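(* Let $(\boldsymbol{\alpha},\boldsymbol{\beta})\in\mathcal{LW}$ be a non-renormalisable pair such that $(\Sigma_{(\boldsymbol{\alpha},\boldsymbol{\beta})},\sigma_{(\boldsymbol{\alpha},\boldsymbol{\beta})})$ is a coded system, and let $\{(\boldsymbol{\alpha}_n,\boldsymbol{\beta}_n)\}_{n=1}^\infty$ be an approximating sequence of essential pairs for $(\boldsymbol{\alpha},\boldsymbol{\beta})$ (as constructed in the context). If there is $N\in\mathbb N$ such that for every $n\ge N$, $${p_1}_{(\boldsymbol{\alpha}_n,\boldsymbol{\beta}_n)}{p_2}_{(\boldsymbol{\alpha}_n,\boldsymbol{\beta}_n)}={p_1}_{(\boldsymbol{\alpha}_N,\boldsymbol{\beta}_N)}{p_2}_{(\boldsymbol{\alpha}_N,\boldsymbol{\beta}_N)},$$ then $(\Sigma_{(\boldsymbol{\alpha},\boldsymbol{\beta})},\sigma_{(\boldsymbol{\alpha},\boldsymbol{\beta})})$ has the specification property.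
   Context: **Basics.** $\mathbb N=\{1,2,\dots\}$, $\Sigma_2=\{0,1\}^{\mathbb N}$, $\sigma$ is the one-sided shift, $\prec,\preccurlyeq$ the lexicographic order. $\Sigma_2^1$ (resp. $\Sigma_2^0$) is the set of sequences with first digit $1$ (resp. $0$). For $(\boldsymbol{\alpha},\boldsymbol{\beta})\in\Sigma_2^1\times\Sigma_2^0$, $\Sigma_{(\boldsymbol{\alpha},\boldsymbol{\beta})}=\{\boldsymbol{x}\in\Sigma_2 : \boldsymbol{\beta}\preccurlyeq\sigma^n(\boldsymbol{x})\preccurlyeq\boldsymbol{\alpha}\ \forall n\ge0\}$ and $\sigma_{(\boldsymbol{\alpha},\boldsymbol{\beta})}$ is the restriction of $\sigma$. $P=\{\boldsymbol{\alpha}\in\Sigma_2^1 : \sigma^n(\boldsymbol{\alpha})\preccurlyeq\boldsymbol{\alpha}\ \forall n\in\mathbb N\}$; with $\bar{\boldsymbol{x}}=(1-x_i)_{i\ge1}$, $\bar P=\{\boldsymbol{x}\in\Sigma_2^0:\bar{\boldsymbol{x}}\in P\}$. $\mathcal{LW}$ is the set of $(\boldsymbol{\alpha},\boldsymbol{\beta})\in P\times\bar P$ with $\sigma^n(\boldsymbol{\alpha})\succcurlyeq\boldsymbol{\beta}$ and $\sigma^n(\boldsymbol{\beta})\preccurlyeq\boldsymbol{\alpha}$ for every $n\in\mathbb N$. Words are finite sequences over $\{0,1\}$, $\ell(\omega)$ is the length. $0\text{-}\max_\omega$ is the lexicographically largest cyclic permutation of $\omega$ beginning with $0$; $1\text{-}\min_\omega$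 the lexicographically smallest one beginning with $1$. $1_{\boldsymbol{\alpha}}$ (resp. $0_{\boldsymbol{\beta}}$) is the largest $n$ such that $1^n$ occurs in $\boldsymbol{\alpha}$ (resp. $0^n$ occurs in $\boldsymbol{\beta}$). $\mathcal L(\Sigma)$ is the set of words of length $\ge1$ occurring in elements of $\Sigma$. **Transitivity, specification, coded.** $\Sigma_{(\boldsymbol{\alpha},\boldsymbol{\beta})}$ is transitive if for all $\omega,\nu\in\mathcal L(\Sigma_{(\boldsymbol{\alpha},\boldsymbol{\beta})})$ there is $\upsilon\in\mathcal L(\Sigma_{(\boldsymbol{\alpha},\boldsymbol{\beta})})$ with $\omega\upsilon\nu\in\mathcal L(\Sigma_{(\boldsymbol{\alpha},\boldsymbol{\beta})})$; it has the specification property if it is transitive and there is $M\in\mathbb N$ such that $\upsilon$ can always be chosen with $\ell(\upsilon)=M$. It is coded if there are transitive lexicographic subshifts of finite type $\Sigma_{(\boldsymbol{\alpha}_n,\boldsymbol{\beta}_n)}\subset\Sigma_{(\boldsymbol{\alpha}_{n+1},\boldsymbol{\beta}_{n+1})}$ ($n\in\mathbb N$) with $\Sigma_{(\boldsymbol{\alpha},\boldsymbol{\beta})}=\overline{\bigcup_n\Sigma_{(\boldsymbol{\alpha}_n,\boldsymbol{\beta}_n)}}$. **Renormalisable.** $(\boldsymbol{\alpha},\boldsymbol{\beta})\in\mathcal{LW}$ is renormalisable if there are words $\omega,\nu$ and sequences $\{n^\omega_i\},\{n^\nu_i\},\{m^\omega_j\},\{m^\nu_j\}\subset\mathbb N\cup\{\infty\}$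 with $\omega=0\text{-}\max_\omega$, $\nu=1\text{-}\min_\nu$, $(0\text{-}\max_\nu)^\infty\prec\omega^\infty$, $\nu^\infty\prec(1\text{-}\min_\omega)^\infty$ (a condition being void if the cyclic permutation does not exist), $\ell(\omega\nu)\ge3$, $0\boldsymbol{\alpha}=\omega\nu^{n^\nu_1}\omega^{n^\omega_1}\nu^{n^\nu_2}\omega^{n^\omega_2}\cdots$ and $1\boldsymbol{\beta}=\nu\omega^{m^\omega_1}\nu^{m^\nu_1}\omega^{m^\omega_2}\nu^{m^\nu_2}\cdots$ (an exponent $\infty$ terminates the expression). It is also called renormalisable (by an infinite sequence) when one of $\omega,\nu$ is an infinite sequence, with $0\boldsymbol{\alpha}=\omega\nu$, $1\boldsymbol{\beta}=\nu$ if $\nu$ is infinite, and $0\boldsymbol{\alpha}=\omega$, $1\boldsymbol{\beta}=\nu\omega$ if $\omega$ is infinite. **Essential pairs and $p_1,p_2$.** $(\boldsymbol{\alpha},\boldsymbol{\beta})\in\mathcal{LW}$ is essential if $\boldsymbol{\alpha},\boldsymbol{\beta}$ are periodic and the pair is not renormalisable. Then $0\boldsymbol{\alpha}=\omega^\infty$, $1\boldsymbol{\beta}=\nu^\infty$ for (shortest) words $\omega=0\text{-}\max_\omega$, $\nu=1\text{-}\min_\nu$; $(\omega,\nu)$ is the associated pair. Write $\omega=\omega_{\boldsymbol{\alpha}}\nu_{\boldsymbol{\alpha}}$ with $1\text{-}\min_\omega=\nu_{\boldsymbol{\alpha}}\omega_{\boldsymbol{\alpha}}$, and $\nu=\nu_{\boldsymbol{\beta}}\omega_{\boldsymbol{\beta}}$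 with $0\text{-}\max_\nu=\omega_{\boldsymbol{\beta}}\nu_{\boldsymbol{\beta}}$, where $\omega_{\boldsymbol{\alpha}},\omega_{\boldsymbol{\beta}}$ begin with $0$ and $\nu_{\boldsymbol{\alpha}},\nu_{\boldsymbol{\beta}}$ begin with $1$. ${p_1}_{(\boldsymbol{\alpha},\boldsymbol{\beta})}$ is the word among $\omega_{\boldsymbol{\alpha}},\omega_{\boldsymbol{\beta}}$ whose infinite repetition is lexicographically larger, and ${p_2}_{(\boldsymbol{\alpha},\boldsymbol{\beta})}$ is the word among $\nu_{\boldsymbol{\alpha}},\nu_{\boldsymbol{\beta}}$ whose infinite repetition is lexicographically smaller (in case of equality, the word with subscript $\boldsymbol{\alpha}$). **Approximating sequence** of a non-renormalisable $(\boldsymbol{\alpha},\boldsymbol{\beta})\in\mathcal{LW}$, $\boldsymbol{\alpha}=(a_i)$, $\boldsymbol{\beta}=(b_i)$. If $\boldsymbol{\alpha}$ is not periodic, take $1_{\boldsymbol{\alpha}}<i_1<i_2<\cdots$ with $a_{i_m}=1$ and put $\boldsymbol{\alpha}^*_m=(a_1\ldots a_{i_m-1}0)^\infty$. If $\boldsymbol{\beta}$ is not periodic, take $0_{\boldsymbol{\beta}}<j_1<j_2<\cdots$ with $b_{j_m}=0$ and put $\boldsymbol{\beta}^*_m=(b_1\ldots b_{j_m-1}1)^\infty$. (i) If only $\boldsymbol{\alpha}$ is non-periodic, $\{\boldsymbol{\alpha}_n\}$ is a subsequence of $\{\boldsymbol{\alpha}^*_m\}$ with terms in $\Sigma_{(\boldsymbol{\alpha},\boldsymbol{\beta})}$,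 converging to $\boldsymbol{\alpha}$, and $\boldsymbol{\beta}_n=\boldsymbol{\beta}$. (ii) If only $\boldsymbol{\beta}$ is non-periodic, symmetrically $\boldsymbol{\alpha}_n=\boldsymbol{\alpha}$ and $\{\boldsymbol{\beta}_n\}$ is a subsequence of $\{\boldsymbol{\beta}^*_m\}$ with terms in $\Sigma_{(\boldsymbol{\alpha},\boldsymbol{\beta})}$ converging to $\boldsymbol{\beta}$. (iii) If both are non-periodic, the $(\boldsymbol{\alpha}_n,\boldsymbol{\beta}_n)$ are taken from $\{(\boldsymbol{\alpha}^*_m,\boldsymbol{\beta}^*_l)\}_{m,l}$ with limit $(\boldsymbol{\alpha},\boldsymbol{\beta})$. (iv) If both are periodic the sequence is constant. In all cases the pairs are in $\mathcal{LW}$ and are chosen to be essential, the $\Sigma_{(\boldsymbol{\alpha}_n,\boldsymbol{\beta}_n)}$ are transitive subshifts of finite type increasing in $n$, and $\Sigma_{(\boldsymbol{\alpha},\boldsymbol{\beta})}=\overline{\bigcup_n\Sigma_{(\boldsymbol{\alpha}_n,\boldsymbol{\beta}_n)}}$. *)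

theory Defs
  imports "HOL-Analysis.Analysis" "HOL-Library.Omega_Words_Fun" "HOL-Library.Fun_Lexorder"
    "HOL-Library.Extended_Nat"
begin

text \<open>
  The digits 0 and 1 are \<^const>\<open>False\<close> and \<^const>\<open>True\<close>. Infinite sequences are
  functions on \<^typ>\<open>nat\<close> (with the notions of Omega_Words_Fun: \<^const>\<open>conc\<close>, \<^const>\<open>iter\<close>,
  \<^const>\<open>suffix\<close>), finite words are lists. Positions count from 0, so the digit $x_i$ is
  \<open>x (i - 1)\<close>, and \<open>suffix n x\<close> is $\sigma^n(x)$. The type \<open>nat \<Rightarrow> bool\<close> carries the product of the
  discrete topologies, so limits and closures are the library's.
\<close>

type_synonym bseq = "bool word"
type_synonym bword = "bool list"

abbreviation lex_less :: "bseq \<Rightarrow> bseq \<Rightarrow> bool" (infix "\<prec>\<^sub>l" 50)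
  where "x \<prec>\<^sub>l y \<equiv> less_fun x y"

abbreviation lex_le :: "bseq \<Rightarrow> bseq \<Rightarrow> bool" (infix "\<preceq>\<^sub>l" 50)
  where "x \<preceq>\<^sub>l y \<equiv> less_fun x y \<or> x = y"

abbreviation zero_cons :: "bseq \<Rightarrow> bseq" where "zero_cons x \<equiv> [False] \<frown> x"
abbreviation one_cons :: "bseq \<Rightarrow> bseq" where "one_cons x \<equiv> [True] \<frown> x"

definition Sigma1 :: "bseq set" where "Sigma1 = {x. x 0 = True}"
definition Sigma0 :: "bseq set" where "Sigma0 = {x. x 0 = False}"

definition lexshift :: "bseq \<Rightarrow> bseq \<Rightarrow> bseq set" where
  "lexshift \<alpha> \<beta> = {x. \<forall>n. \<beta> \<preceq>\<^sub>l suffix n x \<and> suffix n x \<preceq>\<^sub>l \<alpha>}"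

definition mirror :: "bseq \<Rightarrow> bseq" where "mirror x = (\<lambda>i. \<not> x i)"

definition Pset :: "bseq set" where
  "Pset = {\<alpha> \<in> Sigma1. \<forall>n\<ge>1. suffix n \<alpha> \<preceq>\<^sub>l \<alpha>}"

definition Pset_bar :: "bseq set" where
  "Pset_bar = {x \<in> Sigma0. mirror x \<in> Pset}"

definition LW :: "(bseq \<times> bseq) set" where
  "LW = {(\<alpha>, \<beta>). \<alpha> \<in> Pset \<and> \<beta> \<in> Pset_bar \<and>
     (\<forall>n\<ge>1. \<beta> \<preceq>\<^sub>l suffix n \<alpha> \<and> suffix n \<beta> \<preceq>\<^sub>l \<alpha>)}"

definition periodic :: "bseq \<Rightarrow> bool" where
  "periodic x \<longleftrightarrow> (\<exists>p\<ge>1. suffix p x = x)"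

definition occurs :: "bword \<Rightarrow> bseq \<Rightarrow> bool" where
  "occurs w x \<longleftrightarrow> (\<exists>i. subsequence x i (i + length w) = w)"

definition language :: "bseq set \<Rightarrow> bword set" where
  "language S = {w. w \<noteq> [] \<and> (\<exists>x\<in>S. occurs w x)}"

definition begins0 :: "bword \<Rightarrow> bool" where "begins0 w \<longleftrightarrow> w \<noteq> [] \<and> hd w = False"
definition begins1 :: "bword \<Rightarrow> bool" where "begins1 w \<longleftrightarrow> w \<noteq> [] \<and> hd w = True"

text \<open>
  \<open>is_0max w u\<close>: the word 0-max of \<open>w\<close> exists and equals \<open>u\<close>; \<open>is_1min\<close> likewise. They are relations
  because the cyclic permutation need not exist.
\<close>

definition is_0max :: "bword \<Rightarrow> bword \<Rightarrow> bool" where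
  "is_0max w u \<longleftrightarrow> (\<exists>k. u = rotate k w) \<and> begins0 u \<and>
     (\<forall>k. begins0 (rotate k w) \<longrightarrow> rotate k w = u \<or> ord_class.lexordp (rotate k w) u)"

definition is_1min :: "bword \<Rightarrow> bword \<Rightarrow> bool" where
  "is_1min w u \<longleftrightarrow> (\<exists>k. u = rotate k w) \<and> begins1 u \<and>
     (\<forall>k. begins1 (rotate k w) \<longrightarrow> rotate k w = u \<or> ord_class.lexordp u (rotate k w))"

definition transitive_shift :: "bseq set \<Rightarrow> bool" where
  "transitive_shift S \<longleftrightarrow> (\<forall>w\<in>language S. \<forall>v\<in>language S. \<exists>u\<in>language S. w @ u @ v \<in> language S)"

definition specification_property :: "bseq set \<Rightarrow> bool" where
  "specification_property S \<longleftrightarrow> transitive_shift S \<and>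
     (\<exists>M\<ge>1. \<forall>w\<in>language S. \<forall>v\<in>language S.
        \<exists>u\<in>language S. length u = M \<and> w @ u @ v \<in> language S)"

definition finite_type :: "bseq set \<Rightarrow> bool" where
  "finite_type S \<longleftrightarrow> (\<exists>F. finite F \<and> S = {x. \<forall>w\<in>F. \<not> occurs w x})"

definition coded :: "bseq \<Rightarrow> bseq \<Rightarrow> bool" where
  "coded \<alpha> \<beta> \<longleftrightarrow> (\<exists>A B :: nat \<Rightarrow> bseq.
     (\<forall>n. A n \<in> Sigma1 \<and> B n \<in> Sigma0 \<and>
          transitive_shift (lexshift (A n) (B n)) \<and> finite_type (lexshift (A n) (B n)) \<and>
          lexshift (A n) (B n) \<subseteq> lexshift (A (Suc n)) (B (Suc n))) \<and>
     lexshift \<alpha> \<beta> = closure (\<Union>n. lexshift (A n) (B n)))"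

text \<open>
  \<open>blocks u v e k\<close> is the word $u^{e_0} v^{e_1} u^{e_2} v^{e_3} \cdots$ with \<open>k\<close> factors, and
  \<open>is_alternating u v e x\<close> says that \<open>x\<close> is the infinite expression of this form, which ends with the
  first factor whose exponent is \<open>\<infinity>\<close>. Such an \<open>x\<close> is unique for nonempty \<open>u\<close>, \<open>v\<close> and positive exponents.
\<close>

definition blocks :: "bword \<Rightarrow> bword \<Rightarrow> (nat \<Rightarrow> enat) \<Rightarrow> nat \<Rightarrow> bword" where
  "blocks u v e k =
     concat (map (\<lambda>j. concat (replicate (the_enat (e j)) (if even j then u else v))) [0..<k])"

definition is_alternating :: "bword \<Rightarrow> bword \<Rightarrow> (nat \<Rightarrow> enat) \<Rightarrow> bseq \<Rightarrow> bool" where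
  "is_alternating u v e x \<longleftrightarrow> (\<forall>k. (\<forall>j<k. e j \<noteq> \<infinity>) \<longrightarrow>
     (\<exists>y. x = blocks u v e k \<frown> y \<and> (e k = \<infinity> \<longrightarrow> y = (if even k then u else v)\<^sup>\<omega>)))"

text \<open>
  The exponents of \<open>\<nu>\<close> and \<open>\<omega>\<close> in $0\alpha$ are interleaved into one sequence \<open>e\<close>, and those of \<open>\<omega>\<close> and
  \<open>\<nu>\<close> in $1\beta$ into \<open>f\<close>.
\<close>

definition renormalisable_by_words :: "bseq \<Rightarrow> bseq \<Rightarrow> bool" where
  "renormalisable_by_words \<alpha> \<beta> \<longleftrightarrow> (\<exists>(\<omega> :: bword) (\<nu> :: bword) (e :: nat \<Rightarrow> enat) (f :: nat \<Rightarrow> enat) x y.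
     is_0max \<omega> \<omega> \<and> is_1min \<nu> \<nu> \<and>
     (\<forall>u. is_0max \<nu> u \<longrightarrow> u\<^sup>\<omega> \<prec>\<^sub>l \<omega>\<^sup>\<omega>) \<and>
     (\<forall>u. is_1min \<omega> u \<longrightarrow> \<nu>\<^sup>\<omega> \<prec>\<^sub>l u\<^sup>\<omega>) \<and>
     length (\<omega> @ \<nu>) \<ge> 3 \<and>
     (\<forall>i. e i \<ge> 1 \<and> f i \<ge> 1) \<and>
     is_alternating \<nu> \<omega> e x \<and> zero_cons \<alpha> = \<omega> \<frown> x \<and>
     is_alternating \<omega> \<nu> f y \<and> one_cons \<beta> = \<nu> \<frown> y)"

text \<open>
  If one of the two words is infinite, the conditions on its cyclic permutations and infinite repetition
  are void; only the one on the finite word remains.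
\<close>

definition renormalisable_by_sequence :: "bseq \<Rightarrow> bseq \<Rightarrow> bool" where
  "renormalisable_by_sequence \<alpha> \<beta> \<longleftrightarrow>
     (\<exists>(\<omega> :: bword) (\<nu> :: bseq). is_0max \<omega> \<omega> \<and> zero_cons \<alpha> = \<omega> \<frown> \<nu> \<and> one_cons \<beta> = \<nu>) \<or>
     (\<exists>(\<omega> :: bseq) (\<nu> :: bword). is_1min \<nu> \<nu> \<and> zero_cons \<alpha> = \<omega> \<and> one_cons \<beta> = \<nu> \<frown> \<omega>)"

definition renormalisable :: "bseq \<Rightarrow> bseq \<Rightarrow> bool" where
  "renormalisable \<alpha> \<beta> \<longleftrightarrow> renormalisable_by_words \<alpha> \<beta> \<or> renormalisable_by_sequence \<alpha> \<beta>"

definition essential :: "bseq \<Rightarrow> bseq \<Rightarrow> bool" where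
  "essential \<alpha> \<beta> \<longleftrightarrow> (\<alpha>, \<beta>) \<in> LW \<and> periodic \<alpha> \<and> periodic \<beta> \<and> \<not> renormalisable \<alpha> \<beta>"

definition shortest_period_word :: "bseq \<Rightarrow> bword \<Rightarrow> bool" where
  "shortest_period_word x w \<longleftrightarrow> w \<noteq> [] \<and> x = w\<^sup>\<omega> \<and> (\<forall>u. u \<noteq> [] \<and> x = u\<^sup>\<omega> \<longrightarrow> length w \<le> length u)"

definition associated_pair :: "bseq \<Rightarrow> bseq \<Rightarrow> bword \<Rightarrow> bword \<Rightarrow> bool" where
  "associated_pair \<alpha> \<beta> \<omega> \<nu> \<longleftrightarrow>
     shortest_period_word (zero_cons \<alpha>) \<omega> \<and> is_0max \<omega> \<omega> \<and>
     shortest_period_word (one_cons \<beta>) \<nu> \<and> is_1min \<nu> \<nu>"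

text \<open>
  \<open>is_p1_p2 \<alpha> \<beta> p q\<close>: the words $p_1$ and $p_2$ of the pair are \<open>p\<close> and \<open>q\<close>. It is a relation because an
  essential pair with $\alpha = 1^\infty$ or $\beta = 0^\infty$ has no associated pair of words: $01^\infty$
  and $10^\infty$ are not periodic.
\<close>

definition is_p1_p2 :: "bseq \<Rightarrow> bseq \<Rightarrow> bword \<Rightarrow> bword \<Rightarrow> bool" where
  "is_p1_p2 \<alpha> \<beta> p q \<longleftrightarrow> (\<exists>\<omega> \<nu> \<omega>\<^sub>\<alpha> \<nu>\<^sub>\<alpha> \<omega>\<^sub>\<beta> \<nu>\<^sub>\<beta>.
     associated_pair \<alpha> \<beta> \<omega> \<nu> \<and>
     \<omega> = \<omega>\<^sub>\<alpha> @ \<nu>\<^sub>\<alpha> \<and> is_1min \<omega> (\<nu>\<^sub>\<alpha> @ \<omega>\<^sub>\<alpha>) \<and> begins0 \<omega>\<^sub>\<alpha> \<and> begins1 \<nu>\<^sub>\<alpha> \<and>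
     \<nu> = \<nu>\<^sub>\<beta> @ \<omega>\<^sub>\<beta> \<and> is_0max \<nu> (\<omega>\<^sub>\<beta> @ \<nu>\<^sub>\<beta>) \<and> begins0 \<omega>\<^sub>\<beta> \<and> begins1 \<nu>\<^sub>\<beta> \<and>
     p = (if \<omega>\<^sub>\<alpha>\<^sup>\<omega> \<prec>\<^sub>l \<omega>\<^sub>\<beta>\<^sup>\<omega> then \<omega>\<^sub>\<beta> else \<omega>\<^sub>\<alpha>) \<and>
     q = (if \<nu>\<^sub>\<beta>\<^sup>\<omega> \<prec>\<^sub>l \<nu>\<^sub>\<alpha>\<^sup>\<omega> then \<nu>\<^sub>\<beta> else \<nu>\<^sub>\<alpha>))"

definition one_run :: "bseq \<Rightarrow> nat" where
  "one_run \<alpha> = (GREATEST n. occurs (replicate n True) \<alpha>)"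

definition zero_run :: "bseq \<Rightarrow> nat" where
  "zero_run \<beta> = (GREATEST n. occurs (replicate n False) \<beta>)"

text \<open>The positions \<open>i m\<close> count from 1.\<close>

definition is_alpha_star :: "bseq \<Rightarrow> (nat \<Rightarrow> bseq) \<Rightarrow> bool" where
  "is_alpha_star \<alpha> S \<longleftrightarrow> (\<exists>i. strict_mono i \<and>
     (\<forall>m. one_run \<alpha> < i m \<and> \<alpha> (i m - 1) = True \<and> S m = (prefix (i m - 1) \<alpha> @ [False])\<^sup>\<omega>))"

definition is_beta_star :: "bseq \<Rightarrow> (nat \<Rightarrow> bseq) \<Rightarrow> bool" where
  "is_beta_star \<beta> S \<longleftrightarrow> (\<exists>j. strict_mono j \<and>
     (\<forall>m. zero_run \<beta> < j m \<and> \<beta> (j m - 1) = False \<and> S m = (prefix (j m - 1) \<beta> @ [True])\<^sup>\<omega>))"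

definition approximating_sequence :: "bseq \<Rightarrow> bseq \<Rightarrow> (nat \<Rightarrow> bseq) \<Rightarrow> (nat \<Rightarrow> bseq) \<Rightarrow> bool" where
  "approximating_sequence \<alpha> \<beta> A B \<longleftrightarrow>
     (\<not> periodic \<alpha> \<and> periodic \<beta> \<longrightarrow>
        (\<exists>S r. is_alpha_star \<alpha> S \<and> strict_mono (r :: nat \<Rightarrow> nat) \<and> A = S \<circ> r \<and>
               (\<forall>n. A n \<in> lexshift \<alpha> \<beta>) \<and> A \<longlonglongrightarrow> \<alpha> \<and> (\<forall>n. B n = \<beta>))) \<and>
     (periodic \<alpha> \<and> \<not> periodic \<beta> \<longrightarrow>
        (\<exists>S r. is_beta_star \<beta> S \<and> strict_mono (r :: nat \<Rightarrow> nat) \<and> B = S \<circ> r \<and>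
               (\<forall>n. B n \<in> lexshift \<alpha> \<beta>) \<and> B \<longlonglongrightarrow> \<beta> \<and> (\<forall>n. A n = \<alpha>))) \<and>
     (\<not> periodic \<alpha> \<and> \<not> periodic \<beta> \<longrightarrow>
        (\<exists>S T. is_alpha_star \<alpha> S \<and> is_beta_star \<beta> T \<and>
               (\<forall>n. \<exists>m l. A n = S m \<and> B n = T l) \<and> A \<longlonglongrightarrow> \<alpha> \<and> B \<longlonglongrightarrow> \<beta>)) \<and>
     (periodic \<alpha> \<and> periodic \<beta> \<longrightarrow> (\<forall>n. A n = \<alpha> \<and> B n = \<beta>)) \<and>
     (\<forall>n. (A n, B n) \<in> LW \<and> essential (A n) (B n) \<and>
          transitive_shift (lexshift (A n) (B n)) \<and> finite_type (lexshift (A n) (B n)) \<and>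
          lexshift (A n) (B n) \<subseteq> lexshift (A (Suc n)) (B (Suc n))) \<and>
     lexshift \<alpha> \<beta> = closure (\<Union>n. lexshift (A n) (B n))"

end

theory Submission
  imports Defs
begin

text \<open>
  Since the words $p_1 p_2$ are eventually constant, the orbit of \<open>\<alpha>\<close> does not accumulate at \<open>\<beta>\<close>, nor
  conversely: otherwise the word \<open>\<nu>\<^sub>\<alpha>\<close> (or \<open>\<omega>\<^sub>\<beta>\<close>) of the approximating pairs becomes arbitrarily long,
  unless the pair is renormalisable by an infinite sequence, so it is not $p_2$ (or $p_1$), although it
  wins the comparison that defines this word. Hence the
  sequences that may follow a given word form an interval of a size bounded below, and from every word
  a fixed synchronising word can be reached in bounded time. Conversely, the images of the cylinder of
  the synchronising word cover the shift space after finitely many steps; here the transitive subshifts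
  of finite type of the approximation exclude exceptional periodic orbits. It remains to see that the
  return times to the synchronising word have no common divisor \<open>d \<ge> 2\<close>. Otherwise, let the cut words
  be the words \<open>u\<close> such that both \<open>u0\<alpha>\<close> and \<open>u1\<beta>\<close> belong to the shift space. The largest interval of cut
  words around the empty one on which all lengths are divisible by \<open>d\<close> returns to itself along two
  words, and these renormalise \<open>(\<alpha>, \<beta>)\<close>.
\<close>

text \<open>A cut word \<open>u\<close> stands for a gap of the shift space: no point lies strictly
  between \<open>u0\<alpha>\<close> and \<open>u1\<beta>\<close>. Cut words are therefore linearly
  ordered, and their lengths modulo \<open>d\<close> can be compared along this order. A cut word
  whose gap lies close enough to \<open>0\<alpha>\<close> or \<open>1\<beta>\<close> begins with a
  synchronising word, so its length is a multiple of \<open>d\<close>. This is why the class of the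
  empty word has members on both sides, and one return word on each side: these are the two words of
  the renormalisation. Since their lengths are multiples of \<open>d \<ge> 2\<close>, the trivial
  pair 0, 1 does not arise.

  The delicate point is the strictness of the two inequalities between periodic sequences in the
  definition of a renormalisable pair. The order of the classes yields weak inequalities. Equality
  would mean that both return words trace the same periodic orbit, and it is refuted by a path to
  that orbit avoiding both kneading sequences. Such paths also finish the covering argument, where
  the last candidate for an uncovered point is periodic.\<close>

section \<open>Lexicographic orders on sequences, treated symmetrically in the two digits\<close>

abbreviation agree :: "nat \<Rightarrow> bseq \<Rightarrow> bseq \<Rightarrow> bool"
  where "agree m x y \<equiv> \<forall>i<m. x i = y i"

text \<open>
  \<open>dlt False\<close> is the lexicographic order and \<open>dlt True\<close> its reverse. Together with \<open>kn False = \<alpha>\<close> and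
  \<open>kn True = \<beta>\<close> below, every statement about $0\alpha$ and its mirror image about $1\beta$ become the
  two instances of a single statement about a digit \<open>c\<close>.
\<close>

definition dlt :: "bool \<Rightarrow> bseq \<Rightarrow> bseq \<Rightarrow> bool" where
  "dlt c x y \<longleftrightarrow> (\<exists>k. agree k x y \<and> x k = c \<and> y k = (\<not> c))"

definition dle :: "bool \<Rightarrow> bseq \<Rightarrow> bseq \<Rightarrow> bool" where
  "dle c x y \<longleftrightarrow> x = y \<or> dlt c x y"

lemma dlt_less_fun: "dlt c x y \<longleftrightarrow> (if c then y \<prec>\<^sub>l x else x \<prec>\<^sub>l y)"
  unfolding dlt_def less_fun_def
  by (cases c) (simp_all only: if_True if_False less_bool_def, blast+)

lemma dlt_flip: "dlt (\<not> c) x y \<longleftrightarrow> dlt c y x"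
  unfolding dlt_less_fun by auto

lemma dle_flip: "dle (\<not> c) x y \<longleftrightarrow> dle c y x"
  unfolding dle_def dlt_flip by auto

lemma dlt_irrefl [simp]: "\<not> dlt c x x"
  unfolding dlt_def by auto

lemma dle_refl [simp]: "dle c x x"
  unfolding dle_def by auto

lemma dlt_trans: "dlt c x y \<Longrightarrow> dlt c y z \<Longrightarrow> dlt c x z"
  unfolding dlt_less_fun by (cases c) (auto intro: less_fun_trans)

lemma dlt_total: "x = y \<or> dlt c x y \<or> dlt c y x"
proof (cases "x = y")
  case False
  then have ex: "\<exists>k. x k \<noteq> y k" by auto
  define k where "k = (LEAST k. x k \<noteq> y k)"
  have "x k \<noteq> y k" using ex unfolding k_def by (rule LeastI_ex)
  moreover have "agree k x y" unfolding k_def using not_less_Least by blast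
  ultimately show ?thesis unfolding dlt_def by metis
qed simp

lemma dle_trans: "dle c x y \<Longrightarrow> dle c y z \<Longrightarrow> dle c x z"
  unfolding dle_def using dlt_trans by auto

lemma dle_dlt_trans: "dle c x y \<Longrightarrow> dlt c y z \<Longrightarrow> dlt c x z"
  unfolding dle_def using dlt_trans by auto

lemma dle_antisym: "dle c x y \<Longrightarrow> dle c y x \<Longrightarrow> x = y"
  unfolding dle_def using dlt_trans dlt_irrefl by blast

lemma not_dle: "\<not> dle c x y \<longleftrightarrow> dlt c y x"
  by (metis dle_def dlt_irrefl dlt_total dlt_trans)

lemma not_dlt: "\<not> dlt c x y \<longleftrightarrow> dle c y x"
  using not_dle by blast

lemma dlt_heads: "x 0 = c \<Longrightarrow> y 0 = (\<not> c) \<Longrightarrow> dlt c x y"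
  unfolding dlt_def by auto

lemma dle_head: "dle c x y \<Longrightarrow> y 0 = c \<Longrightarrow> x 0 = c"
  unfolding dle_def dlt_def by (metis not_gr_zero)

lemma build_hd: "x 0 = c \<Longrightarrow> c ## suffix 1 x = x"
  by (drule sym) simp

lemma dlt_build [simp]: "dlt c (a ## x) (a ## y) \<longleftrightarrow> dlt c x y"
proof
  assume "dlt c (a ## x) (a ## y)"
  then obtain k where k: "agree k (a ## x) (a ## y)" "(a ## x) k = c" "(a ## y) k = (\<not> c)"
    unfolding dlt_def by auto
  then obtain l where "k = Suc l" by (cases k) auto
  with k have "agree l x y \<and> x l = c \<and> y l = (\<not> c)" by fastforce
  then show "dlt c x y" unfolding dlt_def by auto
next
  assume "dlt c x y"
  then obtain k where k: "agree k x y" "x k = c" "y k = (\<not> c)"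
    unfolding dlt_def by auto
  have "agree (Suc k) (a ## x) (a ## y)"
    using k(1) by (auto simp: less_Suc_eq_0_disj)
  moreover have "(a ## x) (Suc k) = c" "(a ## y) (Suc k) = (\<not> c)" using k by auto
  ultimately show "dlt c (a ## x) (a ## y)" unfolding dlt_def by blast
qed

lemma dlt_conc [simp]: "dlt c (u \<frown> x) (u \<frown> y) \<longleftrightarrow> dlt c x y"
  by (induction u) auto

lemma dle_build [simp]: "dle c (a ## x) (a ## y) \<longleftrightarrow> dle c x y"
  unfolding dle_def by auto

lemma dle_conc [simp]: "dle c (u \<frown> x) (u \<frown> y) \<longleftrightarrow> dle c x y"
  unfolding dle_def by auto

text \<open>Cylinders are intervals of the order; later arguments read off common digits from order
  in this way.\<close>

lemma dle_squeeze:
  assumes "dle c x y" "dle c y z" "agree m x z"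
  shows "agree m x y"
proof (rule ccontr)
  assume na: "\<not> agree m x y"
  then have "dlt c x y" using assms(1) unfolding dle_def by auto
  then obtain k where k: "agree k x y" "x k = c" "y k = (\<not> c)" unfolding dlt_def by auto
  have "k < m" using na k(1) by (meson not_less order.strict_trans2)
  have "agree k z y" using assms(3) k(1) \<open>k < m\<close> by (metis order.strict_trans)
  moreover have "z k = c" using assms(3) k(2) \<open>k < m\<close> by metis
  ultimately have "dlt c z y" using k(3) unfolding dlt_def by blast
  with assms(2) show False using not_dle by blast
qed

lemma prefix_eq_iff: "prefix m x = prefix m y \<longleftrightarrow> agree m x y"
  by (auto simp: list_eq_iff_nth_eq)

lemma agree_conc: "agree m (u \<frown> x) (u \<frown> y) \<longleftrightarrow> agree (m - length u) x y"
proof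
  assume a: "agree m (u \<frown> x) (u \<frown> y)"
  show "agree (m - length u) x y"
  proof (intro allI impI)
    fix i assume "i < m - length u"
    then have "length u + i < m" by simp
    then have "(u \<frown> x) (length u + i) = (u \<frown> y) (length u + i)" using a by blast
    then show "x i = y i" by simp
  qed
next
  assume a: "agree (m - length u) x y"
  show "agree m (u \<frown> x) (u \<frown> y)"
  proof (intro allI impI)
    fix i assume "i < m"
    then show "(u \<frown> x) i = (u \<frown> y) i" using a by (cases "i < length u") auto
  qed
qed

lemma agree_imp_conc: "agree (length u) (u \<frown> x) y \<Longrightarrow> y = u \<frown> suffix (length u) y"
proof -
  assume a: "agree (length u) (u \<frown> x) y"
  have "prefix (length u) (u \<frown> x) = prefix (length u) y"
    using a unfolding prefix_eq_iff .
  then have "prefix (length u) y = u" by simp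
  then show ?thesis using prefix_suffix[of y "length u"] by simp
qed

lemma dlt_agree:
  assumes "dlt c x y"
  obtains k where "x k = c" "y k = (\<not> c)" "\<And>y'. agree (Suc k) y y' \<Longrightarrow> dlt c x y'"
    "\<And>x'. agree (Suc k) x x' \<Longrightarrow> dlt c x' y"
proof -
  obtain k where k: "agree k x y" "x k = c" "y k = (\<not> c)" using assms unfolding dlt_def by auto
  show thesis
  proof (rule that[of k])
    show "x k = c" "y k = (\<not> c)" using k by auto
    show "dlt c x y'" if "agree (Suc k) y y'" for y'
      unfolding dlt_def using k that by (metis less_Suc_eq)
    show "dlt c x' y" if "agree (Suc k) x x'" for x'
      unfolding dlt_def using k that by (metis less_Suc_eq)
  qed
qed

text \<open>The initial run of \<open>\<not> c\<close> becomes longer by one digit, which moves the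
  sequence away from \<open>c\<close>.\<close>

lemma dle_build_self:
  assumes "x 0 = (\<not> c)"
  shows "dle c x ((\<not> c) ## x)"
proof (cases "\<exists>k. x k = c")
  case True
  define k where "k = (LEAST k. x k = c)"
  have k: "x k = c" unfolding k_def using True by (rule LeastI_ex)
  have less: "x i = (\<not> c)" if "i < k" for i
    using not_less_Least[OF that[unfolded k_def]] by blast
  have "k > 0" using k assms by (cases k) auto
  have "((\<not> c) ## x) i = (\<not> c)" if "i \<le> k" for i using that less by (cases i) auto
  then have "((\<not> c) ## x) k = (\<not> c)" "agree k x ((\<not> c) ## x)"
    using less by (blast, metis less_imp_le)
  with k show ?thesis unfolding dle_def dlt_def by blast
next
  case False
  then have x: "x i = (\<not> c)" for i by blast
  have "((\<not> c) ## x) i = x i" for i by (cases i) (simp_all only: build.simps x)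
  then have "(\<not> c) ## x = x" by blast
  then show ?thesis by simp
qed

section \<open>Lexicographic subshifts and cut words\<close>

definition lexset :: "(bool \<Rightarrow> bseq) \<Rightarrow> bseq set" where
  "lexset kn = {x. \<forall>n c. dle c (suffix n x) (kn c)}"

lemma lexset_lexshift: "lexset (\<lambda>c. if c then \<beta> else \<alpha>) = lexshift \<alpha> \<beta>"
  unfolding lexset_def lexshift_def dle_def dlt_less_fun all_bool_eq by auto

lemma lexset_suffix: "x \<in> lexset kn \<Longrightarrow> suffix n x \<in> lexset kn"
  unfolding lexset_def by auto

lemma lexset_dle: "x \<in> lexset kn \<Longrightarrow> dle c x (kn c)"
  unfolding lexset_def by (auto dest: spec[of _ 0])

text \<open>A violated bound is a strict inequality, which finitely many digits decide.\<close>

lemma lexset_closed: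
  assumes "\<And>m. \<exists>y\<in>lexset kn. agree m x y"
  shows "x \<in> lexset kn"
proof -
  have "dle c (suffix n x) (kn c)" for n c
  proof (rule ccontr)
    assume "\<not> dle c (suffix n x) (kn c)"
    then have "dlt c (kn c) (suffix n x)" using not_dle by blast
    then obtain k where k: "\<And>y'. agree (Suc k) (suffix n x) y' \<Longrightarrow> dlt c (kn c) y'"
      using dlt_agree by metis
    obtain y where y: "y \<in> lexset kn" "agree (n + Suc k) x y" using assms by blast
    then have "agree (Suc k) (suffix n x) (suffix n y)" by auto
    then have "dlt c (kn c) (suffix n y)" using k by blast
    moreover have "dle c (suffix n y) (kn c)" using y(1) unfolding lexset_def by auto
    ultimately show False using not_dle by blast
  qed
  then show ?thesis unfolding lexset_def by auto
qed

lemma lexset_conc_iff: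
  "u \<frown> x \<in> lexset kn \<longleftrightarrow> x \<in> lexset kn \<and> (\<forall>k\<le>length u. \<forall>c. dle c (drop k u \<frown> x) (kn c))"
  (is "?l \<longleftrightarrow> ?r")
proof
  assume l: ?l
  have "x \<in> lexset kn" using lexset_suffix[OF l, of "length u"] by simp
  moreover have "dle c (drop k u \<frown> x) (kn c)" if "k \<le> length u" for k c
    using lexset_dle[OF lexset_suffix[OF l, of k], of c] that by simp
  ultimately show ?r by auto
next
  assume r: ?r
  have "dle c (suffix n (u \<frown> x)) (kn c)" for n c
  proof (cases "n \<le> length u")
    case True then show ?thesis using r by simp
  next
    case False
    then show ?thesis using r unfolding lexset_def by simp
  qed
  then show ?l unfolding lexset_def by auto
qed

lemma lexset_conc_D: "u \<frown> x \<in> lexset kn \<Longrightarrow> x \<in> lexset kn"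
  using lexset_conc_iff by blast

lemma lexset_build_iff:
  "b ## x \<in> lexset kn \<longleftrightarrow> x \<in> lexset kn \<and> (\<forall>c. dle c (b ## x) (kn c))"
  using lexset_conc_iff[of "[b]" x kn]
  by (auto simp: le_Suc_eq lexset_dle)

text \<open>Prefixing a word preserves the order, so each bound on \<open>y\<close> follows from the
  same bound on one of the two outer points.\<close>

lemma lexset_conc_convex:
  assumes "u \<frown> x \<in> lexset kn" "u \<frown> z \<in> lexset kn" "y \<in> lexset kn" "dle c x y" "dle c y z"
  shows "u \<frown> y \<in> lexset kn"
proof -
  have "dle d (drop k u \<frown> y) (kn d)" if "k \<le> length u" for k d
  proof -
    have "dle d (drop k u \<frown> x) (kn d)" "dle d (drop k u \<frown> z) (kn d)"
      using assms(1,2) that lexset_conc_iff by blast+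
    moreover have "dle d y x \<or> dle d y z"
      using assms(4,5) dle_flip[of c] by (cases "d = c") auto
    ultimately show ?thesis by (metis dle_conc dle_trans)
  qed
  then show ?thesis using assms(3) lexset_conc_iff by blast
qed

locale kneading =
  fixes kn :: "bool \<Rightarrow> bseq"
  assumes kn_0 [simp]: "kn c 0 = (\<not> c)"
    and kn_mem: "kn c \<in> lexset kn"
begin

definition language_prefix :: "bword \<Rightarrow> bool" where
  "language_prefix u \<longleftrightarrow> (\<exists>x. u \<frown> x \<in> lexset kn)"

definition cut :: "bword \<Rightarrow> bool" where
  "cut u \<longleftrightarrow> (\<forall>c. u \<frown> c ## kn c \<in> lexset kn)"

lemma language_prefixI: "u \<frown> x \<in> lexset kn \<Longrightarrow> language_prefix u"
  unfolding language_prefix_def by auto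

text \<open>Besides \<open>kn c\<close>, the bound to check is \<open>kn (\<not> c)\<close>. It
  begins with \<open>c\<close> as well, and its tail is bounded by \<open>kn c\<close>.\<close>

lemma K_mem: "c ## kn c \<in> lexset kn"
proof -
  have "dle d (c ## kn c) (kn d)" for d
  proof (cases "d = c")
    case True
    then show ?thesis by (auto intro!: dlt_heads simp: dle_def)
  next
    case False
    then have d: "d = (\<not> c)" by auto
    have "dle c (suffix 1 (kn d)) (kn c)" using kn_mem unfolding lexset_def by blast
    then have "dle c (c ## suffix 1 (kn d)) (c ## kn c)" by simp
    moreover have "c ## suffix 1 (kn d) = kn d" by (rule build_hd) (simp add: d)
    ultimately have "dle c (kn d) (c ## kn c)" by (simp only:)
    then show ?thesis by (simp add: d dle_flip)
  qed
  then show ?thesis using lexset_build_iff kn_mem by blast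
qed

lemma dle_K: "x \<in> lexset kn \<Longrightarrow> x 0 = c \<Longrightarrow> dle c x (c ## kn c)"
proof -
  assume x: "x \<in> lexset kn" "x 0 = c"
  have "dle c (suffix 1 x) (kn c)" using x(1) unfolding lexset_def by blast
  then have "dle c (c ## suffix 1 x) (c ## kn c)" by simp
  then show ?thesis by (simp only: build_hd[where x = x and c = c, OF x(2)])
qed

lemma cut_Nil: "cut []"
  unfolding cut_def using K_mem by simp

text \<open>The followers of \<open>u\<close> form an interval. If it meets both first digits, it
  contains both ends of the gap between them.\<close>

lemma cutI:
  assumes "u \<frown> x \<in> lexset kn" "u \<frown> y \<in> lexset kn" "x 0 \<noteq> y 0"
  shows "cut u"
  unfolding cut_def
proof
  fix c
  obtain x' y' where xy: "u \<frown> x' \<in> lexset kn" "u \<frown> y' \<in> lexset kn" "x' 0 = c" "y' 0 = (\<not> c)"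
    using assms by (cases "x 0 = c") auto
  show "u \<frown> c ## kn c \<in> lexset kn"
  proof (rule lexset_conc_convex[OF xy(1,2) K_mem])
    show "dle c x' (c ## kn c)" using xy dle_K lexset_conc_D by blast
    show "dle c (c ## kn c) y'" unfolding dle_def using xy by (auto intro: dlt_heads)
  qed
qed

lemma cut_appendD: "cut (u @ v) \<Longrightarrow> cut v"
  unfolding cut_def conc_conc[symmetric] using lexset_conc_D by blast

lemma cut_ConsD: "cut (b # v) \<Longrightarrow> cut v"
  using cut_appendD[of "[b]" v] by simp

text \<open>
  The sequences that may follow \<open>u\<close> form an interval whose end in direction \<open>c\<close> is the tail of \<open>kn c\<close>
  after the longest suffix of \<open>u\<close> that is a prefix of \<open>kn c\<close>.
\<close>

lemma follower_end:
  assumes "language_prefix u"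
  obtains i where "i \<le> length u" "drop (length u - i) u = prefix i (kn c)"
    "u \<frown> suffix i (kn c) \<in> lexset kn"
    "\<And>x. u \<frown> x \<in> lexset kn \<Longrightarrow> dle c x (suffix i (kn c))"
proof -
  define P where "P i \<longleftrightarrow> i \<le> length u \<and> drop (length u - i) u = prefix i (kn c)" for i
  define i where "i = Greatest P"
  have P0: "P 0" unfolding P_def by simp
  have Pi: "P i" unfolding i_def by (rule GreatestI_nat[of P 0 "length u"]) (use P0 P_def in auto)
  have Pmax: "j \<le> i" if "P j" for j
    unfolding i_def by (rule Greatest_le_nat[of P j "length u"]) (use that P_def in auto)
  let ?z = "suffix i (kn c)"
  have max: "dle c x ?z" if "u \<frown> x \<in> lexset kn" for x
  proof -
    have "dle c (drop (length u - i) u \<frown> x) (kn c)"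
      using that lexset_conc_iff by auto
    moreover have "kn c = drop (length u - i) u \<frown> ?z" using Pi unfolding P_def by simp
    ultimately have "dle c (drop (length u - i) u \<frown> x) (drop (length u - i) u \<frown> ?z)" by (simp only:)
    then show ?thesis by (simp only: dle_conc)
  qed
  obtain x where x: "u \<frown> x \<in> lexset kn" using assms unfolding language_prefix_def by auto
  have "dle d (drop k u \<frown> ?z) (kn d)" if k: "k \<le> length u" for k d
  proof (cases "d = c")
    case True
    let ?s = "drop k u"
    have le: "dle c (?s \<frown> x) (kn c)" using x k lexset_conc_iff by blast
    show ?thesis
    proof (cases "?s = prefix (length ?s) (kn c)")
      \<comment> \<open>A match no longer than the maximal one sits at its end, so the whole
        sequence is again a tail of \<open>kn c\<close>.\<close>
      case True
      then have "P (length ?s)" unfolding P_def using k by simp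
      then have li: "length ?s \<le> i" using Pmax by blast
      have "i - length ?s + (length u - i) = k"
        using li Pi k unfolding P_def by simp
      then have "?s = drop (i - length ?s) (drop (length u - i) u)"
        by (simp only: drop_drop)
      also have "\<dots> = drop (i - length ?s) (prefix i (kn c))" using Pi unfolding P_def by simp
      finally have s: "?s = kn c [i - length ?s \<rightarrow> i]" by simp
      have "?s \<frown> ?z = suffix (i - length ?s) (kn c)"
        by (subst s) (rule suffix_subseq_join, simp)
      then show ?thesis using kn_mem \<open>d = c\<close> unfolding lexset_def by auto
    next
      \<comment> \<open>A mismatch makes the inequality strict already inside \<open>?s\<close>,
        whatever follows.\<close>
      case False
      have "?s \<frown> x \<noteq> kn c"
        using False prefix_conc_length[of ?s x] by fastforce
      then have "dlt c (?s \<frown> x) (kn c)" using le unfolding dle_def by auto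
      then obtain l where l: "agree l (?s \<frown> x) (kn c)" "(?s \<frown> x) l = c" "kn c l = (\<not> c)"
        unfolding dlt_def by auto
      have "l < length ?s"
      proof (rule ccontr)
        assume "\<not> l < length ?s"
        then have "agree (length ?s) (?s \<frown> x) (kn c)" using l(1) by (meson not_less less_le_trans)
        then have "prefix (length ?s) (?s \<frown> x) = prefix (length ?s) (kn c)"
          unfolding prefix_eq_iff .
        then show False using False by simp
      qed
      then have "(?s \<frown> ?z) i = (?s \<frown> x) i" if "i \<le> l" for i
        using that by (simp only: conc_def) (simp del: length_drop)
      then have "agree l (?s \<frown> ?z) (kn c) \<and> (?s \<frown> ?z) l = c" using l(1,2) by (metis less_imp_le order_refl)
      then show ?thesis using l(3) \<open>d = c\<close> unfolding dle_def dlt_def by blast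
    qed
  next
    case False
    then have d: "d = (\<not> c)" by auto
    have "dle d (drop k u \<frown> ?z) (drop k u \<frown> x)" using max[OF x] by (simp add: d dle_flip)
    moreover have "dle d (drop k u \<frown> x) (kn d)" using x k lexset_conc_iff by blast
    ultimately show ?thesis using dle_trans by blast
  qed
  then have "u \<frown> ?z \<in> lexset kn" using lexset_conc_iff lexset_suffix[OF kn_mem] by blast
  then show thesis using that[of i] Pi max unfolding P_def by blast
qed

end

section \<open>Covering by the images of one cylinder\<close>

text \<open>Compactness for a decreasing family of nonempty sets. The prefix grows by digits that
  stay compatible with every \<open>T\<close>.\<close>

lemma boolean_koenig:
  fixes Q :: "nat \<Rightarrow> bseq \<Rightarrow> bool"
  assumes ex: "\<And>T. \<exists>y. Q T y" and anti: "\<And>T T' y. T \<le> T' \<Longrightarrow> Q T' y \<Longrightarrow> Q T y"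
  obtains x where "\<And>T m. \<exists>y. agree m x y \<and> Q T y"
proof -
  define P where "P u \<longleftrightarrow> (\<forall>T. \<exists>y. Q T (u \<frown> y))" for u
  have step: "\<exists>b. P (u @ [b])" if "P u" for u
  proof (rule ccontr)
    assume "\<not> ?thesis"
    then have "\<exists>T. \<forall>y. \<not> Q T ((u @ [b]) \<frown> y)" for b unfolding P_def by blast
    then obtain T where T: "\<not> Q (T b) ((u @ [b]) \<frown> y)" for b y by metis
    obtain y where y: "Q (max (T True) (T False)) (u \<frown> y)" using \<open>P u\<close> unfolding P_def by blast
    have "T (y 0) \<le> max (T True) (T False)" by (cases "y 0") auto
    then have "Q (T (y 0)) (u \<frown> y)" using y anti by blast
    moreover have "u \<frown> y = (u @ [y 0]) \<frown> suffix 1 y" by simp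
    ultimately show False using T by metis
  qed
  define w where "w = rec_nat [] (\<lambda>_ v. v @ [SOME b. P (v @ [b])])"
  have w0: "w 0 = []" and wS: "w (Suc n) = w n @ [SOME b. P (w n @ [b])]" for n
    unfolding w_def by auto
  have Pw: "P (w n)" for n
  proof (induction n)
    case 0 then show ?case unfolding w0 P_def using ex by simp
  next
    case (Suc n) then show ?case unfolding wS using someI_ex[OF step] by blast
  qed
  define x where "x n = (SOME b. P (w n @ [b]))" for n
  have wx: "w n = prefix n x" for n
    by (induction n) (auto simp: w0 wS x_def)
  have "\<exists>y. agree m x y \<and> Q T y" for T m
  proof -
    obtain y where "Q T (prefix m x \<frown> y)" using Pw[of m] unfolding P_def wx by blast
    moreover have "agree m x (prefix m x \<frown> y)" by simp
    ultimately show ?thesis by blast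
  qed
  then show thesis using that by blast
qed

lemma bool_frequent:
  fixes b :: "nat \<Rightarrow> bool"
  obtains b' where "\<And>m. \<exists>n\<ge>m. b n = b'"
proof (cases "\<forall>m. \<exists>n\<ge>m. b n")
  case True
  then show thesis using that[of True] by simp
next
  case False
  then obtain m0 where "\<not> b n" if "n \<ge> m0" for n by blast
  then show thesis using that[of False] by (meson max.cobounded1 max.cobounded2)
qed

lemma finite_no_chain:
  assumes "\<And>x y z. x \<in> S \<Longrightarrow> y \<in> S \<Longrightarrow> z \<in> S \<Longrightarrow> dlt c x y \<Longrightarrow> dlt c y z \<Longrightarrow> False"
  shows "finite S"
proof (rule ccontr)
  assume inf: "infinite S"
  obtain B where B: "card B = 3" "B \<subseteq> S" using infinite_arbitrarily_large[OF inf] by blast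
  then obtain x y z where "B = {x, y, z}" "x \<noteq> y" "y \<noteq> z" "x \<noteq> z" unfolding card_3_iff by auto
  then have x: "x \<in> S" and y: "y \<in> S" "y \<noteq> x" and z: "z \<in> S" "z \<noteq> x" "z \<noteq> y" using B(2) by auto
  show False
    using assms x y z dlt_total[of x y c] dlt_total[of x z c] dlt_total[of y z c] by metis
qed

section \<open>Separated kneading sequences and the synchronising word\<close>

locale separated_kneading = kneading +
  fixes J :: nat
  assumes separated: "\<And>n c. \<not> agree J (suffix n (kn c)) (kn (\<not> c))"
begin

text \<open>By \<open>follower_end\<close> the followers of \<open>u\<close> range between tails of
  the two kneading sequences. If these tails shared \<open>J\<close> digits, one kneading sequence
  would contain the first \<open>J\<close> digits of the other. So they part earlier, and the word
  up to their first difference gives a cut.\<close>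

lemma cut_extend:
  assumes "language_prefix u"
  obtains w where "length w < J" "cut (u @ w)"
proof -
  have "\<exists>i. i \<le> length u \<and> drop (length u - i) u = prefix i (kn c) \<and>
      u \<frown> suffix i (kn c) \<in> lexset kn" for c
    by (rule follower_end[OF assms, of c]) blast
  then have "\<exists>i. \<forall>c. i c \<le> length u \<and> drop (length u - i c) u = prefix (i c) (kn c) \<and>
      u \<frown> suffix (i c) (kn c) \<in> lexset kn"
    by (intro choice allI)
  then obtain i where "\<forall>c. i c \<le> length u \<and> drop (length u - i c) u = prefix (i c) (kn c) \<and>
      u \<frown> suffix (i c) (kn c) \<in> lexset kn" ..
  then have i: "i c \<le> length u" "drop (length u - i c) u = prefix (i c) (kn c)"
    "u \<frown> suffix (i c) (kn c) \<in> lexset kn" for c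
    by blast+
  have nth: "kn c l = u ! (length u - i c + l)" if "l < i c" for c l
  proof -
    have "drop (length u - i c) u ! l = prefix (i c) (kn c) ! l" by (simp only: i(2))
    then show ?thesis using that i(1)[of c] by simp
  qed
  have "\<exists>c. i (\<not> c) \<le> i c" 
  proof (cases "i True \<le> i False")
    case True
    then have "i (\<not> False) \<le> i False" by simp
    then show ?thesis by blast
  next
    case False
    then have "i (\<not> True) \<le> i True" by simp
    then show ?thesis by blast
  qed
  \<comment> \<open>The shorter match is a suffix of the longer one, so a prefix of
    \<open>kn (\<not> c)\<close> can be read inside \<open>kn c\<close>.\<close>
  then obtain c where c: "i (\<not> c) \<le> i c" by auto
  let ?z = "suffix (i c) (kn c)" and ?z' = "suffix (i (\<not> c)) (kn (\<not> c))"
  have "\<not> agree J ?z ?z'"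
  proof
    assume ag: "agree J ?z ?z'"
    have "agree J (suffix (i c - i (\<not> c)) (kn c)) (kn (\<not> c))"
    proof (intro allI impI)
      fix l assume l: "l < J"
      show "suffix (i c - i (\<not> c)) (kn c) l = kn (\<not> c) l"
      proof (cases "l < i (\<not> c)")
        case True
        then have "kn c (i c - i (\<not> c) + l) = u ! (length u - i c + (i c - i (\<not> c) + l))"
          using c by (intro nth) simp
        also have "length u - i c + (i c - i (\<not> c) + l) = length u - i (\<not> c) + l"
          using c i(1)[of c] by simp
        finally show ?thesis using nth[OF True] by simp
      next
        case False
        then have "l - i (\<not> c) < J" using l by simp
        then have "?z (l - i (\<not> c)) = ?z' (l - i (\<not> c))" using ag by blast
        then show ?thesis using False c by simp
      qed
    qed
    then show False using separated by blast
  qed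
  then obtain l where l: "?z l \<noteq> ?z' l" "l < J" by blast
  define k where "k = (LEAST k. ?z k \<noteq> ?z' k)"
  have k: "?z k \<noteq> ?z' k" unfolding k_def by (rule LeastI) (rule l(1))
  have "k \<le> l" unfolding k_def by (rule Least_le) (rule l(1))
  then have kJ: "k < J" using l(2) by simp
  have ag: "agree k ?z ?z'" unfolding k_def using not_less_Least by blast
  let ?w = "prefix k ?z"
  have pz: "?w \<frown> suffix k ?z = ?z" by (rule prefix_suffix[symmetric])
  have "?w = prefix k ?z'" using ag by (simp only: prefix_eq_iff)
  then have pz': "?w \<frown> suffix k ?z' = ?z'" by (simp only: prefix_suffix[symmetric])
  have "cut (u @ ?w)"
  proof (rule cutI)
    show "(u @ ?w) \<frown> suffix k ?z \<in> lexset kn" using i(3) by (simp only: conc_conc[symmetric] pz)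
    show "(u @ ?w) \<frown> suffix k ?z' \<in> lexset kn" using i(3) by (simp only: conc_conc[symmetric] pz')
    show "suffix k ?z 0 \<noteq> suffix k ?z' 0" using k by simp
  qed
  moreover have "length ?w < J" using kJ by simp
  ultimately show thesis using that by blast
qed

text \<open>The synchronising word: the first \<open>Suc J\<close> digits of
  \<open>c ## kn c\<close>, an end of the gap of the empty cut word.\<close>

abbreviation hub :: "bool \<Rightarrow> bword" where "hub c \<equiv> c # prefix J (kn c)"

lemma hub_agree: "agree (Suc J) (hub c \<frown> x) (c ## kn c)"
proof (intro allI impI)
  fix i assume "i < Suc J"
  then show "(hub c \<frown> x) i = (c ## kn c) i" by (cases i) auto
qed

lemma hub_language: "language_prefix (hub c)"
proof -
  have "hub c \<frown> suffix J (kn c) = c ## kn c" by simp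
  then show ?thesis using K_mem language_prefixI by metis
qed

text \<open>A new violation would show \<open>J\<close> digits of \<open>kn c\<close> inside \<open>kn (\<not> c)\<close>.\<close>

lemma cut_synchronises:
  assumes u: "cut u" and y: "y \<in> lexset kn" "agree (Suc J) y (c ## kn c)"
  shows "u \<frown> y \<in> lexset kn"
proof -
  have y0: "y 0 = c" using y(2)[rule_format, of 0] by simp
  let ?K = "c ## kn c"
  have yK: "dle c y ?K" using dle_K[OF y(1) y0] .
  have "dle d (drop k u \<frown> y) (kn d)" if k: "k \<le> length u" for k d
  proof -
    let ?s = "drop k u"
    have K: "dle d (?s \<frown> ?K) (kn d)" for d
      using u k lexset_conc_iff unfolding cut_def by blast
    show ?thesis
    proof (cases "d = c")
      case True
      have "dle c (?s \<frown> y) (?s \<frown> ?K)" using yK by (simp only: dle_conc)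
      then show ?thesis using K[of c] dle_trans True by blast
    next
      case False
      then have d: "d = (\<not> c)" by auto
      show ?thesis
      proof (rule ccontr)
        assume "\<not> ?thesis"
        \<comment> \<open>The bound \<open>kn d\<close> would be caught between two sequences that
          share \<open>length ?s + Suc J\<close> digits.\<close>
        then have "dlt c (?s \<frown> y) (kn d)" unfolding not_dle by (simp add: d dlt_flip)
        then have 1: "dle c (?s \<frown> y) (kn d)" unfolding dle_def by simp
        have 2: "dle c (kn d) (?s \<frown> ?K)" using K[of d] by (simp add: d dle_flip)
        have 3: "agree (length ?s + Suc J) (?s \<frown> y) (?s \<frown> ?K)"
          unfolding agree_conc using y(2) by (simp only: add_diff_cancel_left')
        have 4: "agree (length ?s + Suc J) (?s \<frown> y) (kn d)"
          by (rule dle_squeeze[OF 1 2 3])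
        have "agree J (suffix (Suc (length ?s)) (kn d)) (kn c)"
        proof (intro allI impI)
          fix i assume i: "i < J"
          then have "length ?s + Suc i < length ?s + Suc J" by simp
          then have "(?s \<frown> y) (length ?s + Suc i) = kn d (length ?s + Suc i)" using 4 by blast
          moreover have "(?s \<frown> y) (length ?s + Suc i) = y (Suc i)" by (simp only: conc_def) simp
          moreover have "y (Suc i) = kn c i" using y(2)[rule_format, of "Suc i"] i by simp
          ultimately show "suffix (Suc (length ?s)) (kn d) i = kn c i"
            by (simp only: suffix_nth add_Suc_right add_Suc)
        qed
        then show False using separated[of "Suc (length ?s)" d] unfolding d not_not by blast
      qed
    qed
  qed
  then show ?thesis using y(1) lexset_conc_iff by blast
qed

end

locale coded_kneading = separated_kneading +
  assumes transitive: "\<And>u v. u \<noteq> [] \<Longrightarrow> v \<noteq> [] \<Longrightarrow> language_prefix u \<Longrightarrow> language_prefix v \<Longrightarrow>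
      \<exists>t. t \<noteq> [] \<and> language_prefix (u @ t @ v)"
    and reaches_periodic: "\<And>x u. x \<in> lexset kn \<Longrightarrow> periodic x \<Longrightarrow> (\<And>n c. suffix n x \<noteq> kn c) \<Longrightarrow>
      u \<noteq> [] \<Longrightarrow> language_prefix u \<Longrightarrow>
      \<exists>t. (u @ t) \<frown> x \<in> lexset kn \<and> (\<forall>n c. suffix n ((u @ t) \<frown> x) \<noteq> kn c)"
begin

text \<open>Transitivity puts a word before each prefix of \<open>y\<close>. One of the two digits
  is its last letter for arbitrarily long prefixes, and the space is closed.\<close>

lemma predecessor:
  assumes y: "y \<in> lexset kn"
  obtains b where "b ## y \<in> lexset kn"
proof -
  have "\<exists>b z. b ## z \<in> lexset kn \<and> agree m y z" for m
  proof -
    have "prefix (Suc m) y \<frown> suffix (Suc m) y \<in> lexset kn" using y by (metis prefix_suffix)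
    then have "language_prefix (prefix (Suc m) y)" using language_prefixI by blast
    then obtain t where t: "t \<noteq> []" "language_prefix (hub False @ t @ prefix (Suc m) y)"
      using transitive[of "hub False" "prefix (Suc m) y"] hub_language by auto
    then obtain x where "(hub False @ t @ prefix (Suc m) y) \<frown> x \<in> lexset kn"
      unfolding language_prefix_def by auto
    moreover have "hub False @ t @ prefix (Suc m) y = (hub False @ butlast t) @ last t # prefix (Suc m) y"
      using t(1) by simp
    ultimately have "(hub False @ butlast t) \<frown> (last t ## (prefix (Suc m) y \<frown> x)) \<in> lexset kn"
      by (metis build_append)
    then have "last t ## (prefix (Suc m) y \<frown> x) \<in> lexset kn" using lexset_conc_D by blast
    moreover have "agree m y (prefix (Suc m) y \<frown> x)" by simp
    ultimately show ?thesis by blast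
  qed
  then obtain b z where bz: "b m ## z m \<in> lexset kn" "agree m y (z m)" for m by metis
  obtain b' where b': "\<And>m. \<exists>m'\<ge>m. b m' = b'" using bool_frequent by blast
  have "b' ## y \<in> lexset kn"
  proof (rule lexset_closed)
    fix m
    obtain m' where m': "m' \<ge> m" "b m' = b'" using b' by blast
    have "agree m (b' ## y) (b' ## z m')"
    proof (intro allI impI)
      fix i assume "i < m"
      then show "(b' ## y) i = (b' ## z m') i" using bz(2)[of m'] m'(1)
        by (cases i) (simp_all only: build.simps)
    qed
    then show "\<exists>w\<in>lexset kn. agree m (b' ## y) w" using bz(1)[of m'] m'(2) by blast
  qed
  then show thesis using that by blast
qed

end

lemma dlt_neighbourhood:
  assumes "dlt c x y"
  obtains m where "\<And>x' y'. agree m x x' \<Longrightarrow> agree m y y' \<Longrightarrow> dlt c x' y'"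
proof -
  obtain k where k: "agree k x y" "x k = c" "y k = (\<not> c)" using assms unfolding dlt_def by auto
  have "dlt c x' y'" if "agree (Suc k) x x'" "agree (Suc k) y y'" for x' y'
    unfolding dlt_def using k that by (metis less_Suc_eq)
  then show thesis using that by blast
qed

lemma agree_mono: "agree m x y \<Longrightarrow> n \<le> m \<Longrightarrow> agree n x y"
  using less_le_trans by blast

lemma agree_sym: "agree m x y \<Longrightarrow> agree m y x"
  by metis

lemma agree_trans: "agree m x y \<Longrightarrow> agree m y z \<Longrightarrow> agree m x z"
  by metis

lemma agree_build: "agree m x y \<Longrightarrow> agree (Suc m) (b ## x) (b ## y)"
proof (intro allI impI)
  fix i assume "agree m x y" "i < Suc m"
  then show "(b ## x) i = (b ## y) i"
    by (cases i) (simp_all only: build.simps Suc_less_eq)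
qed

context coded_kneading
begin

text \<open>A cut reached in fewer than \<open>J\<close> digits leaves the next digit free; it is
  chosen against \<open>x\<close>.\<close>

lemma cut_extend_away:
  assumes "language_prefix u"
  obtains p where "u \<frown> p \<in> lexset kn" "\<not> agree J x p"
proof -
  obtain w where w: "length w < J" "cut (u @ w)" using cut_extend[OF assms] .
  let ?d = "\<not> x (length w)"
  let ?p = "w \<frown> ?d ## kn ?d"
  have "u \<frown> ?p \<in> lexset kn" using w(2) unfolding cut_def conc_conc[symmetric] by blast
  moreover have "?p (length w) = ?d" by (simp only: conc_def) simp
  ultimately show thesis using that[of ?p] w(1) by blast
qed

text \<open>
  Consider the points that can be approximated, for every \<open>T\<close>, by points not reached from \<open>a\<close> within
  \<open>T\<close> steps. The images of the cylinder of \<open>a\<close> are intervals which are not contained in a cylinder of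
  length \<open>J\<close>, so each such cylinder contains at most two of these points. They are closed under taking
  some preimage, hence contain a periodic orbit. This orbit avoids both \<open>kn c\<close>, and therefore some
  image of the cylinder of \<open>a\<close> is a neighbourhood of it.
\<close>

lemma covering:
  assumes a: "a \<noteq> []" "language_prefix a"
  shows "\<exists>T. \<forall>x\<in>lexset kn. \<exists>t. length t \<le> T \<and> (a @ t) \<frown> x \<in> lexset kn"
proof (rule ccontr)
  define R where "R T y \<longleftrightarrow> (\<exists>t. length t \<le> T \<and> (a @ t) \<frown> y \<in> lexset kn)" for T y
  assume "\<not> ?thesis"
  then have un: "\<exists>x. x \<in> lexset kn \<and> \<not> R T x" for T unfolding R_def by blast
  have R_mono: "R T' y" if "R T y" "T \<le> T'" for T T' y
    using that le_trans unfolding R_def by blast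
  define E where "E = {x \<in> lexset kn. \<forall>T m. \<exists>y\<in>lexset kn. agree m x y \<and> \<not> R T y}"
  have E_not_R: "\<exists>y\<in>lexset kn. agree m x y \<and> \<not> R T y" if "x \<in> E" for x T m
    using that unfolding E_def by blast
  have E_I: "x \<in> E" if "\<And>T m. \<exists>y\<in>lexset kn. agree m x y \<and> \<not> R T y" for x
    using that lexset_closed[of kn x] unfolding E_def by blast
  obtain x0 where x0: "\<And>T m. \<exists>y. agree m x0 y \<and> y \<in> lexset kn \<and> \<not> R T y"
    by (rule boolean_koenig[where Q = "\<lambda>T y. y \<in> lexset kn \<and> \<not> R T y"]) (use un R_mono in blast)+
  have x0E: "x0 \<in> E" by (rule E_I) (use x0 in blast)

  have pre: "\<exists>x'\<in>E. suffix 1 x' = x" if x: "x \<in> E" for x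
  proof -
    have "\<exists>b y. b ## y \<in> lexset kn \<and> agree k x y \<and> \<not> R k (b ## y)" for k
    proof -
      \<comment> \<open>A path to \<open>b ## y\<close> becomes a path to \<open>y\<close> with one
        more letter, hence the bound \<open>Suc k\<close>.\<close>
      obtain y where y: "y \<in> lexset kn" "agree k x y" "\<not> R (Suc k) y"
        using E_not_R[OF x, of k "Suc k"] by blast
      obtain b where b: "b ## y \<in> lexset kn" using predecessor[OF y(1)] .
      have "\<not> R k (b ## y)"
      proof
        assume "R k (b ## y)"
        then obtain t where t: "length t \<le> k" "(a @ t) \<frown> b ## y \<in> lexset kn" unfolding R_def by blast
        have "(a @ t @ [b]) \<frown> y = (a @ t) \<frown> b ## y" by (metis append_assoc build_append append_Nil2 conc_empty)
        then have "R (Suc k) y" unfolding R_def using t by (intro exI[of _ "t @ [b]"]) simp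
        then show False using y(3) by blast
      qed
      then show ?thesis using b y(2) by blast
    qed
    then obtain b y where by_: "b k ## y k \<in> lexset kn" "agree k x (y k)" "\<not> R k (b k ## y k)" for k
      by metis
    obtain b' where b': "\<And>m. \<exists>n\<ge>m. b n = b'" using bool_frequent by blast
    have "b' ## x \<in> E"
    proof (rule E_I)
      fix T m
      obtain n where n: "n \<ge> max T m" "b n = b'" using b' by blast
      have "agree n x (y n)" by (rule by_(2))
      then have "agree (Suc n) (b' ## x) (b' ## y n)" by (rule agree_build)
      then have "agree m (b' ## x) (b' ## y n)"
        by (rule agree_mono) (use n(1) in linarith)
      moreover have "\<not> R T (b' ## y n)" using by_(3)[of n] R_mono n by auto
      ultimately show "\<exists>z\<in>lexset kn. agree m (b' ## x) z \<and> \<not> R T z"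
        using by_(1)[of n] n(2) by blast
    qed
    moreover have "suffix 1 (b' ## x) = x" by (rule ext) simp
    ultimately show ?thesis by blast
  qed

  \<comment> \<open>No point of the space lies beyond \<open>kn c\<close> in direction
    \<open>c\<close>. So an interval of followers that ends in \<open>kn c\<close> and contains
    another point is a neighbourhood of \<open>kn c\<close>.\<close>
  have kn_E: "kn c \<notin> E" for c
  proof
    assume E: "kn c \<in> E"
    obtain w where w: "length w < J" "cut (a @ w)" using cut_extend[OF a(2)] .
    let ?u = "a @ w @ [c]"
    have u_eq: "?u \<frown> z = (a @ w) \<frown> c ## z" for z
      by (metis append_assoc build_append append_Nil2 conc_empty)
    have top: "?u \<frown> kn c \<in> lexset kn" using w(2) unfolding cut_def u_eq by blast
    obtain z where z: "?u \<frown> z \<in> lexset kn" "\<not> agree J (kn c) z"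
      using cut_extend_away[OF language_prefixI[OF top]] by blast
    then have "kn c \<noteq> z" by blast
    then have "dlt c z (kn c)" using lexset_dle[OF lexset_conc_D[OF z(1)], of c] unfolding dle_def by blast
    then obtain m where m: "\<And>z' y. agree m z z' \<Longrightarrow> agree m (kn c) y \<Longrightarrow> dlt c z' y"
      by (rule dlt_neighbourhood) blast
    obtain y where y: "y \<in> lexset kn" "agree m (kn c) y" "\<not> R (Suc J) y"
      using E_not_R[OF E, of m "Suc J"] by blast
    have "dle c z y" using m[OF _ y(2), of z] unfolding dle_def by blast
    then have "?u \<frown> y \<in> lexset kn"
      by (rule lexset_conc_convex[OF z(1) top y(1)]) (rule lexset_dle[OF y(1)])
    then have "R (Suc J) y" unfolding R_def using w(1) by (intro exI[of _ "w @ [c]"]) simp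
    then show False using y(3) by blast
  qed

  \<comment> \<open>A point \<open>z\<close> near \<open>x2\<close> is reached from
    \<open>a\<close>, and the followers there leave the cylinder of length \<open>J\<close>. On the
    side where they leave, they cover a neighbourhood of \<open>x1\<close> or of
    \<open>x3\<close>.\<close>
  have fibre: "finite {x \<in> E. prefix J x = q}" for q
  proof (rule finite_no_chain[of _ False])
    fix x1 x2 x3
    assume x: "x1 \<in> {x \<in> E. prefix J x = q}" "x2 \<in> {x \<in> E. prefix J x = q}"
      "x3 \<in> {x \<in> E. prefix J x = q}" and lt: "dlt False x1 x2" "dlt False x2 x3"
    have J1: "agree J x1 x2" and J3: "agree J x3 x2" using x by (auto simp only: mem_Collect_eq prefix_eq_iff[symmetric])
    obtain m1 where m1: "\<And>x' y'. agree m1 x1 x' \<Longrightarrow> agree m1 x2 y' \<Longrightarrow> dlt False x' y'"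
      using dlt_neighbourhood[OF lt(1)] by blast
    have "dlt True x3 x2" using lt(2) dlt_flip[of False] by simp
    then obtain m3 where m3: "\<And>x' y'. agree m3 x3 x' \<Longrightarrow> agree m3 x2 y' \<Longrightarrow> dlt True x' y'"
      using dlt_neighbourhood by blast
    define M where "M = Suc (m1 + m3 + J)"
    have "x2 \<in> lexset kn" using x(2) unfolding E_def by blast
    then have "prefix M x2 \<frown> suffix M x2 \<in> lexset kn" by (simp only: prefix_suffix[symmetric])
    then have "language_prefix (prefix M x2)" by (rule language_prefixI)
    moreover have "prefix M x2 \<noteq> []" by (simp add: M_def)
    ultimately obtain t s where ts: "(a @ t @ prefix M x2) \<frown> s \<in> lexset kn"
      using transitive[OF a(1) _ a(2)] unfolding language_prefix_def by blast
    define z where "z = prefix M x2 \<frown> s"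
    have uz: "(a @ t) \<frown> z \<in> lexset kn" using ts unfolding z_def by (simp only: conc_conc append_assoc)
    have x2z: "agree M x2 z"
      unfolding z_def prefix_eq_iff[symmetric] using prefix_conc_length[of "prefix M x2" s] by simp
    obtain p where p: "(a @ t) \<frown> p \<in> lexset kn" "\<not> agree J x2 p"
      using cut_extend_away[OF language_prefixI[OF uz]] by blast
    have key: "x' \<notin> E" if nb: "\<And>y y'. agree M x' y \<Longrightarrow> agree M x2 y' \<Longrightarrow> dlt c y y'"
      and J': "agree J x' x2" and pz: "dlt c p z" for c x'
    proof
      assume "x' \<in> E"
      then obtain y where y: "y \<in> lexset kn" "agree M x' y" "\<not> R (length t) y"
        using E_not_R by blast
      have yz: "dlt c y z" by (rule nb[OF y(2) x2z])
      have "dle c p y"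
      proof (rule ccontr)
        assume "\<not> dle c p y"
        then have "dle c y p" by (meson dle_def not_dle)
        moreover have yx: "agree J y x2"
          using agree_mono[OF y(2), of J] J' unfolding M_def by auto
        moreover have "agree J y z"
          using agree_trans[OF yx agree_mono[OF x2z, of J]] unfolding M_def by auto
        moreover have "dle c p z" using pz unfolding dle_def by simp
        ultimately have "agree J y p" using dle_squeeze by blast
        then show False using p(2) agree_trans[OF agree_sym[OF yx]] by blast
      qed
      then have "(a @ t) \<frown> y \<in> lexset kn"
        by (rule lexset_conc_convex[OF p(1) uz y(1)]) (use yz dle_def in blast)
      then show False using y(3) unfolding R_def by blast
    qed
    have "p \<noteq> z" using p(2) agree_mono[OF x2z, of J] unfolding M_def by auto
    moreover have "dlt False z p = dlt True p z" using dlt_flip[of True z p] by simp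
    ultimately consider "dlt False p z" | "dlt True p z" using dlt_total[of p z False] by blast
    then show False
    proof cases
      case 1
      have "x1 \<notin> E"
        by (rule key[OF _ J1 1], rule m1) (erule agree_mono, simp add: M_def)+
      then show False using x(1) by blast
    next
      case 2
      have "x3 \<notin> E"
        by (rule key[OF _ J3 2], rule m3) (erule agree_mono, simp add: M_def)+
      then show False using x(3) by blast
    qed
  qed
  have "E \<subseteq> (\<Union>q\<in>{q. set q \<subseteq> UNIV \<and> length q = J}. {x \<in> E. prefix J x = q})"
    by auto
  moreover have "finite {q :: bword. set q \<subseteq> UNIV \<and> length q = J}"
    by (rule finite_lists_length_eq) simp
  ultimately have finE: "finite E" using fibre by (meson finite_UN finite_subset)

  \<comment> \<open>A backward orbit inside a finite set repeats, which produces a periodic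
    point.\<close>
  obtain g where g: "\<And>x. x \<in> E \<Longrightarrow> g x \<in> E" "\<And>x. x \<in> E \<Longrightarrow> suffix 1 (g x) = x"
    using pre by metis
  define h where "h n = (g ^^ n) x0" for n
  have hE: "h n \<in> E" for n by (induction n) (auto simp: h_def x0E g(1))
  have hs: "suffix n (h (m + n)) = h m" for m n
  proof (induction n)
    case (Suc n)
    have "suffix (Suc n) (h (m + Suc n)) = suffix n (suffix 1 (g (h (m + n))))"
      by (simp add: h_def)
    then show ?case by (simp only: Suc g(2)[OF hE])
  qed simp
  have "\<not> inj h"
    using finE hE by (meson finite_subset image_subsetI finite_imageD infinite_UNIV_nat)
  then obtain i j where ij: "i < j" "h i = h j" unfolding inj_def by (metis linorder_neqE_nat)
  define x where "x = h i"
  define p where "p = j - i"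
  have hp: "h (i + p * k) = x" for k
  proof (induction k)
    case (Suc k)
    have "i + p * Suc k = p + (i + p * k)" by simp
    then have "h (i + p * Suc k) = (g ^^ p) (h (i + p * k))"
      unfolding h_def by (simp only: funpow_add o_apply)
    also have "\<dots> = (g ^^ p) (h i)" using Suc x_def by simp
    also have "\<dots> = h (p + i)" unfolding h_def by (simp add: funpow_add)
    also have "\<dots> = x" using ij unfolding p_def x_def by simp
    finally show ?case .
  qed (simp add: x_def)
  have xE: "suffix n x \<in> E" for n
  proof -
    have "n \<le> i + p * n" using ij(1) unfolding p_def by (cases "j - i") auto
    then have "suffix n (h (i + p * n)) = h (i + p * n - n)" using hs[of n "i + p * n - n"] by simp
    then show ?thesis using hp hE by metis
  qed
  have "suffix p x = x" using hs[of p i] ij unfolding p_def x_def by simp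
  then have per: "periodic x" unfolding periodic_def using ij(1) p_def by (intro exI[of _ p]) simp
  have xl: "x \<in> lexset kn" using xE[of 0] unfolding E_def by simp
  have "suffix n x \<noteq> kn c" for n c using xE kn_E by metis
  from reaches_periodic[OF xl per this a]
  obtain t where t: "(a @ t) \<frown> x \<in> lexset kn" "\<And>n c. suffix n ((a @ t) \<frown> x) \<noteq> kn c" by blast
  \<comment> \<open>Since the path avoids both kneading sequences, \<open>x\<close> is not an end of
    the follower interval of \<open>a @ t\<close>, which is thus a neighbourhood of
    \<open>x\<close>.\<close>
  have "\<exists>z. (a @ t) \<frown> z \<in> lexset kn \<and> dlt c x z" for c
  proof -
    obtain i where i: "i \<le> length (a @ t)" "drop (length (a @ t) - i) (a @ t) = prefix i (kn c)"
      "(a @ t) \<frown> suffix i (kn c) \<in> lexset kn" "dle c x (suffix i (kn c))"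
      using follower_end[OF language_prefixI[OF t(1)], of c] t(1) by metis
    have "x \<noteq> suffix i (kn c)"
    proof
      assume "x = suffix i (kn c)"
      then have "suffix (length (a @ t) - i) ((a @ t) \<frown> x) = prefix i (kn c) \<frown> suffix i (kn c)"
        using i(2) by (simp only: suffix_conc_fst diff_le_self)
      then show False using t(2) prefix_suffix by metis
    qed
    then show ?thesis using i(3,4) unfolding dle_def by blast
  qed
  then obtain z where z: "(a @ t) \<frown> z c \<in> lexset kn" "dlt c x (z c)" for c by metis
  obtain m1 where m1: "\<And>y. agree m1 x y \<Longrightarrow> dlt False y (z False)"
    using dlt_neighbourhood[OF z(2)[of False]] by metis
  obtain m2 where m2: "\<And>y. agree m2 x y \<Longrightarrow> dlt True y (z True)"
    using dlt_neighbourhood[OF z(2)[of True]] by metis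
  obtain y where y: "y \<in> lexset kn" "agree (m1 + m2) x y" "\<not> R (length t) y"
    using E_not_R[OF xE[of 0], of "m1 + m2" "length t"] by auto
  have "dle False y (z False)" using m1[OF agree_mono[OF y(2)]] unfolding dle_def by simp
  moreover have "dle False (z True) y"
    using m2[OF agree_mono[OF y(2)]] dlt_flip[of False y "z True"] unfolding dle_def by simp
  ultimately have "(a @ t) \<frown> y \<in> lexset kn"
    using lexset_conc_convex[OF z(1) z(1) y(1)] by blast
  then show False using y(3) unfolding R_def by blast
qed

end

section \<open>Specification from return lengths without a common divisor\<close>

text \<open>Take the least positive difference \<open>d\<close> of two members. A member
  \<open>s\<close> that is not a multiple of \<open>d\<close> would produce the smaller difference
  \<open>s mod d\<close>. If \<open>d = 1\<close>, two consecutive members \<open>n\<close> and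
  \<open>Suc n\<close> generate all numbers from \<open>n * n\<close> on.\<close>

lemma additive_nat_set_cases:
  fixes S :: "nat set"
  assumes s0: "s\<^sub>0 \<in> S" and pos: "0 \<notin> S" and add: "\<And>a b. a \<in> S \<Longrightarrow> b \<in> S \<Longrightarrow> a + b \<in> S"
  shows "(\<exists>N. \<forall>n\<ge>N. n \<in> S) \<or> (\<exists>d\<ge>2. \<forall>s\<in>S. d dvd s)"
proof -
  have mult: "q * a + b \<in> S" if "a \<in> S" "b \<in> S" for q a b
    by (induction q) (use that add in \<open>auto simp: add.assoc\<close>)
  define P where "P d \<longleftrightarrow> d > 0 \<and> (\<exists>n\<in>S. n + d \<in> S)" for d
  define d where "d = (LEAST d. P d)"
  have "P s\<^sub>0" unfolding P_def using s0 pos add by (metis gr0I)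
  then have "P d" unfolding d_def by (rule LeastI)
  then obtain n where d: "d > 0" and n: "n \<in> S" "n + d \<in> S" unfolding P_def by blast
  have "n > 0" using n pos by (metis gr0I)
  have dvd: "d dvd s" if s: "s \<in> S" for s
  proof (rule ccontr)
    assume "\<not> d dvd s"
    then have r: "0 < s mod d" "s mod d < d" using d by (auto simp: dvd_eq_mod_eq_0)
    let ?q = "s div d"
    have "?q * (n + d) + n \<in> S" using mult n by blast
    moreover have "?q * (n + d) + n + s mod d = ?q * n + (s + n)"
      using div_mult_mod_eq[of s d] by (simp add: algebra_simps)
    moreover have "?q * n + (s + n) \<in> S" using mult n(1) add s by blast
    ultimately have "P (s mod d)" unfolding P_def using r by metis
    then show False using r(2) not_less_Least d_def by blast
  qed
  show ?thesis
  proof (cases "d = 1")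
    case True
    have "k \<in> S" if k: "k \<ge> n * n" for k
    proof -
      let ?q = "k div n" and ?r = "k mod n"
      have "?r < n" using \<open>n > 0\<close> by simp
      moreover have "n \<le> ?q" using k \<open>n > 0\<close> by (metis div_le_mono nonzero_mult_div_cancel_right not_gr0)
      ultimately obtain m where m: "?q = Suc (m + ?r)" by (metis add.commute less_imp_Suc_add less_le_trans)
      have "k = ?q * n + ?r" by simp
      also have "\<dots> = ?r * (n + d) + (m * n + n)" unfolding m True by (simp add: algebra_simps)
      finally have "k = ?r * (n + d) + (m * n + n)" .
      then show ?thesis using mult[OF n(2) mult[OF n(1) n(1)]] by metis
    qed
    then show ?thesis by blast
  next
    case False
    then have "d \<ge> 2" using d by simp
    then show ?thesis using dvd by blast
  qed
qed

context coded_kneading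
begin

text \<open>This makes the set of return lengths closed under addition.\<close>

lemma cut_append_hub: "cut u \<Longrightarrow> cut (hub c @ t) \<Longrightarrow> cut (u @ hub c @ t)"
proof -
  assume u: "cut u" and t: "cut (hub c @ t)"
  have "u \<frown> (hub c @ t) \<frown> e ## kn e \<in> lexset kn" for e
  proof (rule cut_synchronises[OF u])
    show "(hub c @ t) \<frown> e ## kn e \<in> lexset kn" using t unfolding cut_def by blast
    have "(hub c @ t) \<frown> e ## kn e = hub c \<frown> t \<frown> e ## kn e" by (simp only: conc_conc)
    then show "agree (Suc J) ((hub c @ t) \<frown> e ## kn e) (c ## kn c)"
      using hub_agree by metis
  qed
  then show ?thesis unfolding cut_def conc_conc by blast
qed

lemma specification_if_aperiodic:
  assumes N: "\<And>n. n \<ge> N \<Longrightarrow> \<exists>t. cut (hub False @ t) \<and> length (hub False @ t) = n"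
  shows "\<exists>M\<ge>1. \<forall>u v. language_prefix u \<longrightarrow> language_prefix v \<longrightarrow>
    (\<exists>w. length w = M \<and> language_prefix (u @ w @ v))"
proof -
  let ?a = "hub False"
  obtain T where T: "\<And>x. x \<in> lexset kn \<Longrightarrow> \<exists>t. length t \<le> T \<and> (?a @ t) \<frown> x \<in> lexset kn"
    using covering[OF _ hub_language[of False]] by auto
  \<comment> \<open>The connecting word is \<open>w1\<close>, then \<open>?a @ s\<close>, then
    \<open>?a @ t\<close>. Here \<open>J\<close> bounds \<open>w1\<close>, \<open>Suc J\<close> is
    the length of \<open>?a\<close>, \<open>T\<close> bounds \<open>t\<close>, and
    \<open>?a @ s\<close> pads with a length of at least \<open>N\<close>.\<close>
  define M where "M = Suc (J + N + Suc J + T)"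
  have "\<exists>w. length w = M \<and> language_prefix (u @ w @ v)"
    if u: "language_prefix u" and v: "language_prefix v" for u v
  proof -
    obtain w1 where w1: "length w1 < J" "cut (u @ w1)" using cut_extend[OF u] .
    obtain x where x: "v \<frown> x \<in> lexset kn" using v unfolding language_prefix_def by blast
    obtain t where t: "length t \<le> T" "(?a @ t) \<frown> v \<frown> x \<in> lexset kn" using T[OF x] by blast
    have "M - (length w1 + Suc J + length t) \<ge> N" using w1(1) t(1) unfolding M_def by simp
    then obtain s where s: "cut (?a @ s)" "length (?a @ s) = M - (length w1 + Suc J + length t)"
      using N by blast
    have "(?a @ s) \<frown> (?a @ t) \<frown> v \<frown> x \<in> lexset kn"
      by (rule cut_synchronises[OF s(1) t(2)]) (unfold conc_conc[symmetric], rule hub_agree)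
    then have "(u @ w1) \<frown> (?a @ s) \<frown> (?a @ t) \<frown> v \<frown> x \<in> lexset kn"
      by (rule cut_synchronises[OF w1(2)]) (unfold conc_conc[symmetric], rule hub_agree)
    then have "(u @ (w1 @ (?a @ s) @ ?a @ t) @ v) \<frown> x \<in> lexset kn"
      by (simp only: conc_conc append_assoc)
    then have "language_prefix (u @ (w1 @ (?a @ s) @ ?a @ t) @ v)" by (rule language_prefixI)
    moreover have "length (w1 @ (?a @ s) @ ?a @ t) = length w1 + length (?a @ s) + Suc J + length t"
      by simp
    then have "length (w1 @ (?a @ s) @ ?a @ t) = M" using s(2) w1(1) t(1) unfolding M_def by linarith
    ultimately show ?thesis by blast
  qed
  then show ?thesis unfolding M_def by (metis le_add1 plus_1_eq_Suc)
qed

end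

section \<open>Classes of cut words\<close>

text \<open>
  \<open>wlt c\<close> orders cut words by the position of the gap between the points \<open>u0\<alpha>\<close> and \<open>u1\<beta>\<close>: the end of
  a word counts as a symbol between 0 and 1.
\<close>

fun wlt :: "bool \<Rightarrow> bword \<Rightarrow> bword \<Rightarrow> bool" where
  "wlt c [] [] = False"
| "wlt c [] (b # w) = (b = (\<not> c))"
| "wlt c (b # u) [] = (b = c)"
| "wlt c (b # u) (b' # w) = (if b = b' then wlt c u w else b = c)"

lemma wlt_flip: "wlt (\<not> c) u w = wlt c w u"
  by (induction c u w rule: wlt.induct) auto

lemma wlt_irrefl [simp]: "\<not> wlt c u u"
  by (induction u) auto

lemma wlt_total: "u = w \<or> wlt c u w \<or> wlt c w u"
  by (induction c u w rule: wlt.induct) auto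

lemma wlt_trans: "wlt c u v \<Longrightarrow> wlt c v w \<Longrightarrow> wlt c u w"
proof (induction u arbitrary: v w)
  case Nil
  then show ?case by (cases v; cases w) (auto split: if_splits)
next
  case (Cons a u)
  show ?case
  proof (cases "\<exists>v' w'. v = a # v' \<and> w = a # w'")
    case True
    then show ?thesis using Cons by auto
  next
    case False
    then show ?thesis using Cons.prems(1) Cons.prems(2)
    proof (cases v)
      case v: (Cons b v')
      show ?thesis
      proof (cases w)
        case Nil
        then show ?thesis using Cons.prems unfolding v by (cases "a = b") simp_all
      next
        case w: (Cons e w')
        have "a \<noteq> b \<or> b \<noteq> e" using False unfolding v w by blast
        then have ac: "a = c" and ne: "a \<noteq> e"
          using Cons.prems unfolding v w wlt.simps by (metis (full_types))+
        show ?thesis unfolding w wlt.simps if_not_P[OF ne] by (rule ac)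
      qed
    qed (cases w; simp)
  qed
qed

lemma wlt_append [simp]: "wlt c (p @ u) (p @ w) = wlt c u w"
  by (induction p) auto

context kneading
begin

text \<open>Behind the common prefix this is a difference of digits or an instance of
  \<open>dle_K\<close>. Gaps of distinct cut words therefore do not overlap.\<close>

lemma wlt_dle:
  "cut u \<Longrightarrow> cut v \<Longrightarrow> wlt c u v \<Longrightarrow> dle c (u \<frown> (\<not> c) ## kn (\<not> c)) (v \<frown> c ## kn c)"
proof (induction c u v rule: wlt.induct)
  case (2 c b w)
  have "(b # w) \<frown> c ## kn c \<in> lexset kn" using "2.prems" unfolding cut_def by blast
  then have "dle (\<not> c) ((b # w) \<frown> c ## kn c) ((\<not> c) ## kn (\<not> c))"
    by (rule dle_K) (use "2.prems" in simp)
  then show ?case unfolding dle_flip by (simp only: conc_empty)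
next
  case (3 c b u)
  have "(b # u) \<frown> (\<not> c) ## kn (\<not> c) \<in> lexset kn" using "3.prems" unfolding cut_def by blast
  then have "dle c ((b # u) \<frown> (\<not> c) ## kn (\<not> c)) (c ## kn c)"
    by (rule dle_K) (use "3.prems" in simp)
  then show ?case by (simp only: conc_empty)
next
  case (4 c b u b' w)
  show ?case
  proof (cases "b = b'")
    case True
    then have "dle c (u \<frown> (\<not> c) ## kn (\<not> c)) (w \<frown> c ## kn c)" using 4 cut_ConsD by simp
    then show ?thesis using True by simp
  next
    case False
    then have "b = c" "b' = (\<not> c)" using "4.prems" by auto
    then have "dlt c ((b # u) \<frown> (\<not> c) ## kn (\<not> c)) ((b' # w) \<frown> c ## kn c)"
      by (intro dlt_heads) simp_all
    then show ?thesis unfolding dle_def by blast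
  qed
qed simp

lemma cut_dle: "dle c (u \<frown> c ## kn c) (u \<frown> (\<not> c) ## kn (\<not> c))"
proof -
  have "dlt c (c ## kn c) ((\<not> c) ## kn (\<not> c))" by (rule dlt_heads) simp_all
  then show ?thesis unfolding dle_conc by (simp only: dle_def simp_thms)
qed

lemma cut_convex:
  assumes "cut (p @ u)" "cut (p @ w)" "cut v" "wlt c u v" "wlt c v w"
  shows "cut (p @ v)"
proof -
  have u: "cut u" and w: "cut w" using assms(1,2) cut_appendD by blast+
  have lo: "dle c (u \<frown> (\<not> c) ## kn (\<not> c)) (v \<frown> c ## kn c)" by (rule wlt_dle[OF u assms(3,4)])
  have hi: "dle c (v \<frown> (\<not> c) ## kn (\<not> c)) (w \<frown> c ## kn c)" by (rule wlt_dle[OF assms(3) w assms(5)])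
  have "p \<frown> v \<frown> e ## kn e \<in> lexset kn" for e
  proof (rule lexset_conc_convex[where c = c])
    show "p \<frown> u \<frown> (\<not> c) ## kn (\<not> c) \<in> lexset kn" "p \<frown> w \<frown> c ## kn c \<in> lexset kn"
      using assms(1,2) unfolding cut_def by (simp_all only: conc_conc)
    show "v \<frown> e ## kn e \<in> lexset kn" using assms(3) unfolding cut_def by blast
    have "e = c \<or> e = (\<not> c)" by blast
    then show "dle c (u \<frown> (\<not> c) ## kn (\<not> c)) (v \<frown> e ## kn e)"
      "dle c (v \<frown> e ## kn e) (w \<frown> c ## kn c)"
      using lo hi cut_dle[of c v] dle_trans by blast+
  qed
  then show ?thesis unfolding cut_def conc_conc by blast
qed

text \<open>The classes are the order intervals of cut words with constant length modulo
  \<open>d\<close>. Quantifying over \<open>c\<close> covers both possible orders of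
  \<open>u\<close> and \<open>v\<close>; integers avoid truncated subtraction.\<close>

definition sim :: "nat \<Rightarrow> bword \<Rightarrow> bword \<Rightarrow> bool" where
  "sim d u v \<longleftrightarrow> cut u \<and> cut v \<and> int d dvd int (length u) - int (length v) \<and>
     (\<forall>c w. cut w \<longrightarrow> wlt c u w \<longrightarrow> wlt c w v \<longrightarrow> int d dvd int (length u) - int (length w))"

lemma sim_cut: "sim d u v \<Longrightarrow> cut u" "sim d u v \<Longrightarrow> cut v"
  unfolding sim_def by auto

lemma sim_refl: "cut u \<Longrightarrow> sim d u u"
  unfolding sim_def using wlt_trans wlt_irrefl by (metis diff_self dvd_0_right)

lemma sim_sym: "sim d u v \<Longrightarrow> sim d v u"
  unfolding sim_def
proof (intro conjI allI impI; (elim conjE)?)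
  assume d: "int d dvd int (length u) - int (length v)"
  show d': "int d dvd int (length v) - int (length u)" using d by (metis dvd_minus_iff minus_diff_eq)
  fix c w
  assume all: "\<forall>c w. cut w \<longrightarrow> wlt c u w \<longrightarrow> wlt c w v \<longrightarrow> int d dvd int (length u) - int (length w)"
    and w: "cut w" "wlt c v w" "wlt c w u"
  then have "int d dvd int (length u) - int (length w)" using wlt_flip by blast
  from dvd_add[OF d' this] show "int d dvd int (length v) - int (length w)" by simp
qed

lemma sim_trans:
  assumes uv: "sim d u v" and vw: "sim d v w"
  shows "sim d u w"
proof -
  have d: "int d dvd int (length u) - int (length v)" "int d dvd int (length v) - int (length w)"
    using assms unfolding sim_def by auto
  have "int d dvd int (length u) - int (length x)" if x: "cut x" "wlt c u x" "wlt c x w" for c x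
  proof -
    consider "x = v" | "wlt c x v" | "wlt c v x" using wlt_total by blast
    then show ?thesis
    proof cases
      case 1 then show ?thesis using d by simp
    next
      case 2 then show ?thesis using uv x unfolding sim_def by blast
    next
      case 3
      then have "int d dvd int (length v) - int (length x)" using vw x unfolding sim_def by blast
      from dvd_add[OF d(1) this] show ?thesis by simp
    qed
  qed
  moreover have "int d dvd int (length u) - int (length w)" using dvd_add[OF d] by simp
  ultimately show ?thesis using assms unfolding sim_def by blast
qed

lemma sim_convex: "sim d u w \<Longrightarrow> cut x \<Longrightarrow> wlt c u x \<Longrightarrow> wlt c x w \<Longrightarrow> sim d u x"
proof -
  assume uw: "sim d u w" and x: "cut x" "wlt c u x" "wlt c x w"
  have "int d dvd int (length u) - int (length y)" if y: "cut y" "wlt e u y" "wlt e y x" for e y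
  proof -
    have "e = c"
    proof (rule ccontr)
      assume "e \<noteq> c"
      then have "e = (\<not> c)" by blast
      then have "wlt c x u" using y wlt_flip wlt_trans by blast
      then show False using x(2) wlt_trans wlt_irrefl by blast
    qed
    then have "wlt c u y" "wlt c y w" using y x(3) wlt_trans by blast+
    then show ?thesis using uw y(1) unfolding sim_def by blast
  qed
  moreover have "int d dvd int (length u) - int (length x)" using uw x unfolding sim_def by blast
  ultimately show ?thesis using uw x(1) unfolding sim_def by blast
qed

text \<open>By \<open>cut_convex\<close>, a cut word between the tails stays a cut word when
  \<open>b\<close> is put in front.\<close>

lemma sim_ConsD:
  assumes "sim d (b # u) (b # v)"
  shows "sim d u v"
proof -
  have "int d dvd int (length u) - int (length w)" if w: "cut w" "wlt c u w" "wlt c w v" for c w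
  proof -
    have "cut ([b] @ w)"
      by (rule cut_convex[where c = c and u = u and w = v]) (use assms w sim_cut in auto)
    then have "int d dvd int (length (b # u)) - int (length (b # w))"
      using assms w unfolding sim_def by (metis append_Cons append_Nil wlt.simps(4))
    then show ?thesis by simp
  qed
  moreover have "int d dvd int (length u) - int (length v)" using assms unfolding sim_def by simp
  ultimately show ?thesis using assms cut_ConsD unfolding sim_def by blast
qed

lemma sim_ConsI:
  assumes "cut (b # u)" "cut (b # v)" "sim d u v"
  shows "sim d (b # u) (b # v)"
proof -
  have "int d dvd int (length (b # u)) - int (length w)"
    if w: "cut w" "wlt c (b # u) w" "wlt c w (b # v)" for c w
  proof -
    obtain w' where w': "w = b # w'" "wlt c u w'" "wlt c w' v"
      using w(2,3) by (cases w) (auto split: if_splits)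
    then have "int d dvd int (length u) - int (length w')"
      using assms(3) w(1) cut_ConsD unfolding sim_def by blast
    then show ?thesis using w'(1) by simp
  qed
  then show ?thesis using assms unfolding sim_def by simp
qed

end

section \<open>The class of the empty word when the return lengths have a common divisor\<close>

locale periodic_kneading = coded_kneading +
  fixes d :: nat
  assumes d_ge_2: "d \<ge> 2" and hub_dvd: "\<And>t. cut (hub False @ t) \<Longrightarrow> d dvd length (hub False @ t)"
begin

text \<open>Preceded by a return word of \<open>hub False\<close>, the word becomes a longer return
  word of \<open>hub False\<close>; subtracting the lengths leaves a multiple of
  \<open>d\<close>.\<close>

lemma hub_cut_dvd:
  assumes "cut (hub c @ t)"
  shows "d dvd length (hub c @ t)"
proof -
  obtain t0 where t0: "cut (hub False @ t0)" using cut_extend[OF hub_language] .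
  have "cut (hub False @ t0 @ hub c @ t)" using cut_append_hub[OF t0 assms] by simp
  then have "d dvd length (hub False @ t0 @ hub c @ t)" by (rule hub_dvd)
  then have "d dvd length (hub False @ t0) + length (hub c @ t)"
    by (simp only: length_append add.assoc)
  then show ?thesis using hub_dvd[OF t0] dvd_add_right_iff by blast
qed

text \<open>For a cut word in between, both ends of its gap are squeezed between points beginning
  with \<open>hub c\<close>. They differ right after the word, so the word itself begins with
  \<open>hub c\<close> and \<open>hub_cut_dvd\<close> applies.\<close>

lemma sim_Nil_hub:
  assumes t: "cut (hub c @ t)"
  shows "sim d [] (hub c @ t)"
proof -
  have key: "int d dvd int (length x)" if x: "cut x" "wlt c (hub c @ t) x" "wlt c x []" for x
  proof -
    let ?p = "\<lambda>e. x \<frown> e ## kn e"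
    let ?w = "(hub c @ t) \<frown> (\<not> c) ## kn (\<not> c)"
    have 1: "dle c ?w (?p c)" by (rule wlt_dle[OF t x(1,2)])
    have 2: "dle c (?p (\<not> c)) (c ## kn c)" using wlt_dle[OF x(1) cut_Nil x(3)] by simp
    have ag: "agree (Suc J) ?w (c ## kn c)"
      unfolding conc_conc[symmetric] by (rule hub_agree)
    have "agree (Suc J) ?w (?p c)"
      by (rule dle_squeeze[OF 1 dle_trans[OF cut_dle 2] ag])
    moreover have "agree (Suc J) ?w (?p (\<not> c))"
      by (rule dle_squeeze[OF dle_trans[OF 1 cut_dle] 2 ag])
    ultimately have pp: "agree (Suc J) (?p c) (?p (\<not> c))" "agree (Suc J) (?p c) (c ## kn c)"
      using ag by metis+
    have len: "length x \<ge> Suc J"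
    proof (rule ccontr)
      assume "\<not> ?thesis"
      then have "?p c (length x) = ?p (\<not> c) (length x)" using pp(1) by (meson not_less)
      then show False by (simp only: conc_def) simp
    qed
    have "take (Suc J) x = hub c"
    proof (rule nth_equalityI)
      show "length (take (Suc J) x) = length (hub c)" using len by simp
      fix i assume "i < length (take (Suc J) x)"
      then have i: "i < Suc J" "i < length x" by auto
      have "?p c i = (c ## kn c) i" using pp(2) i(1) by blast
      moreover have "(c ## kn c) i = hub c ! i" using i(1) by (cases i) auto
      ultimately show "take (Suc J) x ! i = hub c ! i" using i by simp
    qed
    then have "x = hub c @ drop (Suc J) x" by (metis append_take_drop_id)
    then show ?thesis using hub_cut_dvd x(1) by (metis int_dvd_int_iff)
  qed
  have "int d dvd int (length x)" if "cut x" "wlt e [] x" "wlt e x (hub c @ t)" for e x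
  proof -
    have "wlt e [] (hub c @ t)" using that wlt_trans by blast
    then have "e = (\<not> c)" by auto
    then show ?thesis using key that wlt_flip by blast
  qed
  moreover have "int d dvd int (length (hub c @ t))" using hub_cut_dvd[OF t] int_dvd_int_iff by blast
  ultimately show ?thesis unfolding sim_def using t cut_Nil
    by (simp only: list.size(3) of_nat_0 diff_0 dvd_minus_iff) blast
qed

end

section \<open>Extremal words\<close>

definition word_dlt :: "bool \<Rightarrow> bword \<Rightarrow> bword \<Rightarrow> bool" where
  "word_dlt c r v \<longleftrightarrow> length r = length v \<and> (\<exists>p r' v'. r = p @ c # r' \<and> v = p @ (\<not> c) # v')"

lemma word_dlt_iter: "word_dlt c r v \<Longrightarrow> dlt c (r\<^sup>\<omega>) (v\<^sup>\<omega>)"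
proof -
  assume "word_dlt c r v"
  then obtain p r' v' where rv: "r = p @ c # r'" "v = p @ (\<not> c) # v'" unfolding word_dlt_def by blast
  have "r\<^sup>\<omega> = p \<frown> c ## r' \<frown> r\<^sup>\<omega>" using iter_unroll[of r] rv(1) by (simp only: build_append) simp
  moreover have "v\<^sup>\<omega> = p \<frown> (\<not> c) ## v' \<frown> v\<^sup>\<omega>"
    using iter_unroll[of v] rv(2) by (simp only: build_append) simp
  moreover have "dlt c (p \<frown> c ## r' \<frown> r\<^sup>\<omega>) (p \<frown> (\<not> c) ## v' \<frown> v\<^sup>\<omega>)"
    unfolding dlt_conc by (rule dlt_heads) simp_all
  ultimately show ?thesis by metis
qed

lemma word_dlt_lexordp:
  assumes "length r = length v"
  shows "word_dlt c r v \<longleftrightarrow> (if c then ord_class.lexordp v r else ord_class.lexordp r v)"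
proof -
  have iff: "ord_class.lexordp r v \<longleftrightarrow> (\<exists>p r' v'. r = p @ False # r' \<and> v = p @ True # v')"
    if "length r = length v" for r v :: bword
  proof
    assume "ord_class.lexordp r v"
    then consider x vs where "v = r @ x # vs" |
      us a b vs ws where "(a :: bool) < b" "r = us @ a # vs" "v = us @ b # ws"
      unfolding lexordp_iff by blast
    then show "\<exists>p r' v'. r = p @ False # r' \<and> v = p @ True # v'"
    proof cases
      case 1 then show ?thesis using that by simp
    next
      case 2
      then have "a = False" "b = True" by auto
      then show ?thesis using 2 by blast
    qed
  next
    assume "\<exists>p r' v'. r = p @ False # r' \<and> v = p @ True # v'"
    then show "ord_class.lexordp r v" using lexordp_append_left_rightI[of False True] by auto
  qed
  show ?thesis
  proof (cases c)
    case True
    then show ?thesis using iff[of v r] assms unfolding word_dlt_def by auto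
  next
    case False
    then show ?thesis using iff[of r v] assms unfolding word_dlt_def by auto
  qed
qed

lemma suffix_iter: "v \<noteq> [] \<Longrightarrow> suffix k (v\<^sup>\<omega>) = (rotate k v)\<^sup>\<omega>"
proof
  fix n assume v: "v \<noteq> []"
  then have "n mod length v < length v" by simp
  then show "suffix k (v\<^sup>\<omega>) n = (rotate k v)\<^sup>\<omega> n" using v by (simp add: nth_rotate mod_simps)
qed

lemma suffix_iter_length: "v \<noteq> [] \<Longrightarrow> suffix (length v * n) (v\<^sup>\<omega>) = v\<^sup>\<omega>"
  by (simp add: suffix_iter)

context kneading
begin

text \<open>The rotation \<open>q @ p\<close> is compared through the tail
  \<open>q \<frown> y\<close> of \<open>v \<frown> y\<close>. If \<open>q\<close> is a prefix of
  \<open>v\<close>, the digit \<open>\<not> c\<close> opening \<open>y\<close> forces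
  \<open>\<not> c\<close> in \<open>v\<close> at the place where \<open>q @ p\<close> has
  \<open>c\<close>.\<close>

lemma prefix_extremal:
  assumes K: "c ## kn c = v \<frown> y" and v: "v \<noteq> []" and y0: "y 0 = (\<not> c)" and hd: "hd (rotate k v) = c"
  shows "rotate k v = v \<or> word_dlt c (rotate k v) v"
proof -
  define p q where "p = take (k mod length v) v" and "q = drop (k mod length v) v"
  have vpq: "v = p @ q" and rot: "rotate k v = q @ p"
    unfolding p_def q_def by (simp_all add: rotate_drop_take)
  show ?thesis
  proof (cases "p = []")
    case True
    then have "rotate k v = v" unfolding rot using vpq by simp
    then show ?thesis ..
  next
    case False
    have "k mod length v < length v" using v by simp
    then have qn: "q \<noteq> []" unfolding q_def by simp
    then have q0: "(q \<frown> y) 0 = c" using hd unfolding rot by (cases q) simp_all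
    have v0: "v ! 0 = c" using fun_cong[OF K, of 0] v by simp
    then have p0: "p = c # tl p" using False unfolding vpq by (cases p) simp_all
    have "q \<frown> y = suffix (length p) (c ## kn c)" unfolding K vpq by (simp del: length_drop length_take)
    then have "q \<frown> y \<in> lexset kn" using lexset_suffix[OF K_mem] by metis
    then have "dle c (q \<frown> y) (c ## kn c)" by (rule dle_K) (rule q0)
    then have le: "dle c (q \<frown> y) (v \<frown> y)" unfolding K .
    have lq: "length q \<le> length v" unfolding vpq by simp
    show ?thesis
    proof (cases "take (length q) v = q")
      case True
      then have vq: "v = q @ drop (length q) v" by (metis append_take_drop_id)
      let ?r = "drop (length q) v"
      have "length ?r = length p" unfolding vpq by simp
      then have rn: "?r \<noteq> []" using False by auto
      have "v \<frown> y = q \<frown> ?r \<frown> y" using vq by (metis conc_conc)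
      then have "dle c y (?r \<frown> y)" using le dle_conc by metis
      then have "(?r \<frown> y) 0 \<noteq> c" using y0 dle_head by blast
      then have "?r ! 0 \<noteq> c" using rn by simp
      moreover obtain b r' where r: "?r = b # r'" using rn by (meson neq_Nil_conv)
      ultimately have "b = (\<not> c)" by simp
      have "v = q @ b # r'" by (rule trans[OF vq]) (simp only: r)
      then have "v = q @ (\<not> c) # r'" unfolding \<open>b = (\<not> c)\<close> .
      moreover have "q @ p = q @ c # tl p" using p0 by metis
      moreover have "length (q @ p) = length v" unfolding vpq by simp
      ultimately have "word_dlt c (q @ p) v" unfolding word_dlt_def by blast
      then show ?thesis unfolding rot by blast
    next
      case False
      have "q \<frown> y \<noteq> v \<frown> y"
      proof
        assume "q \<frown> y = v \<frown> y"
        then have "prefix (length q) (q \<frown> y) = prefix (length q) (v \<frown> y)" by simp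
        then show False using False lq by simp
      qed
      then obtain l where l: "agree l (q \<frown> y) (v \<frown> y)" "(q \<frown> y) l = c" "(v \<frown> y) l = (\<not> c)"
        using le unfolding dle_def dlt_def by blast
      have lless: "l < length q"
      proof (rule ccontr)
        assume "\<not> ?thesis"
        then have "agree (length q) (q \<frown> y) (v \<frown> y)" using l(1) by (meson not_less less_le_trans)
        then have "prefix (length q) (q \<frown> y) = prefix (length q) (v \<frown> y)" unfolding prefix_eq_iff .
        then show False using False lq by simp
      qed
      have "prefix l (q \<frown> y) = prefix l (v \<frown> y)" using l(1) unfolding prefix_eq_iff .
      then have tk: "take l q = take l v" using lless lq by simp
      have "q = take l q @ c # drop (Suc l) q" using id_take_nth_drop[OF lless] l(2) lless by simp
      then have "q @ p = take l v @ c # drop (Suc l) q @ p" using tk by (metis append_Cons append_assoc)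
      moreover have "v = take l v @ (\<not> c) # drop (Suc l) v"
        using id_take_nth_drop[of l v] l(3) lless lq by simp
      moreover have "length (q @ p) = length v" unfolding vpq by simp
      ultimately have "word_dlt c (q @ p) v" unfolding word_dlt_def by blast
      then show ?thesis unfolding rot by blast
    qed
  qed
qed

end

section \<open>A common divisor of the return lengths yields a renormalisation\<close>

context periodic_kneading
begin

definition cls :: "bool \<Rightarrow> bword set" where
  "cls c = {w. sim d [] w \<and> w \<noteq> [] \<and> hd w = c}"

lemma clsD: "w \<in> cls c \<Longrightarrow> sim d [] w" "w \<in> cls c \<Longrightarrow> w \<noteq> []" "w \<in> cls c \<Longrightarrow> hd w = c"
  unfolding cls_def by auto

lemma cls_nonempty: "\<exists>w. w \<in> cls c"
proof -
  obtain t where "cut (hub c @ t)" using cut_extend[OF hub_language] .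
  then have "sim d [] (hub c @ t)" by (rule sim_Nil_hub)
  then have "hub c @ t \<in> cls c" unfolding cls_def by simp
  then show ?thesis by blast
qed

lemma cls_sim: "w \<in> cls c \<Longrightarrow> w' \<in> cls c' \<Longrightarrow> sim d w w'"
  by (rule sim_trans[OF sim_sym[OF clsD(1)] clsD(1)])

lemma sim_Nil_dvd: "sim d [] w \<Longrightarrow> d dvd length w"
  unfolding sim_def by simp

text \<open>
  Shifting the class of the empty word along \<open>kn c\<close> gives intervals on one side of the empty word
  until the first return, so all its members on the side \<open>c\<close> share the word read up to that time.
\<close>

lemma first_return:
  "\<exists>u. u \<noteq> [] \<and> hd u = c \<and> d dvd length u \<and> (\<forall>w\<in>cls c. \<exists>w'. w = u @ w' \<and> sim d [] w') \<and>
     (\<forall>w\<in>cls c. \<forall>k. 0 < k \<longrightarrow> k < length u \<longrightarrow> \<not> sim d [] (drop k w))"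
proof -
  define P where "P k \<longleftrightarrow> 0 < k \<and> (\<exists>w\<in>cls c. k \<le> length w \<and> sim d [] (drop k w))" for k
  obtain w0 where w0: "w0 \<in> cls c" using cls_nonempty by blast
  define n where "n = (LEAST k. P k)"
  have "P (length w0)" unfolding P_def using w0 clsD(2)[OF w0] sim_refl[OF cut_Nil] by auto
  then have Pn: "P n" unfolding n_def by (rule LeastI)
  have notP: "\<not> P k" if "k < n" for k using that not_less_Least unfolding n_def by blast
  have claim: "k \<le> n \<Longrightarrow> (\<exists>u. length u = k \<and> (\<forall>w\<in>cls c. take k w = u)) \<and>
      (\<forall>w\<in>cls c. k \<le> length w) \<and> (\<forall>w\<in>cls c. \<forall>w'\<in>cls c. sim d (drop k w) (drop k w'))" for k
  proof (induction k)
    case 0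
    then show ?case using cls_sim by auto
  next
    case (Suc k)
    then have k: "k < n" and IH: "\<And>w. w \<in> cls c \<Longrightarrow> k \<le> length w"
      "\<And>w w'. w \<in> cls c \<Longrightarrow> w' \<in> cls c \<Longrightarrow> sim d (drop k w) (drop k w')" by auto
    obtain u where u: "length u = k" "\<And>w. w \<in> cls c \<Longrightarrow> take k w = u" using Suc by auto
    have nonempty: "drop k w \<noteq> []" if w: "w \<in> cls c" for w
    proof (cases "k = 0")
      case True then show ?thesis using clsD(2)[OF w] by simp
    next
      case False
      have "\<not> sim d [] (drop k w)" using notP[OF k] w IH(1) False unfolding P_def by auto
      then show ?thesis using sim_refl[OF cut_Nil] by metis
    qed
    have heads: "hd (drop k w) = hd (drop k w')" if w: "w \<in> cls c" "w' \<in> cls c" for w w'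
    proof (cases "k = 0")
      case True then show ?thesis using clsD(3) w by simp
    next
      case False
      show ?thesis
      proof (rule ccontr)
        let ?x = "drop k w" and ?y = "drop k w'"
        assume ne: "hd ?x \<noteq> hd ?y"
        have "wlt (hd ?x) ?x []" "wlt (hd ?x) [] ?y"
          using nonempty w ne by (metis (full_types) list.collapse wlt.simps(2,3))+
        then have "sim d ?x []" using sim_convex[OF IH(2)[OF w] cut_Nil] by blast
        then have "sim d [] ?x" by (rule sim_sym)
        then show False using notP[OF k] w(1) IH(1) False unfolding P_def by auto
      qed
    qed
    let ?b = "hd (drop k w0)"
    have dropk: "drop k w = ?b # drop (Suc k) w" if w: "w \<in> cls c" for w
    proof -
      have "drop k w = hd (drop k w) # tl (drop k w)" using nonempty[OF w] by simp
      also have "tl (drop k w) = drop (Suc k) w" by (simp add: tl_drop drop_Suc)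
      finally show ?thesis unfolding heads[OF w w0] .
    qed
    have "take (Suc k) w = u @ [?b] \<and> Suc k \<le> length w" if w: "w \<in> cls c" for w
    proof -
      have kl: "k < length w" using nonempty[OF w] by simp
      then have "w ! k = ?b" using dropk[OF w] by (metis hd_drop_conv_nth heads w w0)
      then show ?thesis using u(2)[OF w] kl by (simp add: take_Suc_conv_app_nth)
    qed
    moreover have "sim d (drop (Suc k) w) (drop (Suc k) w')" if w: "w \<in> cls c" "w' \<in> cls c" for w w'
      using IH(2)[OF w] unfolding dropk[OF w(1)] dropk[OF w(2)] by (rule sim_ConsD)
    ultimately show ?case using u(1) by (metis length_append_singleton)
  qed
  obtain u where u: "length u = n" "\<And>w. w \<in> cls c \<Longrightarrow> take n w = u" using claim[of n] by auto
  have len: "n \<le> length w" if "w \<in> cls c" for w using claim[of n] that by simp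
  have n0: "0 < n" using Pn unfolding P_def by blast
  obtain w1 where w1: "w1 \<in> cls c" "sim d [] (drop n w1)" using Pn unfolding P_def by blast
  have ret: "sim d [] (drop n w)" if "w \<in> cls c" for w
    using claim[of n] that w1 sim_trans by blast
  have "u \<noteq> []" using u(1) n0 by auto
  moreover have "hd u = c"
    using u(2)[OF w0] clsD(2,3)[OF w0] n0 by (metis hd_take)
  moreover have "d dvd length u"
  proof -
    have "d dvd length (drop n w0)" using ret[OF w0] by (rule sim_Nil_dvd)
    moreover have "d dvd length w0" using clsD(1)[OF w0] by (rule sim_Nil_dvd)
    moreover have "length w0 = length (drop n w0) + n" using len[OF w0] by simp
    ultimately show ?thesis unfolding u(1) by (metis dvd_add_right_iff)
  qed
  moreover have "\<exists>w'. w = u @ w' \<and> sim d [] w'" if "w \<in> cls c" for w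
    using u(2)[OF that] ret[OF that] by (metis append_take_drop_id)
  moreover have "\<not> sim d [] (drop k w)" if "w \<in> cls c" "0 < k" "k < length u" for w k
    using notP[of k] that u(1) len[OF that(1)] unfolding P_def by auto
  ultimately show ?thesis by blast
qed

text \<open>The first return words: \<open>om False\<close> and \<open>om True\<close> will be the
  words \<omega> and \<nu> of the renormalisation.\<close>

definition om :: "bool \<Rightarrow> bword" where
  "om c = (SOME u. u \<noteq> [] \<and> hd u = c \<and> d dvd length u \<and> (\<forall>w\<in>cls c. \<exists>w'. w = u @ w' \<and> sim d [] w') \<and>
     (\<forall>w\<in>cls c. \<forall>k. 0 < k \<longrightarrow> k < length u \<longrightarrow> \<not> sim d [] (drop k w)))"

lemma om: "om c \<noteq> []" "hd (om c) = c" "d dvd length (om c)"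
  "w \<in> cls c \<Longrightarrow> \<exists>w'. w = om c @ w' \<and> sim d [] w'"
  "w \<in> cls c \<Longrightarrow> 0 < k \<Longrightarrow> k < length (om c) \<Longrightarrow> \<not> sim d [] (drop k w)"
  using someI_ex[OF first_return[of c]] unfolding om_def by auto

lemma om_nth_0: "om c ! 0 = c"
  using om(1,2)[of c] by (simp add: hd_conv_nth)

lemma om_iter_0: "(om c)\<^sup>\<omega> 0 = c"
  using om(1)[of c] om_nth_0 by simp

lemma om_unroll: "(om c)\<^sup>\<omega> = om c \<frown> (om c)\<^sup>\<omega>"
  by (rule iter_unroll) (simp add: om(1))

text \<open>The limits of words in the class of the empty word. By \<open>decomposable_om\<close>
  they are infinite products of the two return words.\<close>

definition decomposable :: "bseq \<Rightarrow> bool" where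
  "decomposable x \<longleftrightarrow> (\<forall>m. \<exists>w. sim d [] w \<and> m \<le> length w \<and> take m w = prefix m x)"

lemma decomposable_om:
  assumes x: "decomposable x" and x0: "x 0 = c"
  obtains x' where "x = om c \<frown> x'" "decomposable x'"
proof -
  let ?l = "length (om c)"
  have ex: "\<exists>w'. sim d [] w' \<and> m \<le> length w' \<and> take (?l + m) (om c @ w') = prefix (?l + m) x" for m
  proof -
    obtain w where w: "sim d [] w" "?l + m \<le> length w" "take (?l + m) w = prefix (?l + m) x"
      using x unfolding decomposable_def by blast
    have "0 < ?l" using om(1) by simp
    then have "w ! 0 = x 0" using w(2) arg_cong[OF w(3), of "\<lambda>v. v ! 0"] by simp
    moreover have "w \<noteq> []" using \<open>0 < ?l\<close> w(2) by auto
    ultimately have "w \<in> cls c" using w(1) x0 unfolding cls_def by (simp add: hd_conv_nth)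
    then obtain w' where "w = om c @ w'" "sim d [] w'" using om(4) by blast
    then show ?thesis using w(2,3) by auto
  qed
  have pre: "prefix ?l x = om c"
  proof -
    obtain w' where "take (?l + 0) (om c @ w') = prefix (?l + 0) x" using ex[of 0] by blast
    then show ?thesis by simp
  qed
  then have xs: "x = om c \<frown> suffix ?l x" by (metis prefix_suffix)
  have "decomposable (suffix ?l x)"
    unfolding decomposable_def
  proof
    fix m
    obtain w' where w': "sim d [] w'" "m \<le> length w'" "take (?l + m) (om c @ w') = prefix (?l + m) x"
      using ex by blast
    have "prefix (?l + m) x = om c @ prefix m (suffix ?l x)"
      by (subst subsequence_append) (simp add: pre)
    then have "take m w' = prefix m (suffix ?l x)" using w'(3) by simp
    then show "\<exists>w. sim d [] w \<and> m \<le> length w \<and> take m w = prefix m (suffix ?l x)" using w' by blast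
  qed
  then show thesis using that xs by blast
qed

lemma decomposable_hub:
  assumes x: "x \<in> lexset kn" and ag: "agree (Suc J) x (c ## kn c)"
  shows "decomposable x"
  unfolding decomposable_def
proof
  fix m
  have "prefix (Suc J + m) x \<frown> suffix (Suc J + m) x \<in> lexset kn" using x by (simp only: prefix_suffix[symmetric])
  then obtain w where w: "cut (prefix (Suc J + m) x @ w)" using cut_extend[OF language_prefixI] by blast
  have "prefix (Suc J) x = hub c"
  proof (rule nth_equalityI)
    fix i assume "i < length (prefix (Suc J) x)"
    then have i: "i < Suc J" by simp
    then have "x i = (c ## kn c) i" using ag by blast
    moreover have "(c ## kn c) i = hub c ! i" using i by (cases i) auto
    moreover have "prefix (Suc J) x ! i = x i" using i by (simp del: subseq_to_Suc)
    ultimately show "prefix (Suc J) x ! i = hub c ! i" by (simp only:)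
  qed simp
  then have e: "prefix (Suc J + m) x = hub c @ x [Suc J \<rightarrow> Suc J + m]" by (simp only: subsequence_append)
  have "sim d [] (prefix (Suc J + m) x @ w)"
    using sim_Nil_hub[of c "x [Suc J \<rightarrow> Suc J + m] @ w"] w unfolding e by (simp only: append_assoc)
  moreover have "take m (prefix (Suc J + m) x @ w) = prefix m x" by simp
  ultimately show "\<exists>w. sim d [] w \<and> m \<le> length w \<and> take m w = prefix m x"
    by (intro exI[of _ "prefix (Suc J + m) x @ w"]) simp
qed

text \<open>If \<open>y\<close> began with \<open>c\<close>, comparison with
  \<open>c ## kn c\<close> would force a \<open>c\<close> behind the leading \<open>om c\<close> of
  every member of \<open>cls c\<close>. Deleting that \<open>om c\<close> would give a shorter
  member, and so on without end.\<close>

lemma K_split: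
  obtains y where "c ## kn c = om c \<frown> y" "decomposable y" "y 0 = (\<not> c)"
proof -
  have "decomposable (c ## kn c)" by (rule decomposable_hub[OF K_mem]) blast
  then obtain y where y: "c ## kn c = om c \<frown> y" "decomposable y"
    using decomposable_om[of "c ## kn c" c] by auto
  have "y 0 = (\<not> c)"
  proof (rule ccontr)
    assume "\<not> ?thesis"
    then have y0: "y 0 = c" by blast
    have "v \<notin> cls c" for v
    proof (induction "length v" arbitrary: v rule: less_induct)
      case less
      show ?case
      proof
        assume v: "v \<in> cls c"
        then obtain v' where v': "v = om c @ v'" "sim d [] v'" using om(4) by blast
        have le: "dle c (v' \<frown> e ## kn e) y" for e
        proof -
          have "v \<frown> e ## kn e \<in> lexset kn" using v clsD(1) sim_cut(2) unfolding cut_def by blast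
          moreover have "(v \<frown> e ## kn e) 0 = c"
            using clsD(2,3)[OF v] by (simp add: hd_conv_nth)
          ultimately have "dle c (v \<frown> e ## kn e) (c ## kn c)" by (rule dle_K)
          then have "dle c (v \<frown> e ## kn e) (om c \<frown> y)" unfolding y(1) .
          then show ?thesis unfolding v'(1) conc_conc[symmetric] by (simp only: dle_conc)
        qed
        have "(v' \<frown> (\<not> c) ## kn (\<not> c)) 0 = c" by (rule dle_head[OF le y0])
        then have "v' \<noteq> []" "hd v' = c" by (cases v'; simp)+
        then have "v' \<in> cls c" using v'(2) unfolding cls_def by simp
        moreover have "length v' < length v" using v'(1) om(1) by simp
        ultimately show False using less by blast
      qed
    qed
    then show False using cls_nonempty by blast
  qed
  then show thesis using that y by blast
qed

text \<open>A first difference cannot lie in the leading \<open>om c\<close>, which both sequences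
  share; removing this block moves it to the left.\<close>

lemma decomposable_ge:
  assumes "decomposable x" "x 0 = c"
  shows "dle c ((om c)\<^sup>\<omega>) x"
proof -
  let ?o = "(om c)\<^sup>\<omega>"
  have "\<not> (agree k x ?o \<and> x k = c \<and> ?o k = (\<not> c))" if "decomposable x" "x 0 = c" for k x
    using that
  proof (induction k arbitrary: x rule: less_induct)
    case (less k)
    obtain x' where x': "x = om c \<frown> x'" "decomposable x'" using decomposable_om less.prems by blast
    let ?l = "length (om c)"
    show ?case
    proof
      assume a: "agree k x ?o \<and> x k = c \<and> ?o k = (\<not> c)"
      have "\<not> k < ?l"
      proof
        assume "k < ?l"
        then have "x k = ?o k" unfolding x'(1) by (subst om_unroll) simp
        then show False using a by simp
      qed
      then have kl: "?l \<le> k" by simp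
      have sh: "x (?l + i) = x' i" "?o (?l + i) = ?o i" for i
        unfolding x'(1) by simp (subst om_unroll, simp)
      have ag: "agree (k - ?l) x' ?o"
      proof (intro allI impI)
        fix i assume "i < k - ?l"
        then have "?l + i < k" by simp
        then show "x' i = ?o i" using a sh[of i] by metis
      qed
      have at: "x' (k - ?l) = c" "?o (k - ?l) = (\<not> c)" using a sh[of "k - ?l"] kl by auto
      \<comment> \<open>At a block boundary the periodic sequence has the digit \<open>c\<close>, so
        the difference is not there and the next block is \<open>om c\<close> again.\<close>
      have "k - ?l \<noteq> 0" using at(2) om_iter_0[of c] by (metis (full_types))
      then have "x' 0 = c" using ag om_iter_0[of c] by (metis gr0I)
      moreover have "k - ?l < k" using kl om(1)[of c] by (metis diff_less length_greater_0_conv less_le_trans)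
      ultimately show False using less.IH[OF _ x'(2)] ag at by blast
    qed
  qed
  then have "\<not> dlt c x ?o" using assms unfolding dlt_def by blast
  then show ?thesis unfolding not_dlt .
qed

lemma iter_om_dlt_K: "dlt c ((om c)\<^sup>\<omega>) (c ## kn c)"
proof -
  obtain y where y: "c ## kn c = om c \<frown> y" "decomposable y" "y 0 = (\<not> c)" using K_split .
  have "decomposable (c ## kn c)" by (rule decomposable_hub[OF K_mem]) blast
  then have "dle c ((om c)\<^sup>\<omega>) (c ## kn c)" by (rule decomposable_ge) simp
  moreover have "(om c)\<^sup>\<omega> \<noteq> c ## kn c"
  proof
    assume "(om c)\<^sup>\<omega> = c ## kn c"
    then have "om c \<frown> (om c)\<^sup>\<omega> = om c \<frown> y" using y(1) om_unroll by metis
    then have "(om c)\<^sup>\<omega> = y" by (simp only: same_concat_eq)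
    then show False using y(3) om_iter_0[of c] by (metis (full_types))
  qed
  ultimately show ?thesis unfolding dle_def by blast
qed

lemma om_extremal:
  assumes "hd (rotate k (om c)) = c"
  shows "rotate k (om c) = om c \<or> word_dlt c (rotate k (om c)) (om c)"
proof -
  obtain y where y: "c ## kn c = om c \<frown> y" "decomposable y" "y 0 = (\<not> c)" using K_split .
  show ?thesis by (rule prefix_extremal[OF y(1) om(1) y(3) assms])
qed

lemma iter_om_extremal:
  assumes "suffix k ((om c)\<^sup>\<omega>) 0 = c"
  shows "dle c (suffix k ((om c)\<^sup>\<omega>)) ((om c)\<^sup>\<omega>)"
proof -
  have "rotate k (om c) \<noteq> []" using om(1) by simp
  then have "hd (rotate k (om c)) = c" using assms by (simp add: suffix_iter[OF om(1)] hd_conv_nth)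
  then show ?thesis using om_extremal word_dlt_iter unfolding suffix_iter[OF om(1)] dle_def by metis
qed

end

section \<open>Comparison of the two periodic orbits\<close>

lemma wlt_Cons_same: "wlt c (b # u) (b # w) = wlt c u w"
  by simp

context periodic_kneading
begin

text \<open>
  The words read after a rotation of \<open>om (\<not> c)\<close> and after \<open>om c\<close> visit classes in a fixed strict order
  until their digits differ.
\<close>

lemma rotate_om_dle:
  assumes k: "0 < k" "k < length (om (\<not> c))" and kc: "om (\<not> c) ! k = c"
  shows "dle c (suffix k ((om (\<not> c))\<^sup>\<omega>)) ((om c)\<^sup>\<omega>)"
proof (rule ccontr)
  let ?u = "om (\<not> c)" and ?v = "om c"
  define N M where "N = length ?u" and "M = length ?v"
  have N0: "0 < N" and M0: "0 < M" unfolding N_def M_def using om(1) by auto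
  define Inv where "Inv j i \<longleftrightarrow>
      (\<forall>x\<in>cls (\<not> c). \<forall>w\<in>cls c. wlt c (drop j x) (drop i w) \<and> \<not> sim d (drop j x) (drop i w))" for j i
  have decomp: "\<exists>x'. x = om e @ x' \<and> sim d [] x'" if "x \<in> cls e" for e x using om(4) that by blast
  have Cons_drop: "drop j x = om e ! j # drop (Suc j) x" if x: "x \<in> cls e" and j: "j < length (om e)" for e x j
  proof -
    obtain x' where x': "x = om e @ x'" using decomp[OF x] by blast
    then have "j < length x" "x ! j = om e ! j" using j by (auto simp: nth_append)
    then show ?thesis using Cons_nth_drop_Suc[of j x] by simp
  qed
  have drop_end: "sim d [] (drop (length (om e)) x)" if "x \<in> cls e" for e x
    using decomp[OF that] by auto
  have cut_drop: "cut (drop j x)" if "x \<in> cls e" for e x j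
  proof -
    have "cut (take j x @ drop j x)" using clsD(1)[OF that] sim_cut(2) by simp
    then show ?thesis using cut_appendD by blast
  qed
  have convex: False if "sim d [] p" "sim d [] q" "cut x" "\<not> sim d [] x" "wlt c p x" "wlt c x q" for p q x
  proof -
    have "sim d p x" by (rule sim_convex[OF sim_trans[OF sim_sym[OF that(1)] that(2)] that(3,5,6)])
    then show False using that(1,4) sim_trans by blast
  qed
  \<comment> \<open>A cut word outside the class of \<open>[]\<close> lies on the same side of all
    members, so one member may replace another in a comparison.\<close>
  have order: "wlt c p x" if "sim d [] p" "sim d [] q" "cut x" "\<not> sim d [] x" "wlt c q x" for p q x
  proof (rule ccontr)
    assume "\<not> ?thesis"
    moreover have "p \<noteq> x" using that by blast
    ultimately have "wlt c x p" using wlt_total by blast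
    then show False using convex[OF that(2,1,3,4,5)] by blast
  qed
  have order': "wlt c x p" if "sim d [] p" "sim d [] q" "cut x" "\<not> sim d [] x" "wlt c x q" for p q x
  proof (rule ccontr)
    assume "\<not> ?thesis"
    moreover have "p \<noteq> x" using that by blast
    ultimately have "wlt c p x" using wlt_total by blast
    then show False using convex[OF that(1,2,3,4) _ that(5)] by blast
  qed
  have nsim: "\<not> sim d x y" if "sim d [] y" "\<not> sim d [] x" for x y
    using that sim_sym sim_trans by blast
  have nsim': "\<not> sim d y x" if "sim d [] y" "\<not> sim d [] x" for x y
    using that sim_trans by blast
  have init: "Inv k 0"
    unfolding Inv_def
  proof (intro ballI)
    fix x w assume x: "x \<in> cls (\<not> c)" and w: "w \<in> cls c"
    have ns: "\<not> sim d [] (drop k x)" using om(5)[OF x k] .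
    have "wlt c (drop k x) []" unfolding Cons_drop[OF x k(2)] kc by simp
    then have "wlt c (drop k x) w"
      by (rule order'[OF clsD(1)[OF w] sim_refl[OF cut_Nil] cut_drop[OF x] ns])
    then show "wlt c (drop k x) (drop 0 w) \<and> \<not> sim d (drop k x) (drop 0 w)"
      using nsim[OF clsD(1)[OF w] ns] by simp
  qed
  have step: "Inv (Suc j mod N) (Suc i mod M)" if inv: "Inv j i" and j: "j < N" and i: "i < M" and eq: "?u ! j = ?v ! i" for i j
  proof -
    have next_: "wlt c (drop (Suc j) x) (drop (Suc i) w) \<and> \<not> sim d (drop (Suc j) x) (drop (Suc i) w)"
      if x: "x \<in> cls (\<not> c)" and w: "w \<in> cls c" for x w
    proof -
      have dx: "drop j x = ?u ! j # drop (Suc j) x" using Cons_drop[OF x] j N_def by simp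
      have dw: "drop i w = ?u ! j # drop (Suc i) w" using Cons_drop[OF w] i M_def eq by simp
      have "wlt c (drop j x) (drop i w)" "\<not> sim d (drop j x) (drop i w)"
        using inv x w unfolding Inv_def by blast+
      moreover have "cut (?u ! j # drop (Suc j) x)" "cut (?u ! j # drop (Suc i) w)"
        using cut_drop[OF x, of j] cut_drop[OF w, of i] unfolding dx dw .
      ultimately show ?thesis unfolding dx dw wlt_Cons_same using sim_ConsI by blast
    qed
    obtain x0 w0 where x0: "x0 \<in> cls (\<not> c)" and w0: "w0 \<in> cls c" using cls_nonempty by blast
    \<comment> \<open>A tail that has completed its return word lies in the class of
      \<open>[]\<close> and is replaced by a fresh member. Both tails cannot complete together,
      because they are inequivalent.\<close>
    show ?thesis
    proof (cases "Suc j = N")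
      case jN: True
      have xs: "sim d [] (drop (Suc j) x)" if "x \<in> cls (\<not> c)" for x
        using drop_end[OF that] jN N_def by simp
      show ?thesis
      proof (cases "Suc i = M")
        case True
        have "sim d [] (drop (Suc i) w0)" using drop_end[OF w0] True M_def by simp
        then have "sim d (drop (Suc j) x0) (drop (Suc i) w0)" using xs[OF x0] sim_sym sim_trans by blast
        then show ?thesis using next_[OF x0 w0] by blast
      next
        case False
        then have i': "Suc i mod M = Suc i" using i by simp
        have "wlt c x (drop (Suc i) w) \<and> \<not> sim d x (drop (Suc i) w)"
          if x: "x \<in> cls (\<not> c)" and w: "w \<in> cls c" for x w
        proof -
          have ns: "\<not> sim d [] (drop (Suc i) w)" using om(5)[OF w, of "Suc i"] False i M_def by simp
          have "wlt c x (drop (Suc i) w)"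
            by (rule order[OF clsD(1)[OF x] xs[OF x] cut_drop[OF w] ns]) (use next_[OF x w] in blast)
          then show ?thesis using nsim'[OF clsD(1)[OF x] ns] by blast
        qed
        then show ?thesis unfolding Inv_def i' jN by simp
      qed
    next
      case jN: False
      then have j': "Suc j mod N = Suc j" using j by simp
      show ?thesis
      proof (cases "Suc i = M")
        case True
        have "wlt c (drop (Suc j) x) w \<and> \<not> sim d (drop (Suc j) x) w"
          if x: "x \<in> cls (\<not> c)" and w: "w \<in> cls c" for x w
        proof -
          have ns: "\<not> sim d [] (drop (Suc j) x)" using om(5)[OF x, of "Suc j"] jN j N_def by simp
          have ws: "sim d [] (drop (Suc i) w)" using drop_end[OF w] True M_def by simp
          have "wlt c (drop (Suc j) x) w"
            by (rule order'[OF clsD(1)[OF w] ws cut_drop[OF x] ns]) (use next_[OF x w] in blast)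
          then show ?thesis using nsim[OF clsD(1)[OF w] ns] by blast
        qed
        then show ?thesis unfolding Inv_def j' True by simp
      next
        case False
        then have i': "Suc i mod M = Suc i" using i by simp
        show ?thesis unfolding Inv_def i' j' using next_ by blast
      qed
    qed
  qed
  assume "\<not> dle c (suffix k (?u\<^sup>\<omega>)) (?v\<^sup>\<omega>)"
  then obtain l where l: "agree l (?v\<^sup>\<omega>) (suffix k (?u\<^sup>\<omega>))" "?v\<^sup>\<omega> l = c" "suffix k (?u\<^sup>\<omega>) l = (\<not> c)"
    unfolding not_dle dlt_def by blast
  have digu: "suffix k (?u\<^sup>\<omega>) n = ?u ! ((k + n) mod N)" and digv: "?v\<^sup>\<omega> n = ?v ! (n mod M)" for n
    unfolding N_def M_def using om(1) by simp_all
  have "n \<le> l \<Longrightarrow> Inv ((k + n) mod N) (n mod M)" for n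
  proof (induction n)
    case 0
    then show ?case using init k(2) unfolding N_def by simp
  next
    case (Suc n)
    have "?u ! ((k + n) mod N) = ?v ! (n mod M)"
      using l(1) Suc.prems unfolding digu[symmetric] digv[symmetric] by (metis Suc_le_lessD)
    then have "Inv (Suc ((k + n) mod N) mod N) (Suc (n mod M) mod M)"
      using step Suc N0 M0 by simp
    then show ?case by (simp only: mod_Suc_eq add_Suc_right)
  qed
  then have inv: "Inv ((k + l) mod N) (l mod M)" by simp
  obtain x0 w0 where x0: "x0 \<in> cls (\<not> c)" and w0: "w0 \<in> cls c" using cls_nonempty by blast
  have "drop ((k + l) mod N) x0 = (\<not> c) # drop (Suc ((k + l) mod N)) x0"
    using Cons_drop[OF x0, of "(k + l) mod N"] N0 l(3) digu[of l] unfolding N_def by simp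
  moreover have "drop (l mod M) w0 = c # drop (Suc (l mod M)) w0"
    using Cons_drop[OF w0, of "l mod M"] M0 l(2) digv[of l] unfolding M_def by simp
  ultimately have "wlt c ((\<not> c) # drop (Suc ((k + l) mod N)) x0) (c # drop (Suc (l mod M)) w0)"
    using inv x0 w0 unfolding Inv_def by metis
  then show False by simp
qed

text \<open>
  If the two periodic orbits coincide, the orbit lies in the subshift and can be reached from the
  cylinder of \<open>kn c\<close>; decomposing such a path into \<open>om False\<close> and \<open>om True\<close> shows that some \<open>kn e\<close> ends
  in that orbit.
\<close>

lemma orbits_differ:
  assumes k: "0 < k" "k < length (om (\<not> c))"
  shows "suffix k ((om (\<not> c))\<^sup>\<omega>) \<noteq> (om c)\<^sup>\<omega>"
proof
  let ?o = "\<lambda>e. (om e)\<^sup>\<omega>"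
  let ?x = "?o c"
  define M where "M = length (om c)"
  have M0: "M > 0" unfolding M_def using om(1) by simp
  assume eq: "suffix k (?o (\<not> c)) = ?o c"
  have per: "suffix (length (om e) * n) (?o e) = ?o e" for e n by (rule suffix_iter_length[OF om(1)])
  have perM: "suffix (m + M * n) ?x = suffix m ?x" for m n
    using arg_cong[OF per[of c n], of "suffix m"] unfolding M_def by (simp only: suffix_suffix add.commute)
  have ret: "suffix (length (om (\<not> c)) - k) ?x = ?o (\<not> c)"
    unfolding eq[symmetric] suffix_suffix using k per[of "\<not> c" 1] by simp
  have tail: "\<exists>n'. suffix n (?o e) = suffix n' (?o e')" for n e e'
  proof -
    consider "e = e'" | "e = c" "e' = (\<not> c)" | "e = (\<not> c)" "e' = c" by blast
    then show ?thesis
    proof cases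
      case 2
      have "suffix n (?o e) = suffix (k + n) (?o e')" unfolding 2 eq[symmetric] suffix_suffix ..
      then show ?thesis by blast
    next
      case 3
      have "suffix n (?o e) = suffix (length (om (\<not> c)) - k + n) (?o e')"
        unfolding 3 ret[symmetric] suffix_suffix ..
      then show ?thesis by blast
    qed auto
  qed
  have ext: "dle e (suffix n ?x) (?o e)" if "suffix n ?x 0 = e" for n e
    using tail[of n c e] iter_om_extremal[of _ e] that by metis
  have extK: "dlt e (suffix n ?x) (e ## kn e)" if "suffix n ?x 0 = e" for n e
    using dle_dlt_trans[OF ext[OF that] iter_om_dlt_K] .
  have "\<exists>n. ?x n = e" for e
  proof -
    obtain n where "suffix 0 (?o e) = suffix n ?x" using tail by blast
    then have "?o e 0 = ?x n" using fun_cong[of "suffix 0 (?o e)" "suffix n ?x" 0] by simp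
    then show ?thesis using om_iter_0 by metis
  qed
  then have often: "\<exists>n\<ge>m. ?x n = e" for e m
  proof -
    obtain n where "?x n = e" using \<open>\<And>e. \<exists>n. ?x n = e\<close> by blast
    then have "suffix (n + M * m) ?x 0 = e" unfolding perM by simp
    then have "?x (n + M * m) = e" by simp
    moreover have "m \<le> n + M * m" using M0 by (cases M) auto
    ultimately show ?thesis by blast
  qed
  have after: "dle e (suffix (Suc n) ?x) (kn e)" if xn: "?x n = e" for n e
  proof -
    have "suffix n ?x 0 = e" using xn by simp
    then have "dle e (suffix n ?x) (e ## kn e)" using extK unfolding dle_def by blast
    moreover have "suffix n ?x = e ## suffix (Suc n) ?x"
      using suffix_singleton_suffix[of ?x n] xn by simp
    ultimately show ?thesis using dle_build by metis
  qed
  \<comment> \<open>Starting behind a digit \<open>e\<close>, the bound survives a run of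
    \<open>\<not> e\<close>, since shifting shortens the run. By periodicity every position is
    preceded by such a digit.\<close>
  have later: "dle e (suffix (Suc (n0 + n)) ?x) (kn e)" if n0: "?x n0 = e" for n0 n e
  proof (induction n)
    case 0
    then show ?case using after[OF n0] by (simp only: add_0_right)
  next
    case (Suc n)
    let ?y = "suffix (Suc (Suc (n0 + n))) ?x"
    consider "?x (Suc (n0 + n)) = e" | "?x (Suc (n0 + n)) = (\<not> e)" "?y 0 = e" |
      "?x (Suc (n0 + n)) = (\<not> e)" "?y 0 = (\<not> e)" by blast
    then show ?case
    proof cases
      case 1
      then show ?thesis using after[of "Suc (n0 + n)" e] by (simp only: add_Suc_right)
    next
      case 2
      then have "dlt e ?y (kn e)" by (intro dlt_heads kn_0)
      then show ?thesis unfolding dle_def by (simp only: add_Suc_right simp_thms)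
    next
      case 3
      have "suffix (Suc (n0 + n)) ?x = (\<not> e) ## ?y"
        using suffix_singleton_suffix[of ?x "Suc (n0 + n)"] 3(1) by simp
      then have "dle e ?y (suffix (Suc (n0 + n)) ?x)"
        using dle_build_self[where c = e and x = ?y, OF 3(2)] by (simp only:)
      then have "dle e ?y (kn e)" using Suc dle_trans by blast
      then show ?thesis by (simp only: add_Suc_right)
    qed
  qed
  have xmem: "?x \<in> lexset kn"
    unfolding lexset_def
  proof (intro CollectI allI)
    fix n e
    obtain n0 where n0: "?x n0 = e" using often by blast
    have "Suc n0 \<le> n + M * Suc n0" using M0 by (cases M) auto
    then obtain m where "n + M * Suc n0 = Suc n0 + m" using le_Suc_ex by blast
    then have "suffix n ?x = suffix (Suc (n0 + m)) ?x" using perM[of n "Suc n0"] by (simp only: add_Suc)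
    then show "dle e (suffix n ?x) (kn e)" using later[OF n0, of m] by (simp only:)
  qed
  \<comment> \<open>If \<open>kn e\<close> is preceded by \<open>e\<close> on the orbit, strictness
    in \<open>extK\<close> fails. If it is preceded by \<open>\<not> e\<close>, it is constant, but
    \<open>e\<close> recurs on the orbit.\<close>
  have avoid: "suffix n ?x \<noteq> kn e" for n e
  proof
    assume "suffix n ?x = kn e"
    then have "suffix (n + M * 1) ?x = kn e" unfolding perM .
    moreover obtain n' where n': "n + M * 1 = Suc n'" using M0 by (cases M) auto
    ultimately have eq': "suffix (Suc n') ?x = kn e" by simp
    have cons: "suffix n' ?x = ?x n' ## kn e"
      using suffix_singleton_suffix[of ?x n'] unfolding eq' by simp
    show False
    proof (cases "?x n' = e")
      case True
      then have "suffix n' ?x 0 = e" by simp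
      then have "dlt e (suffix n' ?x) (e ## kn e)" by (rule extK)
      then show False unfolding cons True by simp
    next
      case False
      then have xn': "?x n' = (\<not> e)" by blast
      have "dle e (suffix n' ?x) (kn e)" using xmem unfolding lexset_def by blast
      then have "kn e = (\<not> e) ## kn e"
        unfolding cons xn' by (rule dle_antisym[OF dle_build_self[where c = e and x = "kn e", OF kn_0]])
      then have "kn e i = (\<not> e)" for i
        by (induction i) (metis build.simps)+
      moreover obtain i where "i \<ge> Suc n'" "?x i = e" using often by blast
      then have "suffix (Suc n') ?x (i - Suc n') = e" by simp
      ultimately show False unfolding eq' by (metis (full_types))
    qed
  qed
  obtain kk where kk: "?x kk = c" "(c ## kn c) kk = (\<not> c)" using iter_om_dlt_K[of c] unfolding dlt_def by blast
  \<comment> \<open>Long enough to begin with \<open>hub c\<close> and to contain the position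
    \<open>kk\<close> at which \<open>?x\<close> differs from \<open>c ## kn c\<close>.\<close>
  define u where "u = prefix (kk + Suc J) (c ## kn c)"
  have "u \<frown> suffix (kk + Suc J) (c ## kn c) \<in> lexset kn"
    unfolding u_def using K_mem by (simp only: prefix_suffix[symmetric])
  then have "language_prefix u" by (rule language_prefixI)
  moreover have "u \<noteq> []" unfolding u_def subsequence_empty by simp
  moreover have "periodic ?x" unfolding periodic_def using perM[of 0 1] M0 by (intro exI[of _ M]) simp
  ultimately obtain t where t: "(u @ t) \<frown> ?x \<in> lexset kn" "\<And>n e. suffix n ((u @ t) \<frown> ?x) \<noteq> kn e"
    using reaches_periodic[OF xmem _ avoid] by blast
  let ?z = "(u @ t) \<frown> ?x"
  have agz: "agree (kk + Suc J) ?z (c ## kn c)"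
  proof -
    have "prefix (length u) ?z = u" unfolding conc_conc[symmetric] by (rule prefix_conc_length)
    moreover have "length u = kk + Suc J" unfolding u_def subsequence_length by simp
    ultimately show ?thesis unfolding prefix_eq_iff[symmetric] by (simp only: u_def)
  qed
  \<comment> \<open>Induction on the time \<open>n\<close> at which the orbit is joined. Behind
    \<open>om e\<close>, a remainder beginning with \<open>\<not> e\<close> is squeezed onto the
    remainder of \<open>e ## kn e\<close>, so that \<open>z\<close> would pass through
    \<open>kn e\<close>.\<close>
  have claim: "z = ?o e" if "decomposable z" "z \<in> lexset kn" "z 0 = e" "\<And>n e'. suffix n z \<noteq> kn e'"
    "suffix n z = suffix n' ?x" for n n' z e
    using that
  proof (induction n arbitrary: z e n' rule: less_induct)
    case (less n)
    have ge: "dle e (?o e) z" by (rule decomposable_ge[OF less.prems(1,3)])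
    show ?case
    proof (cases "n = 0")
      case True
      then have z: "z = suffix n' ?x" using less.prems(5) by (simp only: suffix_0)
      then have "dle e z (?o e)" using ext[of n' e] less.prems(3) by (simp only:)
      then show ?thesis using ge dle_antisym by blast
    next
      case False
      obtain z' where z': "z = om e \<frown> z'" "decomposable z'"
        using decomposable_om[OF less.prems(1,3)] .
      have zl: "z' \<in> lexset kn" using less.prems(2) z'(1) lexset_conc_D by blast
      have zs: "suffix n z' = suffix (length (om e) + n) z" for n unfolding z'(1) by simp
      have zt: "suffix n z' \<noteq> kn e'" for n e' using less.prems(4) zs by metis
      let ?n = "n - length (om e)"
      have nl: "?n < n" using False om(1)[of e] by (simp add: diff_less)
      \<comment> \<open>If the orbit is joined inside the first block, \<open>?n\<close> is
        truncated to 0 and the surplus moves to the index on the orbit.\<close>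
      have "suffix ?n z' = suffix (length (om e) - n + n') ?x"
      proof -
        have "suffix ?n z' = suffix (length (om e) - n) (suffix n z)"
          unfolding zs suffix_suffix by (rule arg_cong[of _ _ "\<lambda>m. suffix m z"]) simp
        then show ?thesis unfolding less.prems(5) suffix_suffix by (simp only: add.commute)
      qed
      then have z'o: "z' = ?o (z' 0)" using less.IH[OF nl z'(2) zl refl zt] by blast
      show ?thesis
      proof (cases "z' 0 = e")
        case True
        then have "z' = ?o e" using z'o by simp
        then show ?thesis using z'(1) om_unroll[of e] by simp
      next
        case False
        then have z'e: "z' = ?o (\<not> e)" using z'o by simp
        obtain y where y: "e ## kn e = om e \<frown> y" "decomposable y" "y 0 = (\<not> e)" using K_split .
        have "dle (\<not> e) z' y" unfolding z'e by (rule decomposable_ge[OF y(2,3)])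
        then have 1: "dle e y z'" unfolding dle_flip .
        have "dle e z (e ## kn e)" by (rule dle_K[OF less.prems(2,3)])
        then have "dle e z' y" unfolding z'(1) y(1) by (simp only: dle_conc)
        then have "z' = y" using 1 dle_antisym by blast
        then have "z = e ## kn e" using z'(1) y(1) by simp
        then have "suffix 1 z = suffix 1 (e ## kn e)" by (simp only:)
        also have "\<dots> = kn e" by (rule HOL.ext) simp
        finally have "suffix 1 z = kn e" .
        then show ?thesis using less.prems(4) by blast
      qed
    qed
  qed
  have "?z 0 = c" using agz[rule_format, of 0] by simp
  moreover have "decomposable ?z" by (rule decomposable_hub[OF t(1) agree_mono[OF agz]]) simp
  moreover have "suffix (length (u @ t)) ?z = suffix 0 ?x" by (simp only: suffix_conc_length suffix_0)
  ultimately have "?z = ?x" using claim[OF _ t(1) _ t(2)] by blast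
  then have "?x kk = (c ## kn c) kk" using agz by (metis less_add_Suc1 add_Suc_right add_Suc_shift)
  then show False using kk by simp
qed

lemma rotate_om_dlt:
  assumes "hd (rotate k (om (\<not> c))) = c"
  shows "dlt c ((rotate k (om (\<not> c)))\<^sup>\<omega>) ((om c)\<^sup>\<omega>)"
proof -
  let ?u = "om (\<not> c)"
  define l where "l = k mod length ?u"
  have rot: "rotate l ?u = rotate k ?u" unfolding l_def by (rule rotate_conv_mod[symmetric])
  have ll: "l < length ?u" unfolding l_def using om(1) by simp
  have hdl: "?u ! l = c" using assms unfolding rot[symmetric] by (simp add: hd_rotate_conv_nth om(1) ll)
  then have "0 < l" using om_nth_0[of "\<not> c"] by (metis (full_types) gr0I)
  have s: "(rotate k ?u)\<^sup>\<omega> = suffix l (?u\<^sup>\<omega>)" unfolding rot[symmetric] suffix_iter[OF om(1)] ..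
  show ?thesis
    using rotate_om_dle[OF \<open>0 < l\<close> ll hdl] orbits_differ[OF \<open>0 < l\<close> ll] unfolding s dle_def by blast
qed

lemma blocks_Suc:
  "blocks u v e (Suc k) = blocks u v e k @ concat (replicate (the_enat (e k)) (if even k then u else v))"
  unfolding blocks_def by simp

lemma decomposable_run:
  assumes x: "decomposable x" "x 0 = c"
  shows "x = (om c)\<^sup>\<omega> \<or> (\<exists>n\<ge>1. \<exists>y. x = concat (replicate n (om c)) \<frown> y \<and> decomposable y \<and> y 0 = (\<not> c))"
proof (rule ccontr)
  assume no: "\<not> ?thesis"
  have run: "\<exists>y. x = concat (replicate n (om c)) \<frown> y \<and> decomposable y \<and> y 0 = c" for n
  proof (induction n)
    case 0
    then show ?case using x by simp
  next
    case (Suc n)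
    then obtain y where y: "x = concat (replicate n (om c)) \<frown> y" "decomposable y" "y 0 = c" by blast
    obtain y' where y': "y = om c \<frown> y'" "decomposable y'" using decomposable_om[OF y(2,3)] .
    have "om c @ concat (replicate n (om c)) = concat (replicate n (om c)) @ om c"
      by (induction n) simp_all
    then have "concat (replicate (Suc n) (om c)) = concat (replicate n (om c)) @ om c" by simp
    then have xy: "x = concat (replicate (Suc n) (om c)) \<frown> y'" using y(1) y'(1) by (simp only: conc_conc)
    then have "y' 0 = c" using no y'(2) by (metis (full_types) le_add1 plus_1_eq_Suc)
    then show ?case using xy y'(2) by blast
  qed
  have iter: "concat (replicate n (om c)) \<frown> (om c)\<^sup>\<omega> = (om c)\<^sup>\<omega>" for n
  proof (induction n)
    case (Suc n)
    have "concat (replicate (Suc n) (om c)) \<frown> (om c)\<^sup>\<omega> = om c \<frown> concat (replicate n (om c)) \<frown> (om c)\<^sup>\<omega>"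
      by (simp only: replicate_Suc concat.simps conc_conc)
    then show ?case unfolding Suc om_unroll[symmetric] .
  qed simp
  have "x i = (om c)\<^sup>\<omega> i" for i
  proof -
    let ?w = "concat (replicate (Suc i) (om c))"
    have "Suc i * 1 \<le> Suc i * length (om c)" using om(1)[of c] by (intro mult_le_mono2) (simp add: Suc_leI)
    then have "i < length ?w" by (simp only: length_concat map_replicate sum_list_replicate) simp
    moreover obtain y where "x = ?w \<frown> y" using run by blast
    ultimately have "x i = (?w \<frown> (om c)\<^sup>\<omega>) i" by (simp only: conc_fst)
    then show ?thesis by (simp only: iter)
  qed
  then show False using no by blast
qed

lemma decomposable_alternating:
  assumes "decomposable y" "y 0 = c"
  shows "\<exists>e. (\<forall>i. e i \<ge> 1) \<and> is_alternating (om c) (om (\<not> c)) e y"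
proof -
  \<comment> \<open>After an infinite exponent \<open>y'\<close> need only be decomposable, which
    keeps the iteration total.\<close>
  define R where "R y E y' \<longleftrightarrow> decomposable y' \<and> E \<ge> 1 \<and> (E = \<infinity> \<and> y = (om (y 0))\<^sup>\<omega> \<or>
      (\<exists>n. E = enat n \<and> y = concat (replicate n (om (y 0))) \<frown> y' \<and> y' 0 = (\<not> y 0)))" for y E y'
  have ex: "\<exists>p. R y (fst p) (snd p)" if y: "decomposable y" for y
    using decomposable_run[OF y refl]
  proof
    assume "y = (om (y 0))\<^sup>\<omega>"
    then have "R y \<infinity> y" unfolding R_def using y by simp
    then show ?thesis by (intro exI[of _ "(\<infinity>, y)"]) simp
  next
    assume "\<exists>n\<ge>1. \<exists>y'. y = concat (replicate n (om (y 0))) \<frown> y' \<and> decomposable y' \<and> y' 0 = (\<not> y 0)"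
    then obtain n y' where n: "n \<ge> 1" "y = concat (replicate n (om (y 0))) \<frown> y'" "decomposable y'" "y' 0 = (\<not> y 0)"
      by blast
    have "enat n \<ge> 1" using n(1) by (simp add: one_enat_def)
    then have "R y (enat n) y'" unfolding R_def using n by blast
    then show ?thesis by (intro exI[of _ "(enat n, y')"]) simp
  qed
  define f where "f y = (SOME p. R y (fst p) (snd p))" for y
  have f: "R y (fst (f y)) (snd (f y))" if "decomposable y" for y
    unfolding f_def by (rule someI_ex[OF ex[OF that]])
  define Y where "Y k = ((\<lambda>y. snd (f y)) ^^ k) y" for k
  define e where "e k = fst (f (Y k))" for k
  have YS: "Y (Suc k) = snd (f (Y k))" for k unfolding Y_def by simp
  have Yd: "decomposable (Y k)" for k
  proof (induction k)
    case 0 then show ?case unfolding Y_def using assms by simp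
  next
    case (Suc k) then show ?case unfolding YS using f R_def by blast
  qed
  have RY: "R (Y k) (e k) (Y (Suc k))" for k unfolding YS e_def by (rule f[OF Yd])
  have Y0: "Y 0 = y" unfolding Y_def by simp
  have main: "(\<forall>j<k. e j \<noteq> \<infinity>) \<Longrightarrow> y = blocks (om c) (om (\<not> c)) e k \<frown> Y k \<and>
      Y k 0 = (if even k then c else \<not> c)" for k
  proof (induction k)
    case 0
    then show ?case using assms by (simp add: Y0 blocks_def)
  next
    case (Suc k)
    then have IH: "y = blocks (om c) (om (\<not> c)) e k \<frown> Y k" "Y k 0 = (if even k then c else \<not> c)" by auto
    have "e k \<noteq> \<infinity>" using Suc.prems by blast
    from conjunct2[OF conjunct2[OF RY[of k, unfolded R_def]]]
    have "\<exists>n. e k = enat n \<and> Y k = concat (replicate n (om (Y k 0))) \<frown> Y (Suc k) \<and>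
      Y (Suc k) 0 = (\<not> Y k 0)"
    proof
      assume "e k = \<infinity> \<and> Y k = (om (Y k 0))\<^sup>\<omega>"
      then show ?thesis using \<open>e k \<noteq> \<infinity>\<close> by (elim conjE notE)
    qed
    then obtain n where n: "e k = enat n" "Y k = concat (replicate n (om (Y k 0))) \<frown> Y (Suc k)"
      "Y (Suc k) 0 = (\<not> Y k 0)" by (elim exE conjE) (rule that)
    have omY: "om (Y k 0) = (if even k then om c else om (\<not> c))" unfolding IH(2) by simp
    have "y = blocks (om c) (om (\<not> c)) e k \<frown> concat (replicate n (om (Y k 0))) \<frown> Y (Suc k)"
      using IH(1) n(2) by metis
    then have "y = blocks (om c) (om (\<not> c)) e (Suc k) \<frown> Y (Suc k)"
      unfolding blocks_Suc n(1) the_enat.simps omY by (simp only: conc_conc)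
    then show ?case using n(3) IH(2) by simp
  qed
  have "is_alternating (om c) (om (\<not> c)) e y"
    unfolding is_alternating_def
  proof (intro allI impI)
    fix k assume fin: "\<forall>j<k. e j \<noteq> \<infinity>"
    note m = main[OF fin]
    have "Y k = (if even k then om c else om (\<not> c))\<^sup>\<omega>" if "e k = \<infinity>"
    proof -
      have "Y k = (om (Y k 0))\<^sup>\<omega>" using RY[of k] that unfolding R_def by auto
      then show ?thesis using m by (cases "even k") auto
    qed
    then show "\<exists>z. y = blocks (om c) (om (\<not> c)) e k \<frown> z \<and>
        (e k = \<infinity> \<longrightarrow> z = (if even k then om c else om (\<not> c))\<^sup>\<omega>)"
      by (intro exI[of _ "Y k"] conjI impI conjunct1[OF m])
  qed
  moreover have "e i \<ge> 1" for i using RY unfolding R_def by blast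
  ultimately show ?thesis by blast
qed

lemma renormalisable: "renormalisable_by_words (kn False) (kn True)"
proof -
  have ren: "\<exists>y e. c ## kn c = om c \<frown> y \<and> (\<forall>i. e i \<ge> 1) \<and> is_alternating (om (\<not> c)) (om c) e y" for c
  proof -
    obtain y where y: "c ## kn c = om c \<frown> y" "decomposable y" "y 0 = (\<not> c)" using K_split .
    then show ?thesis using decomposable_alternating[OF y(2,3)] by (metis not_not)
  qed
  obtain x e where x: "False ## kn False = om False \<frown> x" "\<forall>i. e i \<ge> 1"
    "is_alternating (om True) (om False) e x"
    using ren[of False] unfolding not_False_eq_True by blast
  obtain y f where y: "True ## kn True = om True \<frown> y" "\<forall>i. f i \<ge> 1"
    "is_alternating (om False) (om True) f y"
    using ren[of True] unfolding not_True_eq_False by blast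
  have rot0: "rotate 0 w = w" for w :: bword by simp
  have "is_0max (om False) (om False)"
    unfolding is_0max_def begins0_def
    using om(1,2) om_extremal[of _ False] word_dlt_lexordp[of _ "om False" False] by (metis rot0 length_rotate)
  moreover have "is_1min (om True) (om True)"
    unfolding is_1min_def begins1_def
    using om(1,2) om_extremal[of _ True] word_dlt_lexordp[of _ "om True" True] by (metis rot0 length_rotate)
  moreover have "u\<^sup>\<omega> \<prec>\<^sub>l (om False)\<^sup>\<omega>" if "is_0max (om True) u" for u
    using that rotate_om_dlt[of _ False] unfolding is_0max_def begins0_def dlt_less_fun by auto
  moreover have "(om True)\<^sup>\<omega> \<prec>\<^sub>l u\<^sup>\<omega>" if "is_1min (om False) u" for u
    using that rotate_om_dlt[of _ True] unfolding is_1min_def begins1_def dlt_less_fun by auto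
  moreover have "length (om False @ om True) \<ge> 3"
  proof -
    have "length (om c) \<ge> 2" for c
      using om(1)[of c] om(3)[of c] d_ge_2 by (meson dvd_imp_le le_trans length_greater_0_conv)
    from add_mono[OF this[of False] this[of True]] show ?thesis by simp
  qed
  ultimately show ?thesis
    unfolding renormalisable_by_words_def using x y
    by (intro exI[of _ "om False"] exI[of _ "om True"] exI[of _ e] exI[of _ f] exI[of _ x] exI[of _ y]) simp
qed

end

section \<open>Words and limits in the shift space\<close>

lemma suffix_as_conc: "subsequence x i (i + length w) = w \<longleftrightarrow> (\<exists>y. suffix i x = w \<frown> y)"
proof
  assume "subsequence x i (i + length w) = w"
  then have "prefix (length w) (suffix i x) = w" by (simp only: subsequence_shift add_0_right)
  then show "\<exists>y. suffix i x = w \<frown> y" by (metis prefix_suffix)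
next
  assume "\<exists>y. suffix i x = w \<frown> y"
  then obtain y where "suffix i x = w \<frown> y" by blast
  then have "prefix (length w) (suffix i x) = w" by (simp only: prefix_conc_length)
  then show "subsequence x i (i + length w) = w" by (simp only: subsequence_shift add_0_right)
qed

lemma occurs_iff: "occurs w x \<longleftrightarrow> (\<exists>i y. suffix i x = w \<frown> y)"
  unfolding occurs_def suffix_as_conc ..

lemma language_lexset: "w \<in> language (lexset kn) \<longleftrightarrow> w \<noteq> [] \<and> (\<exists>x. w \<frown> x \<in> lexset kn)"
proof
  assume "w \<in> language (lexset kn)"
  then obtain x i y where "w \<noteq> []" and x: "x \<in> lexset kn" "suffix i x = w \<frown> y"
    unfolding language_def occurs_iff by blast
  have "w \<frown> y \<in> lexset kn" using lexset_suffix[OF x(1), of i] by (simp only: x(2))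
  then show "w \<noteq> [] \<and> (\<exists>x. w \<frown> x \<in> lexset kn)" using \<open>w \<noteq> []\<close> by blast
next
  assume "w \<noteq> [] \<and> (\<exists>x. w \<frown> x \<in> lexset kn)"
  then obtain x where "w \<noteq> []" "w \<frown> x \<in> lexset kn" by blast
  moreover have "occurs w (w \<frown> x)" unfolding occurs_iff by (intro exI[of _ 0]) auto
  ultimately show "w \<in> language (lexset kn)" unfolding language_def by blast
qed

lemma open_cylinder: "open {y. agree m x y}"
proof -
  have eq: "{y. agree m x y} = (\<Inter>i\<in>{..<m}. (\<lambda>y. y i) -` {x i})"
    by (auto simp only: vimage_def mem_Collect_eq INT_iff lessThan_iff singleton_iff)
  have "open ((\<lambda>y :: bseq. y i) -` {x i})" for i
    by (rule open_vimage[OF open_discrete continuous_on_product_coordinates])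
  then show ?thesis unfolding eq by (intro open_INT) auto
qed

lemma closure_agree:
  assumes "x \<in> closure X"
  obtains y where "y \<in> X" "agree m x y"
proof -
  have "\<exists>y\<in>X. y \<in> {y. agree m x y}"
    using assms open_cylinder[of m x] unfolding closure_iff_nhds_not_empty by fastforce
  then show thesis using that by blast
qed

lemma LIMSEQ_agree:
  assumes "X \<longlonglongrightarrow> x"
  shows "\<exists>N. \<forall>n\<ge>N. agree m x (X n)"
proof -
  have "eventually (\<lambda>n. X n \<in> {y. agree m x y}) sequentially"
    by (rule topological_tendstoD[OF assms open_cylinder]) simp
  then show ?thesis unfolding eventually_sequentially by simp
qed

text \<open>A forbidden word that starts inside \<open>u\<close> ends within the next
  \<open>L\<close> digits, where \<open>x\<close> and \<open>y\<close> coincide.\<close>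

lemma finite_type_window:
  assumes "finite_type S"
  obtains L where "\<And>u x y. u \<frown> y \<in> S \<Longrightarrow> x \<in> S \<Longrightarrow> agree L x y \<Longrightarrow> u \<frown> x \<in> S"
proof -
  obtain F where F: "finite F" "S = {x. \<forall>w\<in>F. \<not> occurs w x}"
    using assms unfolding finite_type_def by blast
  define L where "L = Max (insert 0 (length ` F))"
  have L: "length w \<le> L" if "w \<in> F" for w unfolding L_def using F(1) that by simp
  have "u \<frown> x \<in> S" if u: "u \<frown> y \<in> S" and x: "x \<in> S" and ag: "agree L x y" for u x y
  proof -
    have "\<not> occurs w (u \<frown> x)" if w: "w \<in> F" for w
    proof
      assume "occurs w (u \<frown> x)"
      then obtain i z where z: "suffix i (u \<frown> x) = w \<frown> z" unfolding occurs_iff by blast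
      show False
      proof (cases "i \<ge> length u")
        case True
        then have "suffix (i - length u) x = w \<frown> z" using z by (simp only: suffix_conc_snd)
        then show False using x w unfolding F(2) occurs_iff by blast
      next
        case False
        have long: "agree (length u + L) (u \<frown> x) (u \<frown> y)"
          unfolding agree_conc using ag by (simp only: add_diff_cancel_left')
        have "agree (length w) (w \<frown> z) (suffix i (u \<frown> y))"
        proof (intro allI impI)
          fix j assume j: "j < length w"
          then have "i + j < length u + L" using False L[OF w] by simp
          then have "(u \<frown> x) (i + j) = (u \<frown> y) (i + j)" using long by blast
          then show "(w \<frown> z) j = suffix i (u \<frown> y) j"
            unfolding z[symmetric] suffix_nth .
        qed
        then have "suffix i (u \<frown> y) = w \<frown> suffix (length w) (suffix i (u \<frown> y))" by (rule agree_imp_conc)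
        then show False using u w unfolding F(2) occurs_iff by blast
      qed
    qed
    then show ?thesis unfolding F(2) by blast
  qed
  then show thesis using that by blast
qed

lemma suffix_periodic:
  assumes "suffix p x = x"
  shows "suffix (p * n) x = x"
proof (induction n)
  case (Suc n)
  have "suffix (p * Suc n) x = suffix (p * n) (suffix p x)" unfolding suffix_suffix by (simp only: mult_Suc_right)
  then show ?case unfolding assms Suc .
qed (simp only: mult_0_right suffix_0)

section \<open>Approximation by transitive subshifts of finite type\<close>

locale approximated_kneading = kneading +
  fixes KN :: "nat \<Rightarrow> bool \<Rightarrow> bseq"
  assumes KN_kneading: "\<And>n. kneading (KN n)"
    and KN_transitive: "\<And>n. transitive_shift (lexset (KN n))"
    and KN_finite_type: "\<And>n. finite_type (lexset (KN n))"
    and KN_increasing: "\<And>n. lexset (KN n) \<subseteq> lexset (KN (Suc n))"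
    and KN_closure: "lexset kn = closure (\<Union>n. lexset (KN n))"
    and KN_periodic: "\<And>n c. periodic (KN n c)"
    and KN_lim: "\<And>m c. \<exists>N. \<forall>n\<ge>N. agree m (kn c) (KN n c)"
begin

lemma KN_mono: "m \<le> n \<Longrightarrow> lexset (KN m) \<subseteq> lexset (KN n)"
  by (rule lift_Suc_mono_le[where f = "\<lambda>n. lexset (KN n)", OF KN_increasing])

lemma KN_subset: "lexset (KN n) \<subseteq> lexset kn"
  unfolding KN_closure by (meson UN_upper UNIV_I closure_subset order_trans)

lemma KN_mem: "KN n c \<in> lexset kn"
  using KN_subset kneading.kn_mem[OF KN_kneading] by blast

lemma KN_language:
  assumes "language_prefix u"
  obtains N where "\<And>n. n \<ge> N \<Longrightarrow> \<exists>x. u \<frown> x \<in> lexset (KN n)"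
proof -
  obtain x where "u \<frown> x \<in> lexset kn" using assms unfolding language_prefix_def by blast
  then obtain y where y: "y \<in> (\<Union>n. lexset (KN n))" "agree (length u) (u \<frown> x) y"
    using closure_agree unfolding KN_closure by blast
  then obtain N where "y \<in> lexset (KN N)" by blast
  then have "u \<frown> suffix (length u) y \<in> lexset (KN N)" using agree_imp_conc[OF y(2)] by (simp only:)
  then show thesis using that[of N] KN_mono by blast
qed

lemma transitive:
  assumes "u \<noteq> []" "v \<noteq> []" "language_prefix u" "language_prefix v"
  shows "\<exists>t. t \<noteq> [] \<and> language_prefix (u @ t @ v)"
proof -
  obtain N1 where N1: "\<And>n. n \<ge> N1 \<Longrightarrow> \<exists>x. u \<frown> x \<in> lexset (KN n)" using KN_language[OF assms(3)] by blast
  obtain N2 where N2: "\<And>n. n \<ge> N2 \<Longrightarrow> \<exists>x. v \<frown> x \<in> lexset (KN n)" using KN_language[OF assms(4)] by blast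
  have "u \<in> language (lexset (KN (N1 + N2)))" "v \<in> language (lexset (KN (N1 + N2)))"
    unfolding language_lexset using assms N1 N2 by auto
  then obtain t where t: "t \<in> language (lexset (KN (N1 + N2)))" "u @ t @ v \<in> language (lexset (KN (N1 + N2)))"
    using KN_transitive unfolding transitive_shift_def by blast
  then have "t \<noteq> []" "\<exists>x. (u @ t @ v) \<frown> x \<in> lexset (KN (N1 + N2))" unfolding language_lexset by auto
  then show ?thesis unfolding language_prefix_def using KN_subset by blast
qed

text \<open>A periodic orbit avoiding both kneading sequences satisfies finitely many strict bounds,
  so it lies in an approximating subshift. There transitivity leads to a long prefix of
  \<open>x\<close>, and finite type allows \<open>x\<close> itself to follow.\<close>

lemma reaches_periodic:
  assumes x: "x \<in> lexset kn" "periodic x" "\<And>n c. suffix n x \<noteq> kn c" and u: "u \<noteq> []" "language_prefix u"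
  shows "\<exists>t. (u @ t) \<frown> x \<in> lexset kn \<and> (\<forall>n c. suffix n ((u @ t) \<frown> x) \<noteq> kn c)"
proof -
  obtain p where p: "p \<ge> 1" "suffix p x = x" using x(2) unfolding periodic_def by blast
  have ev: "\<exists>N. \<forall>n\<ge>N. dle c (suffix i x) (KN n c)" for i c
  proof -
    have "dlt c (suffix i x) (kn c)" using x(1,3) unfolding lexset_def dle_def by blast
    then obtain m where m: "\<And>x' y'. agree m (suffix i x) x' \<Longrightarrow> agree m (kn c) y' \<Longrightarrow> dlt c x' y'"
      by (rule dlt_neighbourhood) blast
    obtain N where "\<forall>n\<ge>N. agree m (kn c) (KN n c)" using KN_lim by blast
    then have "\<forall>n\<ge>N. dle c (suffix i x) (KN n c)" using m unfolding dle_def by blast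
    then show ?thesis by blast
  qed
  define N where "N i c = (SOME N. \<forall>n\<ge>N. dle c (suffix i x) (KN n c))" for i c
  have N: "dle c (suffix i x) (KN n c)" if "n \<ge> N i c" for i c n
    using someI_ex[OF ev[of c i]] that unfolding N_def by blast
  define N0 where "N0 = Max ((\<lambda>(i, c). N i c) ` ({..<p} \<times> UNIV))"
  have N0: "N i c \<le> N0" if "i < p" for i c
    unfolding N0_def by (rule Max_ge) (use that in force)+
  obtain N1 where N1: "\<And>n. n \<ge> N1 \<Longrightarrow> \<exists>y. u \<frown> y \<in> lexset (KN n)" using KN_language[OF u(2)] by blast
  define n where "n = N0 + N1"
  have xn: "x \<in> lexset (KN n)"
    unfolding lexset_def
  proof (intro CollectI allI)
    fix i c
    have "suffix i x = suffix (i mod p) (suffix (p * (i div p)) x)"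
      unfolding suffix_suffix by (rule arg_cong[of _ _ "\<lambda>j. suffix j x"]) simp
    then have "suffix i x = suffix (i mod p) x" unfolding suffix_periodic[OF p(2)] .
    moreover have "N (i mod p) c \<le> n" using N0[of "i mod p" c] p(1) unfolding n_def by simp
    ultimately show "dle c (suffix i x) (KN n c)" using N by metis
  qed
  obtain L where L: "\<And>u x y. u \<frown> y \<in> lexset (KN n) \<Longrightarrow> x \<in> lexset (KN n) \<Longrightarrow> agree L x y \<Longrightarrow> u \<frown> x \<in> lexset (KN n)"
    using finite_type_window[OF KN_finite_type] by blast
  have "u \<in> language (lexset (KN n))" unfolding language_lexset using u(1) N1[of n] by (simp add: n_def)
  moreover have "prefix (Suc L) x \<in> language (lexset (KN n))"
  proof -
    have "prefix (Suc L) x \<frown> suffix (Suc L) x \<in> lexset (KN n)" using xn by (simp only: prefix_suffix[symmetric])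
    moreover have "prefix (Suc L) x \<noteq> []" unfolding subsequence_empty by simp
    ultimately show ?thesis unfolding language_lexset by blast
  qed
  ultimately obtain t where "u @ t @ prefix (Suc L) x \<in> language (lexset (KN n))"
    using KN_transitive unfolding transitive_shift_def by blast
  then obtain y where "(u @ t @ prefix (Suc L) x) \<frown> y \<in> lexset (KN n)" unfolding language_lexset by blast
  then have "(u @ t) \<frown> (prefix (Suc L) x \<frown> y) \<in> lexset (KN n)" by (simp only: conc_conc append_assoc)
  moreover have "agree L x (prefix (Suc L) x \<frown> y)"
    by (intro allI impI) (simp only: conc_def subsequence_length, simp del: subseq_to_Suc)
  ultimately have mem: "(u @ t) \<frown> x \<in> lexset (KN n)" using L xn by blast
  have "suffix m ((u @ t) \<frown> x) \<noteq> kn c" for m c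
  proof
    \<comment> \<open>On the path, \<open>kn c\<close> would lie in the approximating subshift and
      hence equal its bound \<open>KN n c\<close>. Being periodic, it would recur on the orbit of
      \<open>x\<close>.\<close>
    assume kn: "suffix m ((u @ t) \<frown> x) = kn c"
    have "kn c \<in> lexset (KN n)" using lexset_suffix[OF mem] kn by metis
    then have "dle c (kn c) (KN n c)" by (rule lexset_dle)
    moreover have "dle c (KN n c) (kn c)" by (rule lexset_dle[OF KN_mem])
    ultimately have eq: "KN n c = kn c" by (rule dle_antisym[rotated])
    let ?l = "length (u @ t)"
    have "suffix ?l (kn c) = suffix (m + ?l) ((u @ t) \<frown> x)" unfolding kn[symmetric] suffix_suffix ..
    also have "\<dots> = suffix m x" by (subst suffix_conc_snd) (simp_all only: le_add2 add_diff_cancel_right')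
    finally have tail: "suffix ?l (kn c) = suffix m x" .
    show False
    proof (cases "periodic (kn c)")
      case True
      then obtain p' where p': "p' \<ge> 1" "suffix p' (kn c) = kn c" unfolding periodic_def by blast
      have le: "?l \<le> p' * ?l" using p'(1) by simp
      have "kn c = suffix (p' * ?l) (kn c)" using suffix_periodic[OF p'(2)] by (simp only:)
      also have "\<dots> = suffix (p' * ?l - ?l) (suffix ?l (kn c))"
        unfolding suffix_suffix using le by (simp only: le_add_diff_inverse)
      also have "\<dots> = suffix (m + (p' * ?l - ?l)) x" unfolding tail suffix_suffix ..
      finally show False using x(3) by metis
    next
      case False
      then show False using eq KN_periodic by metis
    qed
  qed
  then show ?thesis using mem KN_subset by blast
qed

end

section \<open>Boundedness of the connecting words\<close>

lemma iter_append: "u \<noteq> [] \<Longrightarrow> (v @ u)\<^sup>\<omega> = v \<frown> (u @ v)\<^sup>\<omega>"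
proof -
  assume u: "u \<noteq> []"
  have "suffix (length v) ((v @ u)\<^sup>\<omega>) = (u @ v)\<^sup>\<omega>"
    using u by (subst suffix_iter) (simp_all add: rotate_append)
  moreover have "prefix (length v) ((v @ u)\<^sup>\<omega>) = v"
  proof (rule nth_equalityI)
    fix i assume "i < length (prefix (length v) ((v @ u)\<^sup>\<omega>))"
    then have "i < length v" by simp
    moreover have "length (v @ u) \<noteq> 0" using u by simp
    ultimately show "prefix (length v) ((v @ u)\<^sup>\<omega>) ! i = v ! i" by (simp add: nth_append)
  qed simp
  ultimately show ?thesis using prefix_suffix[of "(v @ u)\<^sup>\<omega>" "length v"] by (simp only:)
qed

lemma iter_0: "u \<noteq> [] \<Longrightarrow> u\<^sup>\<omega> 0 = hd u"
  by (simp add: hd_conv_nth)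

lemma agree_suffix: "agree (k + m) x y \<Longrightarrow> agree m (suffix k x) (suffix k y)"
  by (intro allI impI) (simp only: suffix_nth add_less_cancel_left)

context approximated_kneading
begin

text \<open>
  \<open>w n c @ v n c\<close> is the period of \<open>c ## KN n c\<close> and \<open>v n c @ w n c\<close> its extremal rotation beginning with
  \<open>\<not> c\<close>. If the orbit of \<open>kn c\<close> accumulates at \<open>kn (\<not> c)\<close>, these rotations converge to \<open>(\<not> c) ## kn (\<not> c)\<close>,
  so \<open>v n c\<close> becomes long and a bounded \<open>w n (\<not> c)\<close> loses the comparison defining $p_1$ and $p_2$.
\<close>

lemma no_accumulation:
  assumes wv: "\<And>n c. w n c \<noteq> [] \<and> hd (w n c) = c \<and> v n c \<noteq> [] \<and> hd (v n c) = (\<not> c)"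
    and K: "\<And>n c. c ## KN n c = (w n c @ v n c)\<^sup>\<omega>"
    and ext: "\<And>n c k. hd (rotate k (w n c @ v n c)) = (\<not> c) \<Longrightarrow>
        dle (\<not> c) ((rotate k (w n c @ v n c))\<^sup>\<omega>) ((v n c @ w n c)\<^sup>\<omega>)"
    and nonconst: "\<And>c. \<exists>i. kn c i = c"
    and not_renorm: "\<And>c u. (\<not> c) ## kn (\<not> c) \<noteq> u \<frown> c ## kn c"
    and bounded: "\<And>n c. n \<ge> N\<^sub>0 \<Longrightarrow> length (v n c) > C \<Longrightarrow>
        length (w n (\<not> c)) \<le> C \<and> \<not> dlt c ((v n c)\<^sup>\<omega>) ((w n (\<not> c))\<^sup>\<omega>)"
  shows "\<exists>J. \<forall>n. \<not> agree J (suffix n (kn c)) (kn (\<not> c))"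
proof (rule ccontr)
  let ?K = "(\<not> c) ## kn (\<not> c)"
  assume "\<not> ?thesis"
  then have acc: "\<exists>n. agree J (suffix n (kn c)) (kn (\<not> c))" for J by blast
  \<comment> \<open>The digit before an approach to \<open>kn (\<not> c)\<close> is
    \<open>\<not> c\<close>: a \<open>c\<close> there would start a longer run of \<open>c\<close>
    than the initial one of \<open>kn (\<not> c)\<close>, which is the longest possible.\<close>
  have acc': "\<exists>n. agree J (suffix n (kn c)) ?K" for J
  proof -
    define i0 where "i0 = (LEAST i. kn (\<not> c) i = (\<not> c))"
    have i0: "kn (\<not> c) i0 = (\<not> c)" unfolding i0_def by (rule LeastI_ex[OF nonconst])
    have less: "kn (\<not> c) i = c" if "i < i0" for i
      using not_less_Least[OF that[unfolded i0_def]] by blast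
    obtain n where n: "agree (J + Suc i0) (suffix n (kn c)) (kn (\<not> c))" using acc by blast
    have "kn c n = kn (\<not> c) 0" using n[rule_format, of 0] by simp
    then have "n \<noteq> 0" using kn_0[of c] kn_0[of "\<not> c"] by (metis (full_types))
    then obtain n' where n': "n = Suc n'" using not0_implies_Suc by blast
    have cons: "suffix n' (kn c) = kn c n' ## suffix n (kn c)" unfolding n' suffix_singleton_suffix ..
    have "kn c n' = (\<not> c)"
    proof (rule ccontr)
      assume "\<not> ?thesis"
      then have kc: "kn c n' = c" by blast
      let ?x = "c ## suffix n (kn c)"
      have "?x i = c" if "i \<le> i0" for i
      proof (cases i)
        case (Suc j)
        then have "j < J + Suc i0" "j < i0" using that by auto
        then have "suffix n (kn c) j = c" using n less by metis
        then show ?thesis unfolding Suc by simp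
      qed simp
      then have "agree i0 ?x (kn (\<not> c)) \<and> ?x i0 = c" using less less_imp_le by blast
      then have "dlt c ?x (kn (\<not> c))" unfolding dlt_def using i0 by blast
      moreover have "dle (\<not> c) ?x (kn (\<not> c))"
        using lexset_dle[OF lexset_suffix[OF kn_mem[of c], of n'], of "\<not> c"] unfolding cons kc .
      ultimately show False unfolding dle_flip using not_dle by blast
    qed
    then have "suffix n' (kn c) = (\<not> c) ## suffix n (kn c)" unfolding cons by (simp only:)
    moreover have "agree (Suc (J + Suc i0)) ((\<not> c) ## suffix n (kn c)) ?K" by (rule agree_build[OF n])
    ultimately have "agree (Suc (J + Suc i0)) (suffix n' (kn c)) ?K" by (simp only:)
    then have "agree J (suffix n' (kn c)) ?K" by (rule agree_mono) simp
    then show ?thesis by blast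
  qed
  define m where "m n = (v n c @ w n c)\<^sup>\<omega>" for n
  have m_K: "m n = v n c \<frown> c ## KN n c" for n
    unfolding m_def K by (rule iter_append) (use wv in blast)
  have m_0: "m n 0 = (\<not> c)" for n
    unfolding m_K using wv[of n c] by (cases "v n c") simp_all
  have m_mem: "m n \<in> lexset kn" for n
  proof -
    obtain l where l: "length (w n c) = Suc l" using wv[of n c] by (cases "w n c") simp_all
    have "m n = suffix (length (w n c)) ((w n c @ v n c)\<^sup>\<omega>)"
      unfolding m_def using wv[of n c] by (subst suffix_iter) (simp_all add: rotate_append)
    also have "\<dots> = suffix l (KN n c)" unfolding K[symmetric] l by (rule HOL.ext) simp
    finally show ?thesis using lexset_suffix[OF KN_mem] by (simp only:)
  qed
  \<comment> \<open>\<open>KN n c\<close> inherits the approach to \<open>?K\<close>, and the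
    extremal rotation \<open>m n\<close> is squeezed between the approaching tail and
    \<open>?K\<close>.\<close>
  have lim: "\<exists>N. \<forall>n\<ge>N. agree J (m n) ?K" for J
  proof -
    obtain k where k: "agree (Suc J) (suffix k (kn c)) ?K" using acc' by blast
    obtain N where N: "\<And>n. n \<ge> N \<Longrightarrow> agree (k + Suc J) (kn c) (KN n c)" using KN_lim by blast
    have "agree J (m n) ?K" if n: "n \<ge> N" for n
    proof -
      let ?y = "suffix k (KN n c)"
      have yk: "agree (Suc J) ?y ?K"
        by (rule agree_trans[OF agree_sym[OF agree_suffix[OF N[OF n]]] k])
      then have y0: "?y 0 = (\<not> c)" using yk[rule_format, of 0] by simp
      let ?W = "w n c @ v n c"
      have W: "?W \<noteq> []" using wv by blast
      have "?y = suffix (Suc k) (c ## KN n c)" by (rule HOL.ext) simp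
      then have yr: "?y = (rotate (Suc k) ?W)\<^sup>\<omega>" unfolding K suffix_iter[OF W] .
      have "rotate (Suc k) ?W \<noteq> []" using W by (simp del: rotate_Suc)
      then have "hd (rotate (Suc k) ?W) = (\<not> c)"
        using y0 iter_0 unfolding yr by metis
      then have "dle (\<not> c) ?y (m n)" using ext[of "Suc k" n c] unfolding yr m_def by blast
      moreover have "dle (\<not> c) (m n) ?K" by (rule dle_K[OF m_mem m_0])
      ultimately have "agree (Suc J) ?y (m n)" using yk by (rule dle_squeeze)
      then have "agree (Suc J) (m n) ?K" using agree_trans[OF agree_sym] yk by blast
      then show ?thesis by (rule agree_mono) simp
    qed
    then show ?thesis by blast
  qed
  \<comment> \<open>A length \<open>l\<close> recurring for arbitrarily large \<open>n\<close> would
    give \<open>?K = ?p \<frown> c ## kn c\<close> in the limit.\<close>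
  have "\<exists>N. \<forall>n\<ge>N. length (v n c) \<noteq> l" for l
  proof -
    let ?p = "prefix l ?K"
    obtain i where i: "?K i \<noteq> (?p \<frown> c ## kn c) i" using not_renorm[of c ?p] by blast
    obtain N1 where N1: "\<And>n. n \<ge> N1 \<Longrightarrow> agree (l + Suc i) (m n) ?K" using lim by blast
    obtain N2 where N2: "\<And>n. n \<ge> N2 \<Longrightarrow> agree (Suc i) (kn c) (KN n c)" using KN_lim by blast
    have "length (v n c) \<noteq> l" if n: "n \<ge> N1 + N2" for n
    proof
      assume l: "length (v n c) = l"
      have mk: "agree (l + Suc i) (m n) ?K" using N1 n by simp
      then have "agree l (m n) ?K" by (rule agree_mono) simp
      then have "prefix l (m n) = ?p" unfolding prefix_eq_iff .
      moreover have "prefix l (m n) = v n c" unfolding m_K l[symmetric] by (rule prefix_conc_length)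
      ultimately have mp: "m n = ?p \<frown> c ## KN n c" unfolding m_K by (simp only:)
      have "agree (Suc i) (kn c) (KN n c)" using N2 n by simp
      then have "agree (Suc (Suc i)) (c ## kn c) (c ## KN n c)" by (rule agree_build)
      then have "agree (Suc i) (c ## kn c) (c ## KN n c)" by (rule agree_mono) simp
      then have "agree (Suc i - length ?p) (c ## kn c) (c ## KN n c)" by (rule agree_mono) simp
      then have "agree (Suc i) (?p \<frown> c ## kn c) (m n)" unfolding mp agree_conc .
      then have "(?p \<frown> c ## kn c) i = m n i" by blast
      moreover have "m n i = ?K i" using mk by simp
      ultimately show False using i by simp
    qed
    then show ?thesis by blast
  qed
  then obtain N where N: "\<And>l n. n \<ge> N l \<Longrightarrow> length (v n c) \<noteq> l" by metis
  define N1 where "N1 = Max (N ` {..C})"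
  have N1: "length (v n c) > C" if "n \<ge> N1" for n
  proof (rule ccontr)
    assume "\<not> ?thesis"
    then have "length (v n c) \<le> C" by simp
    then have "N (length (v n c)) \<le> N1" unfolding N1_def by (intro Max_ge) auto
    then show False using N[of "length (v n c)" n] that by simp
  qed
  obtain N2 where N2: "\<And>n. n \<ge> N2 \<Longrightarrow> agree (Suc C) (m n) ?K" using lim by blast
  obtain N3 where N3: "\<And>n. n \<ge> N3 \<Longrightarrow> agree (Suc C) (kn (\<not> c)) (KN n (\<not> c))" using KN_lim by blast
  define n where "n = N\<^sub>0 + N1 + N2 + N3"
  let ?q = "w n (\<not> c)" and ?x = "(v n c)\<^sup>\<omega>" and ?Kn = "(\<not> c) ## KN n (\<not> c)"
  have vC: "length (v n c) > C" using N1 unfolding n_def by simp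
  have q: "length ?q \<le> C" and ndlt: "\<not> dlt c ?x (?q\<^sup>\<omega>)" using bounded[OF _ vC] unfolding n_def by simp_all
  have "agree (Suc (Suc C)) ?K ?Kn" by (rule agree_build[OF N3]) (simp add: n_def)
  then have KKn: "agree (Suc C) ?K ?Kn" by (rule agree_mono) simp
  have mK: "agree (Suc C) (m n) ?K" using N2 unfolding n_def by simp
  have xm: "agree (Suc C) ?x (m n)"
  proof (intro allI impI)
    fix i assume "i < Suc C"
    then have i: "i < length (v n c)" using vC by simp
    then have "?x i = v n c ! i" using wv[of n c] by simp
    moreover have "m n i = v n c ! i" unfolding m_K using i by (simp only: conc_fst)
    ultimately show "?x i = m n i" by simp
  qed
  have xKn: "agree (Suc C) ?x ?Kn" by (rule agree_trans[OF agree_trans[OF xm mK] KKn])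
  have Kn: "?Kn = (?q @ v n (\<not> c))\<^sup>\<omega>" by (rule K)
  have qn: "?q \<noteq> []" "hd ?q = (\<not> c)" "v n (\<not> c) \<noteq> []" "hd (v n (\<not> c)) = c" using wv[of n "\<not> c"] by auto
  have Kni: "?Kn i = (?q @ v n (\<not> c)) ! i" if "i \<le> length ?q" for i
  proof -
    have "i < length (?q @ v n (\<not> c))" using that qn(3) by (cases "v n (\<not> c)") simp_all
    then show ?thesis unfolding Kn using qn(1) by simp
  qed
  \<comment> \<open>\<open>?x\<close> begins with \<open>?q\<close> followed by \<open>c\<close>,
    whereas the repetition of \<open>?q\<close> continues with \<open>\<not> c\<close>.\<close>
  have "agree (length ?q) ?x (?q\<^sup>\<omega>)"
  proof (intro allI impI)
    fix i assume i: "i < length ?q"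
    then have "?x i = ?Kn i" using xKn q by simp
    also have "\<dots> = ?q ! i" using Kni[of i] i by (simp add: nth_append)
    also have "\<dots> = ?q\<^sup>\<omega> i" using i qn(1) by simp
    finally show "?x i = ?q\<^sup>\<omega> i" .
  qed
  moreover have "?x (length ?q) = c"
  proof -
    have "?x (length ?q) = ?Kn (length ?q)" using xKn q by simp
    also have "\<dots> = c" using Kni[of "length ?q"] qn(3,4) by (simp add: nth_append hd_conv_nth)
    finally show ?thesis .
  qed
  moreover have "?q\<^sup>\<omega> (length ?q) = (\<not> c)" using qn(1,2) by (simp add: hd_conv_nth)
  ultimately have "dlt c ?x (?q\<^sup>\<omega>)" unfolding dlt_def by blast
  then show False using ndlt by blast
qed

end

section \<open>The specification property\<close>

lemma LW_kneading:
  assumes "(\<alpha>, \<beta>) \<in> LW"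
  shows "kneading (\<lambda>c. if c then \<beta> else \<alpha>)"
proof
  have a: "\<alpha> \<in> Pset" and b: "\<beta> \<in> Pset_bar"
    and ab: "\<And>n. n \<ge> 1 \<Longrightarrow> \<beta> \<preceq>\<^sub>l suffix n \<alpha>" "\<And>n. n \<ge> 1 \<Longrightarrow> suffix n \<beta> \<preceq>\<^sub>l \<alpha>"
    using assms unfolding LW_def by auto
  have a0: "\<alpha> 0" and b0: "\<not> \<beta> 0" using a b unfolding Pset_def Pset_bar_def Sigma1_def Sigma0_def by auto
  show "(if c then \<beta> else \<alpha>) 0 = (\<not> c)" for c using a0 b0 by auto
  have lt: "\<beta> \<prec>\<^sub>l \<alpha>" unfolding less_fun_def using a0 b0 by (intro exI[of _ 0]) auto
  have mir: "less_fun (mirror x) (mirror y) \<longleftrightarrow> less_fun y x" for x y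
    unfolding less_fun_def mirror_def by auto
  have mir_eq: "mirror x = mirror y \<longleftrightarrow> x = y" for x y
    unfolding mirror_def fun_eq_iff by simp
  have mir_suf: "suffix n (mirror x) = mirror (suffix n x)" for n x
    unfolding mirror_def by (rule ext) simp
  have aa: "suffix n \<alpha> \<preceq>\<^sub>l \<alpha>" if "n \<ge> 1" for n using a that unfolding Pset_def by blast
  have bb: "\<beta> \<preceq>\<^sub>l suffix n \<beta>" if "n \<ge> 1" for n
  proof -
    have "suffix n (mirror \<beta>) \<preceq>\<^sub>l mirror \<beta>" using b that unfolding Pset_bar_def Pset_def by blast
    then show ?thesis unfolding mir_suf mir mir_eq by metis
  qed
  have "\<alpha> \<in> lexshift \<alpha> \<beta>"
    unfolding lexshift_def
  proof (intro CollectI allI)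
    show "\<beta> \<preceq>\<^sub>l suffix n \<alpha> \<and> suffix n \<alpha> \<preceq>\<^sub>l \<alpha>" for n
      using ab(1) aa lt by (cases "n = 0") auto
  qed
  moreover have "\<beta> \<in> lexshift \<alpha> \<beta>"
    unfolding lexshift_def
  proof (intro CollectI allI)
    show "\<beta> \<preceq>\<^sub>l suffix n \<beta> \<and> suffix n \<beta> \<preceq>\<^sub>l \<alpha>" for n
      using ab(2) bb lt by (cases "n = 0") auto
  qed
  ultimately show "(if c then \<beta> else \<alpha>) \<in> lexset (\<lambda>c. if c then \<beta> else \<alpha>)" for c
    unfolding lexset_lexshift by simp
qed

text \<open>Relabelling by digits: \<open>w False\<close> and \<open>v True\<close> compete for
  $p_1$, \<open>v False\<close> and \<open>w True\<close> for $p_2$.\<close>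

lemma is_p1_p2_words:
  assumes "is_p1_p2 A B p q"
  obtains w v :: "bool \<Rightarrow> bword" where
    "\<And>c. w c \<noteq> [] \<and> hd (w c) = c \<and> v c \<noteq> [] \<and> hd (v c) = (\<not> c)"
    "\<And>c. c ## (if c then B else A) = (w c @ v c)\<^sup>\<omega>"
    "\<And>c k. hd (rotate k (w c @ v c)) = (\<not> c) \<Longrightarrow> dle (\<not> c) ((rotate k (w c @ v c))\<^sup>\<omega>) ((v c @ w c)\<^sup>\<omega>)"
    "p = (if dlt False ((w False)\<^sup>\<omega>) ((v True)\<^sup>\<omega>) then v True else w False)"
    "q = (if dlt False ((w True)\<^sup>\<omega>) ((v False)\<^sup>\<omega>) then w True else v False)"
proof -
  from assms obtain \<omega>\<^sub>\<alpha> \<nu>\<^sub>\<alpha> \<omega>\<^sub>\<beta> \<nu>\<^sub>\<beta> where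
    pair: "associated_pair A B (\<omega>\<^sub>\<alpha> @ \<nu>\<^sub>\<alpha>) (\<nu>\<^sub>\<beta> @ \<omega>\<^sub>\<beta>)"
    and min: "is_1min (\<omega>\<^sub>\<alpha> @ \<nu>\<^sub>\<alpha>) (\<nu>\<^sub>\<alpha> @ \<omega>\<^sub>\<alpha>)" and max: "is_0max (\<nu>\<^sub>\<beta> @ \<omega>\<^sub>\<beta>) (\<omega>\<^sub>\<beta> @ \<nu>\<^sub>\<beta>)"
    and begins: "begins0 \<omega>\<^sub>\<alpha>" "begins1 \<nu>\<^sub>\<alpha>" "begins0 \<omega>\<^sub>\<beta>" "begins1 \<nu>\<^sub>\<beta>"
    and p: "p = (if \<omega>\<^sub>\<alpha>\<^sup>\<omega> \<prec>\<^sub>l \<omega>\<^sub>\<beta>\<^sup>\<omega> then \<omega>\<^sub>\<beta> else \<omega>\<^sub>\<alpha>)"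
    and q: "q = (if \<nu>\<^sub>\<beta>\<^sup>\<omega> \<prec>\<^sub>l \<nu>\<^sub>\<alpha>\<^sup>\<omega> then \<nu>\<^sub>\<beta> else \<nu>\<^sub>\<alpha>)"
    unfolding is_p1_p2_def by blast
  define w v where "w c = (if c then \<nu>\<^sub>\<beta> else \<omega>\<^sub>\<alpha>)" and "v c = (if c then \<omega>\<^sub>\<beta> else \<nu>\<^sub>\<alpha>)" for c
  show thesis
  proof (rule that[of w v])
    show "w c \<noteq> [] \<and> hd (w c) = c \<and> v c \<noteq> [] \<and> hd (v c) = (\<not> c)" for c
      using begins unfolding w_def v_def begins0_def begins1_def by auto
    show "c ## (if c then B else A) = (w c @ v c)\<^sup>\<omega>" for c
      using pair unfolding associated_pair_def shortest_period_word_def w_def v_def by auto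
    show "p = (if dlt False ((w False)\<^sup>\<omega>) ((v True)\<^sup>\<omega>) then v True else w False)"
      unfolding p w_def v_def dlt_less_fun by simp
    show "q = (if dlt False ((w True)\<^sup>\<omega>) ((v False)\<^sup>\<omega>) then w True else v False)"
      unfolding q w_def v_def dlt_less_fun by simp
    fix c k
    assume hd: "hd (rotate k (w c @ v c)) = (\<not> c)"
    have len: "length (rotate k (w c @ v c)) = length (v c @ w c)" by simp
    have ne: "rotate k (w c @ v c) \<noteq> []" using begins unfolding w_def begins0_def begins1_def by auto
    have "rotate k (w c @ v c) = v c @ w c \<or> word_dlt (\<not> c) (rotate k (w c @ v c)) (v c @ w c)"
      unfolding word_dlt_lexordp[OF len]
      using hd ne min max unfolding is_1min_def is_0max_def begins0_def begins1_def w_def v_def by (cases c) auto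
    then show "dle (\<not> c) ((rotate k (w c @ v c))\<^sup>\<omega>) ((v c @ w c)\<^sup>\<omega>)"
      unfolding dle_def using word_dlt_iter by metis
  qed
qed

text \<open>Such a \<open>u\<close> would be the finite word of a renormalisation by an infinite
  sequence; \<open>prefix_extremal\<close> makes it 0-max or 1-min.\<close>

lemma (in kneading) not_renormalisable_by_sequence:
  assumes nr: "\<not> renormalisable_by_sequence (kn False) (kn True)"
  shows "(\<not> c) ## kn (\<not> c) \<noteq> u \<frown> c ## kn c"
proof
  assume eq: "(\<not> c) ## kn (\<not> c) = u \<frown> c ## kn c"
  have u: "u \<noteq> []"
  proof
    assume "u = []"
    then have "((\<not> c) ## kn (\<not> c)) 0 = (c ## kn c) 0" using eq by (simp only: conc_empty)
    then show False by simp
  qed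
  have hdu: "hd u = (\<not> c)" using fun_cong[OF eq, of 0] u by (cases u) simp_all
  have ext: "rotate k u = u \<or> word_dlt (\<not> c) (rotate k u) u" if "hd (rotate k u) = (\<not> c)" for k
    by (rule prefix_extremal[OF eq u _ that]) simp
  have rot0: "u = rotate 0 u" by simp
  show False
  proof (cases c)
    case True
    have "is_0max u u"
      unfolding is_0max_def begins0_def
      using u hdu ext word_dlt_lexordp[of _ u False] True rot0 by (metis (full_types) length_rotate)
    then show False using nr eq True unfolding renormalisable_by_sequence_def by auto
  next
    case False
    have "is_1min u u"
      unfolding is_1min_def begins1_def
      using u hdu ext word_dlt_lexordp[of _ u True] False rot0 by (metis (full_types) length_rotate)
    then show False using nr eq False unfolding renormalisable_by_sequence_def by auto
  qed
qed

theorem theorem6p2: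
  fixes \<alpha> \<beta> :: bseq and A B :: "nat \<Rightarrow> bseq" and p1 p2 :: "nat \<Rightarrow> bword"
  assumes "(\<alpha>, \<beta>) \<in> LW"
    and "\<not> renormalisable \<alpha> \<beta>"
    and "coded \<alpha> \<beta>"
    and "approximating_sequence \<alpha> \<beta> A B"
    and "\<And>n. is_p1_p2 (A n) (B n) (p1 n) (p2 n)"
    and "\<exists>N. \<forall>n\<ge>N. p1 n @ p2 n = p1 N @ p2 N"
  shows "specification_property (lexshift \<alpha> \<beta>)"
proof -
  define kn where "kn = (\<lambda>c. if c then \<beta> else \<alpha>)"
  define KN where "KN n = (\<lambda>c. if c then B n else A n)" for n
  have S: "lexset kn = lexshift \<alpha> \<beta>" "lexset (KN n) = lexshift (A n) (B n)" for n
    unfolding kn_def KN_def by (rule lexset_lexshift)+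
  interpret kneading kn unfolding kn_def by (rule LW_kneading[OF assms(1)])
  have clos: "lexshift \<alpha> \<beta> = closure (\<Union>n. lexshift (A n) (B n))"
    and approx: "(A n, B n) \<in> LW \<and> essential (A n) (B n) \<and>
          transitive_shift (lexshift (A n) (B n)) \<and> finite_type (lexshift (A n) (B n)) \<and>
          lexshift (A n) (B n) \<subseteq> lexshift (A (Suc n)) (B (Suc n))" for n
    using assms(4) unfolding approximating_sequence_def by blast+
  have lims: "(periodic \<alpha> \<longrightarrow> (\<forall>n. A n = \<alpha>)) \<and> (\<not> periodic \<alpha> \<longrightarrow> A \<longlonglongrightarrow> \<alpha>) \<and>
    (periodic \<beta> \<longrightarrow> (\<forall>n. B n = \<beta>)) \<and> (\<not> periodic \<beta> \<longrightarrow> B \<longlonglongrightarrow> \<beta>)"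
    using assms(4) unfolding approximating_sequence_def by blast
  have const: "KN n c = kn c" if "periodic (kn c)" for n c
    using that lims unfolding kn_def KN_def by (cases c) auto
  interpret approximated_kneading kn KN
  proof (intro approximated_kneading.intro approximated_kneading_axioms.intro)
    show "kneading kn" by (rule kneading_axioms)
    show "kneading (KN n)" for n unfolding KN_def using approx LW_kneading by blast
    show "transitive_shift (lexset (KN n))" "finite_type (lexset (KN n))"
      "lexset (KN n) \<subseteq> lexset (KN (Suc n))" for n
      unfolding S using approx by blast+
    show "lexset kn = closure (\<Union>n. lexset (KN n))" unfolding S by (rule clos)
    show "periodic (KN n c)" for n c using approx unfolding KN_def essential_def by auto
    show "\<exists>N. \<forall>n\<ge>N. agree m (kn c) (KN n c)" for m c
    proof (cases "periodic (kn c)")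
      case True
      then show ?thesis using const by simp
    next
      case False
      then have "(\<lambda>n. KN n c) \<longlonglongrightarrow> kn c" using lims unfolding kn_def KN_def by (cases c) auto
      then show ?thesis by (rule LIMSEQ_agree)
    qed
  qed

  define Q where "Q n w v \<longleftrightarrow> (\<forall>c. w c \<noteq> [] \<and> hd (w c) = c \<and> v c \<noteq> [] \<and> hd (v c) = (\<not> c)) \<and>
      (\<forall>c. c ## KN n c = (w c @ v c)\<^sup>\<omega>) \<and>
      (\<forall>c k. hd (rotate k (w c @ v c)) = (\<not> c) \<longrightarrow> dle (\<not> c) ((rotate k (w c @ v c))\<^sup>\<omega>) ((v c @ w c)\<^sup>\<omega>)) \<and>
      p1 n = (if dlt False ((w False)\<^sup>\<omega>) ((v True)\<^sup>\<omega>) then v True else w False) \<and>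
      p2 n = (if dlt False ((w True)\<^sup>\<omega>) ((v False)\<^sup>\<omega>) then w True else v False)"
    for n and w v :: "bool \<Rightarrow> bword"
  have "\<exists>w v. Q n w v" for n
    unfolding Q_def KN_def by (rule is_p1_p2_words[OF assms(5)[of n]]) blast
  then obtain w v where Q: "\<And>n. Q n (w n) (v n)" by metis
  note Q' = Q[unfolded Q_def]
  have wv: "w n c \<noteq> [] \<and> hd (w n c) = c \<and> v n c \<noteq> [] \<and> hd (v n c) = (\<not> c)"
    and K: "c ## KN n c = (w n c @ v n c)\<^sup>\<omega>" for n c
    using Q'[of n] by blast+
  have ext: "dle (\<not> c) ((rotate k (w n c @ v n c))\<^sup>\<omega>) ((v n c @ w n c)\<^sup>\<omega>)"
    if "hd (rotate k (w n c @ v n c)) = (\<not> c)" for n c k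
    using Q'[of n] that by blast
  have p1: "p1 n = (if dlt False ((w n False)\<^sup>\<omega>) ((v n True)\<^sup>\<omega>) then v n True else w n False)"
    and p2: "p2 n = (if dlt False ((w n True)\<^sup>\<omega>) ((v n False)\<^sup>\<omega>) then w n True else v n False)" for n
    using Q'[of n] by blast+
  obtain N\<^sub>0 where N\<^sub>0: "\<And>n. n \<ge> N\<^sub>0 \<Longrightarrow> p1 n @ p2 n = p1 N\<^sub>0 @ p2 N\<^sub>0" using assms(6) by blast
  define C where "C = length (p1 N\<^sub>0 @ p2 N\<^sub>0)"
  \<comment> \<open>The constant concatenation bounds both words by \<open>C\<close>. A longer
    \<open>v n c\<close> has lost its comparison, so \<open>w n (\<not> c)\<close> is the word
    chosen.\<close>
  have bounded: "length (w n (\<not> c)) \<le> C \<and> \<not> dlt c ((v n c)\<^sup>\<omega>) ((w n (\<not> c))\<^sup>\<omega>)"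
    if n: "n \<ge> N\<^sub>0" and long: "length (v n c) > C" for n c
  proof -
    have len: "length (p1 n) \<le> C" "length (p2 n) \<le> C"
      using arg_cong[OF N\<^sub>0[OF n], of length] unfolding C_def by simp_all
    show ?thesis
    proof (cases c)
      case True
      then have nl: "\<not> dlt False ((w n False)\<^sup>\<omega>) ((v n True)\<^sup>\<omega>)" using long len(1) p1[of n] by (auto split: if_splits)
      then have "p1 n = w n False" using p1 by simp
      moreover have "\<not> dlt True ((v n True)\<^sup>\<omega>) ((w n False)\<^sup>\<omega>)" using nl unfolding dlt_less_fun by simp
      ultimately show ?thesis using len(1) True by simp
    next
      case False
      then have l: "dlt False ((w n True)\<^sup>\<omega>) ((v n False)\<^sup>\<omega>)" using long len(2) p2[of n] by (auto split: if_splits)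
      then have "p2 n = w n True" using p2 by simp
      moreover have "\<not> dlt False ((v n False)\<^sup>\<omega>) ((w n True)\<^sup>\<omega>)"
        using l dlt_trans dlt_irrefl by blast
      ultimately show ?thesis using len(2) False by simp
    qed
  qed
  \<comment> \<open>A constant \<open>kn c\<close> would equal \<open>KN 0 c\<close>, but
    \<open>c\<close> followed by \<open>\<not> c\<close> forever is not a periodic repetition of a
    word.\<close>
  have nonconst: "\<exists>i. kn c i = c" for c
  proof (rule ccontr)
    assume "\<not> ?thesis"
    then have all: "kn c i = (\<not> c)" for i by blast
    have "suffix 1 (kn c) = kn c" by (rule HOL.ext) (simp only: suffix_nth all)
    then have "periodic (kn c)" unfolding periodic_def by blast
    then have "KN 0 c = kn c" by (rule const)
    let ?W = "w 0 c @ v 0 c"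
    obtain l where l: "length ?W = Suc l" using wv[of 0 c] by (cases "w 0 c") simp_all
    have "(c ## KN 0 c) (length ?W) = (\<not> c)" unfolding l \<open>KN 0 c = kn c\<close> using all by simp
    moreover have "?W\<^sup>\<omega> (length ?W) = ?W ! 0" using l by simp
    moreover have "?W ! 0 = c" using wv[of 0 c] by (cases "w 0 c") simp_all
    ultimately show False unfolding K by simp
  qed
  have nrs: "\<not> renormalisable_by_sequence (kn False) (kn True)"
    and nrw: "\<not> renormalisable_by_words (kn False) (kn True)"
    using assms(2) unfolding renormalisable_def kn_def by simp_all
  have "\<exists>J. \<forall>n. \<not> agree J (suffix n (kn c)) (kn (\<not> c))" for c
    by (rule no_accumulation[OF wv K ext nonconst not_renormalisable_by_sequence[OF nrs] bounded])
  then obtain J where J: "\<not> agree (J c) (suffix n (kn c)) (kn (\<not> c))" for n c by metis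
  have sep: "\<not> agree (J True + J False) (suffix n (kn c)) (kn (\<not> c))" for n c
  proof
    assume "agree (J True + J False) (suffix n (kn c)) (kn (\<not> c))"
    then have "agree (J c) (suffix n (kn c)) (kn (\<not> c))" by (rule agree_mono) (cases c; simp)
    then show False using J by blast
  qed
  interpret coded_kneading kn "J True + J False"
    by unfold_locales (rule sep, fact transitive, fact reaches_periodic)

  define R where "R = {length (hub False @ t) |t. cut (hub False @ t)}"
  obtain t\<^sub>0 where "cut (hub False @ t\<^sub>0)" using cut_extend[OF hub_language] .
  then have "length (hub False @ t\<^sub>0) \<in> R" unfolding R_def by blast
  moreover have "0 \<notin> R" unfolding R_def by auto
  moreover have "a + b \<in> R" if ab: "a \<in> R" "b \<in> R" for a b
  proof -
    obtain s t where s: "cut (hub False @ s)" "a = length (hub False @ s)"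
      and t: "cut (hub False @ t)" "b = length (hub False @ t)" using ab unfolding R_def by blast
    have "cut (hub False @ s @ hub False @ t)" using cut_append_hub[OF s(1) t(1)] by simp
    moreover have "a + b = length (hub False @ s @ hub False @ t)" unfolding s(2) t(2) by simp
    ultimately show ?thesis unfolding R_def by blast
  qed
  ultimately have "(\<exists>N. \<forall>n\<ge>N. n \<in> R) \<or> (\<exists>d\<ge>2. \<forall>s\<in>R. d dvd s)" by (rule additive_nat_set_cases)
  then obtain N where N: "\<And>n. n \<ge> N \<Longrightarrow> n \<in> R"
  proof (elim disjE exE conjE)
    fix d :: nat assume d: "d \<ge> 2" "\<forall>s\<in>R. d dvd s"
    interpret periodic_kneading kn "J True + J False" d
      by unfold_locales (use d R_def in blast)+
    show ?thesis using renormalisable nrw by blast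
  qed blast
  have "\<exists>t. cut (hub False @ t) \<and> length (hub False @ t) = n" if "n \<ge> N" for n
    using N[OF that] unfolding R_def by blast
  from specification_if_aperiodic[OF this]
  obtain M where M: "M \<ge> 1" "\<And>u v. language_prefix u \<Longrightarrow> language_prefix v \<Longrightarrow>
    \<exists>w. length w = M \<and> language_prefix (u @ w @ v)" by blast
  have lang: "u \<in> language (lexset kn) \<longleftrightarrow> u \<noteq> [] \<and> language_prefix u" for u
    unfolding language_lexset language_prefix_def ..
  have spec: "\<exists>w\<in>language (lexset kn). length w = M \<and> u @ w @ v \<in> language (lexset kn)"
    if uv: "u \<in> language (lexset kn)" "v \<in> language (lexset kn)" for u v
  proof -
    obtain w where w: "length w = M" "language_prefix (u @ w @ v)" using M(2) uv lang by blast
    then obtain x where "(u @ w @ v) \<frown> x \<in> lexset kn" unfolding language_prefix_def by blast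
    then have "u \<frown> w \<frown> v \<frown> x \<in> lexset kn" by (simp only: conc_conc append_assoc)
    then have "language_prefix w" using lexset_conc_D language_prefixI by blast
    moreover have "w \<noteq> []" using w(1) M(1) by auto
    ultimately show ?thesis using w uv lang by auto
  qed
  then show ?thesis unfolding S(1)[symmetric] specification_property_def transitive_shift_def
    using M(1) by blast
qed

end
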